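(* Every graph $G=(V,E)$ with maximum degree $\Delta$ admits an acyclic edge coloring with any number $q>4(\Delta-1)$ of colors. Moreover, such a coloring can be found in $O(|E|\,|V|\,\Delta)$ time with high probability.
   Context: An edge coloring is proper if all edges incident to each vertex receive distinct colors. A proper edge coloring is acyclic if no cycle is bichromatic, i.e., no cycle receives exactly two (alternating) colors. *)

theory Defs
  imports "HOL-Probability.Probability"
begin

section \<open>Acyclic edge colorings of finite simple graphs\<close>

text \<open>A graph is a set of vertices with a set of edges, an edge being a two-element set of vertices.\<close>

definition sgraph :: "'a set \<Rightarrow> 'a set set \<Rightarrow> bool" where
  "sgraph V E \<longleftrightarrow> finite V \<and> (\<forall>e\<in>E. e \<subseteq> V \<and> card e = 2)"

text \<open>The element \<open>0\<close> only matters for the graph without vertices, whose maximum degree is \<open>0\<close>.\<close>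

definition max_degree :: "'a set \<Rightarrow> 'a set set \<Rightarrow> nat" where
  "max_degree V E = Max (insert 0 ((\<lambda>v. card {e \<in> E. v \<in> e}) ` V))"

definition proper_edge_coloring :: "'a set \<Rightarrow> 'a set set \<Rightarrow> ('a set \<Rightarrow> 'c) \<Rightarrow> bool" where
  "proper_edge_coloring V E \<phi> \<longleftrightarrow> (\<forall>v\<in>V. inj_on \<phi> {e \<in> E. v \<in> e})"

text \<open>A cycle is given by the list of its (distinct) vertices in cyclic order.\<close>

definition cycle_edges :: "'a list \<Rightarrow> 'a set set" where
  "cycle_edges vs = (\<lambda>i. {vs ! i, vs ! (Suc i mod length vs)}) ` {..<length vs}"

definition is_cycle :: "'a set set \<Rightarrow> 'a list \<Rightarrow> bool" where
  "is_cycle E vs \<longleftrightarrow> 3 \<le> length vs \<and> distinct vs \<and> cycle_edges vs \<subseteq> E"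

text \<open>In a proper coloring the two colors of a bichromatic cycle necessarily alternate.\<close>

definition bichromatic :: "('a set \<Rightarrow> 'c) \<Rightarrow> 'a list \<Rightarrow> bool" where
  "bichromatic \<phi> vs \<longleftrightarrow> card (\<phi> ` cycle_edges vs) = 2"

definition acyclic_edge_coloring ::
    "'a set \<Rightarrow> 'a set set \<Rightarrow> nat \<Rightarrow> ('a set \<Rightarrow> nat) \<Rightarrow> bool" where
  "acyclic_edge_coloring V E q \<phi> \<longleftrightarrow>
     \<phi> ` E \<subseteq> {..<q} \<and> proper_edge_coloring V E \<phi> \<and>
     \<not> (\<exists>vs. is_cycle E vs \<and> bichromatic \<phi> vs)"

section \<open>Randomized random access machines\<close>

text \<open>
  The machine has registers and a memory, both indexed by natural numbers; a program names only
  finitely many registers, while memory is addressed indirectly through register contents.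
  Every executed instruction takes one time step, and so does every evaluation of the guard of a
  loop or conditional. A register is regarded as true if it is nonzero.

  To keep the unit-cost measure honest, arithmetic is limited to addition and (truncated)
  subtraction, and registers only hold numbers below a word bound \<open>B\<close>.
\<close>

datatype instr =
    Const nat nat                     \<comment> \<open>\<open>Const i c\<close>: \<open>r i := c\<close>\<close>
  | Add nat nat nat                   \<comment> \<open>\<open>Add i j l\<close>: \<open>r i := r j + r l\<close>\<close>
  | Sub nat nat nat                   \<comment> \<open>\<open>Sub i j l\<close>: \<open>r i := r j - r l\<close>\<close>
  | Load nat nat                      \<comment> \<open>\<open>Load i j\<close>: \<open>r i := M (r j)\<close>\<close>
  | Store nat nat                     \<comment> \<open>\<open>Store i j\<close>: \<open>M (r i) := r j\<close>\<close>
  | Rand nat nat                      \<comment> \<open>\<open>Rand i j\<close>: \<open>r i :=\<close> a uniformly random number below \<open>r j\<close>\<close>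
  | If nat "instr list" "instr list"
  | While nat "instr list"

text \<open>A configuration: the instructions still to be executed, the registers, the memory.\<close>

type_synonym config = "instr list \<times> (nat \<Rightarrow> nat) \<times> (nat \<Rightarrow> nat)"

text \<open>
  Assigning a number that is not below the word bound, like choosing a random number below \<open>0\<close>,
  is a fault. A faulting instruction leaves the configuration unchanged, so that the machine
  never halts.
\<close>

definition assign :: "nat \<Rightarrow> nat \<Rightarrow> nat \<Rightarrow> config \<Rightarrow> config" where
  "assign B i x = (\<lambda>(p, r, M). if x < B then (tl p, r(i := x), M) else (p, r, M))"

fun step :: "nat \<Rightarrow> config \<Rightarrow> config pmf" where
  "step B ([], r, M) = return_pmf ([], r, M)"
| "step B (Const i c # p, r, M) = return_pmf (assign B i c (Const i c # p, r, M))"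
| "step B (Add i j l # p, r, M) = return_pmf (assign B i (r j + r l) (Add i j l # p, r, M))"
| "step B (Sub i j l # p, r, M) = return_pmf (assign B i (r j - r l) (Sub i j l # p, r, M))"
| "step B (Load i j # p, r, M) = return_pmf (assign B i (M (r j)) (Load i j # p, r, M))"
| "step B (Store i j # p, r, M) = return_pmf (p, r, M(r i := r j))"
| "step B (Rand i j # p, r, M) =
     (if r j = 0 then return_pmf (Rand i j # p, r, M)
      else map_pmf (\<lambda>x. assign B i x (Rand i j # p, r, M)) (pmf_of_set {..<r j}))"
| "step B (If i p1 p2 # p, r, M) = return_pmf ((if r i \<noteq> 0 then p1 else p2) @ p, r, M)"
| "step B (While i p1 # p, r, M) =
     return_pmf (if r i \<noteq> 0 then p1 @ While i p1 # p else p, r, M)"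

text \<open>
  The distribution of the configuration after \<open>t\<close> time steps. A halted configuration (one with no
  instructions left) no longer changes.
\<close>

fun run :: "nat \<Rightarrow> nat \<Rightarrow> config \<Rightarrow> config pmf" where
  "run B 0 cfg = return_pmf cfg"
| "run B (Suc t) cfg = bind_pmf (step B cfg) (run B t)"

section \<open>Edge coloring as a computational problem\<close>

text \<open>A graph on the vertices \<open>0, \<dots>, n - 1\<close> is presented by a list of its edges, in any order and
  with the endpoints of each edge in any order.\<close>

definition edge :: "nat \<times> nat \<Rightarrow> nat set" where
  "edge = (\<lambda>(u, v). {u, v})"

definition edge_list :: "nat set set \<Rightarrow> (nat \<times> nat) list \<Rightarrow> bool" where
  "edge_list E es \<longleftrightarrow> distinct (map edge es) \<and> set (map edge es) = E"

text \<open>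
  Initially registers \<open>0\<close>, \<open>1\<close>, \<open>2\<close> contain the number of vertices, the number of edges and the
  number of colors, and memory cells \<open>2 * i\<close> and \<open>2 * i + 1\<close> contain the endpoints of the \<open>i\<close>-th
  edge; everything else is zero.
\<close>

definition initial :: "instr list \<Rightarrow> nat \<Rightarrow> (nat \<times> nat) list \<Rightarrow> nat \<Rightarrow> config" where
  "initial P n es q =
     (P,
      (\<lambda>i. if i = 0 then n else if i = 1 then length es else if i = 2 then q else 0),
      (\<lambda>a. if a < 2 * length es
           then (if even a then fst else snd) (es ! (a div 2)) else 0))"

text \<open>
  The machine has halted and memory cell \<open>2 * m + i\<close>, where \<open>m\<close> is the number of edges, contains the
  color of the \<open>i\<close>-th edge, for each \<open>i < m\<close>.
\<close>

definition outputs_coloring ::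
    "(nat \<times> nat) list \<Rightarrow> (nat set \<Rightarrow> nat) \<Rightarrow> config \<Rightarrow> bool" where
  "outputs_coloring es \<phi> = (\<lambda>(p, r, M).
     p = [] \<and> (\<forall>i < length es. M (2 * length es + i) = \<phi> (edge (es ! i))))"

text \<open>
  The program \<open>P\<close> finds acyclic edge colorings for all admissible numbers of colors in time
  \<open>O(|E| |V| \<Delta>)\<close> with high probability. The constant in the \<open>O\<close> is uniform in the graph and in the
  number of colors; the summand \<open>1\<close> accounts for graphs without edges and is otherwise absorbed by
  that constant. High probability means probability at least \<open>1 - |V|\<^sup>-\<^sup>c\<close>, where the exponent
  \<open>c\<close> can be made as large as desired at the expense of the constant in the \<open>O\<close> alone. Words are
  polynomially bounded, that is, they have \<open>O(log (|V| + |E| + q))\<close> bits.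
\<close>

definition finds_acyclic_edge_colorings_whp :: "instr list \<Rightarrow> bool" where
  "finds_acyclic_edge_colorings_whp P \<longleftrightarrow>
     (\<exists>k. \<forall>c. \<exists>C. \<forall>n E es q.
        sgraph {..<n} E \<longrightarrow> edge_list E es \<longrightarrow> int q > 4 * (int (max_degree {..<n} E) - 1) \<longrightarrow>
        measure_pmf.prob
          (run ((n + card E + q + 2) ^ k) (C * (card E * n * max_degree {..<n} E + 1))
            (initial P n es q))
          {cfg. \<exists>\<phi>. acyclic_edge_coloring {..<n} E q \<phi> \<and> outputs_coloring es \<phi> cfg}
        \<ge> 1 - 1 / real n ^ c)"

end

theory Submission
  imports Defs
begin

text \<open>
  The coloring is found by backtracking. In each round the first uncolored edge \<open>e = uv\<close> draws one of
  the \<open>q\<close> colors at random. If that color is present at \<open>u\<close> or \<open>v\<close>, or closes a bichromatic 4-cycle,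
  nothing happens; this excludes at most \<open>2 (\<Delta> - 1)\<close> colors, because every such 4-cycle comes with a
  color that is present at both \<open>u\<close> and \<open>v\<close>. If the color closes a longer bichromatic cycle, all edges
  of the cycle except two consecutive ones lose their colors. Otherwise \<open>e\<close> receives the color.

  The analysis is by entropy compression: the history is determined by the final coloring and the
  uncolored paths, for which there are at most \<open>\<Delta> - 1\<close> choices per edge. If the two surviving edges
  are chosen naively, this yields a failure probability decaying by a factor \<open>1 - O(1/\<Delta>)\<close> per round,
  which proves existence but is too slow for the time bound. A constant decay rate is gained as
  follows. The surviving edges \<open>az\<close> and \<open>zb\<close> are reconstructed from the color of \<open>az\<close>, and that color is
  missing at all vertices of the cycle other than \<open>a\<close> and \<open>z\<close>, since the two colors of the cycle were
  present at all of them and have been erased. For five suitable positions of \<open>(a, z)\<close> on the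
  cycle the sets of such private colors of \<open>a\<close> are disjoint, so they cannot all have almost
  \<open>\<Delta> - 1\<close> elements among about \<open>4 (\<Delta> - 1)\<close> colors. The position is therefore drawn at random, and
  drawn anew if a random test color is private to \<open>a\<close>; this makes positions with many private colors,
  and hence with many possible predecessors, less likely.

  Consequently \<open>O(|E| + c |V|)\<close> rounds suffice, and in a round at most \<open>\<Delta>\<close> alternating paths have
  to be followed, each of length at most \<open>min |V| |E|\<close>.
\<close>

section \<open>Partial edge colorings and alternating paths\<close>

text \<open>Let \<open>y = D / q\<close> and give every uncolored edge the weight \<open>x\<close>.
  With a naive choice of the surviving edges, one round multiplies the total weight of the histories
  by \<open>2 * y + 1 / x + y * (\<Sum>L. (x * y) ^ (L - 2))\<close>, summed over odd
  \<open>L\<close> from \<open>5\<close> on: stalling, coloring an edge, and erasing a cycle with at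
  most \<open>D\<close> predecessors for each trace. At \<open>y = 1/4\<close> the minimum over
  \<open>x\<close> is exactly 1, attained at \<open>x = 2 * (sqrt 5 - 1)\<close>, about 2.47. Thus
  \<open>4 * D < q\<close> is precisely the critical threshold, and the naive slack vanishes as
  \<Delta> grows. The second draw of the position lowers the number of predecessors times the
  probability of the pattern, summed over the patterns, from \<open>D\<close> to about
  \<open>(6/5 - y) * D\<close>; at the threshold this is the factor 0.95 from which the constant
  rate comes. Histories are never enumerated. The induction pushes a weight function on all
  colorings with one common uncolored set \<open>U\<close> through a single round; the bound
  \<open>h / q ^ (m - card U)\<close> on the weights is reproduced, with a new \<open>h\<close>, by
  every kind of move.\<close>

text \<open>The edges are numbered \<open>0, \<dots>, m - 1\<close>, and \<open>D\<close> stands for \<open>\<Delta> - 1\<close>.\<close>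

locale coloring_instance =
  fixes m :: nat and p r :: "nat \<Rightarrow> 'v" and q D :: nat
  assumes ends_distinct: "i < m \<Longrightarrow> p i \<noteq> r i"
    and ends_inj: "i < m \<Longrightarrow> j < m \<Longrightarrow> {p i, r i} = {p j, r j} \<Longrightarrow> i = j"
    and degree: "card {i. i < m \<and> w \<in> {p i, r i}} \<le> Suc D"
    and colors: "0 < m \<Longrightarrow> 4 * D < q"
begin

definition ends :: "nat \<Rightarrow> 'v set" where
  "ends i = {p i, r i}"

definition other :: "nat \<Rightarrow> 'v \<Rightarrow> 'v" where
  "other i w = (if w = p i then r i else p i)"

fun walk :: "'v \<Rightarrow> nat list \<Rightarrow> bool" where
  "walk x [] = True"
| "walk x (i # fs) = (i < m \<and> x \<in> ends i \<and> walk (other i x) fs)"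

fun vend :: "'v \<Rightarrow> nat list \<Rightarrow> 'v" where
  "vend x [] = x"
| "vend x (i # fs) = vend (other i x) fs"

definition vtx :: "'v \<Rightarrow> nat list \<Rightarrow> nat \<Rightarrow> 'v" where
  "vtx x fs k = vend x (take k fs)"

lemma other_ends:
  assumes "w \<in> ends i"
  shows "other i w \<in> ends i" "other i (other i w) = w" "ends i = {w, other i w}"
  using assms by (auto simp: ends_def other_def)

lemma other_neq: "i < m \<Longrightarrow> w \<in> ends i \<Longrightarrow> other i w \<noteq> w"
  using ends_distinct[of i] by (auto simp: ends_def other_def)

lemma ends_eqD: "i < m \<Longrightarrow> j < m \<Longrightarrow> ends i = ends j \<Longrightarrow> i = j"
  using ends_inj by (auto simp: ends_def)

lemma walk_append: "walk x (as @ bs) \<longleftrightarrow> walk x as \<and> walk (vend x as) bs"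
  by (induction as arbitrary: x) auto

lemma vend_append: "vend x (as @ bs) = vend (vend x as) bs"
  by (induction as arbitrary: x) auto

lemma walk_rev: "walk x fs \<Longrightarrow> walk (vend x fs) (rev fs) \<and> vend (vend x fs) (rev fs) = x"
  by (induction fs arbitrary: x) (auto simp: walk_append vend_append other_ends)

lemma vtx_0 [simp]: "vtx x fs 0 = x"
  by (simp add: vtx_def)

lemma vtx_Suc: "k < length fs \<Longrightarrow> vtx x fs (Suc k) = other (fs ! k) (vtx x fs k)"
  by (simp add: vtx_def take_Suc_conv_app_nth vend_append)

lemma walk_take: "walk x fs \<Longrightarrow> walk x (take k fs)"
  by (metis append_take_drop_id walk_append)

lemma walk_nth:
  assumes "walk x fs" "k < length fs"
  shows "fs ! k < m" "vtx x fs k \<in> ends (fs ! k)" "vtx x fs (Suc k) \<in> ends (fs ! k)"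
    "ends (fs ! k) = {vtx x fs k, vtx x fs (Suc k)}" "vtx x fs k \<noteq> vtx x fs (Suc k)"
proof -
  have "walk (vend x (take k fs)) (drop k fs)"
    using assms by (metis append_take_drop_id walk_append)
  then have "walk (vtx x fs k) (fs ! k # drop (Suc k) fs)"
    using assms by (simp add: vtx_def Cons_nth_drop_Suc)
  then show *: "fs ! k < m" "vtx x fs k \<in> ends (fs ! k)" by auto
  show "vtx x fs (Suc k) \<in> ends (fs ! k)" "ends (fs ! k) = {vtx x fs k, vtx x fs (Suc k)}"
    using * assms by (auto simp: vtx_Suc other_ends)
  show "vtx x fs k \<noteq> vtx x fs (Suc k)"
    using * assms other_neq[of "fs ! k" "vtx x fs k"] by (auto simp: vtx_Suc)
qed

lemma vtx_append1: "k \<le> length as \<Longrightarrow> vtx x (as @ bs) k = vtx x as k"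
  by (simp add: vtx_def)

lemma vtx_length: "vtx x fs (length fs) = vend x fs"
  by (simp add: vtx_def)

lemma vtx_rev:
  assumes "walk x fs" "k \<le> length fs"
  shows "vtx x fs k = vtx (vend x fs) (rev fs) (length fs - k)"
proof -
  have 1: "walk (vend x (take k fs)) (drop k fs)"
    using assms by (metis append_take_drop_id walk_append)
  have 2: "vend x fs = vend (vend x (take k fs)) (drop k fs)"
    by (metis append_take_drop_id vend_append)
  have "take (length fs - k) (rev fs) = rev (drop k fs)"
    using assms by (simp add: take_rev)
  then show ?thesis using walk_rev[OF 1] 2 by (simp add: vtx_def)
qed

definition proper :: "(nat \<Rightarrow> nat option) \<Rightarrow> bool" where
  "proper \<sigma> \<longleftrightarrow> (\<forall>i<m. \<forall>j<m. \<forall>\<kappa>. \<sigma> i = Some \<kappa> \<longrightarrow> \<sigma> j = Some \<kappa> \<longrightarrow> ends i \<inter> ends j \<noteq> {} \<longrightarrow> i = j)"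

definition pcolorings :: "(nat \<Rightarrow> nat option) set" where
  "pcolorings = {\<sigma>. dom \<sigma> \<subseteq> {..<m} \<and> ran \<sigma> \<subseteq> {..<q} \<and> proper \<sigma>}"

definition cols :: "(nat \<Rightarrow> nat option) \<Rightarrow> 'v \<Rightarrow> nat set" where
  "cols \<sigma> w = {\<kappa>. \<exists>i<m. \<sigma> i = Some \<kappa> \<and> w \<in> ends i}"

definition altpath :: "(nat \<Rightarrow> nat option) \<Rightarrow> nat \<Rightarrow> nat \<Rightarrow> 'v \<Rightarrow> nat list \<Rightarrow> bool" where
  "altpath \<sigma> a b x fs \<longleftrightarrow>
     walk x fs \<and> (\<forall>k<length fs. \<sigma> (fs ! k) = Some (if even k then a else b))"

lemma properD:
  "proper \<sigma> \<Longrightarrow> i < m \<Longrightarrow> j < m \<Longrightarrow> \<sigma> i = Some \<kappa> \<Longrightarrow> \<sigma> j = Some \<kappa> \<Longrightarrow> w \<in> ends i \<Longrightarrow> w \<in> ends j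
   \<Longrightarrow> i = j"
  unfolding proper_def by blast

lemma proper_mono: "proper \<sigma> \<Longrightarrow> \<tau> \<subseteq>\<^sub>m \<sigma> \<Longrightarrow> proper \<tau>"
  unfolding proper_def map_le_def by (metis domI)

text \<open>A repeated vertex \<open>y\<^sub>i = y\<^sub>j\<close> would force, via the unique edge of the color in question,
  a repetition \<open>y\<^sub>i\<^sub>-\<^sub>1 = y\<^sub>j\<^sub>-\<^sub>1\<close> or \<open>y\<^sub>i\<^sub>+\<^sub>1 = y\<^sub>j\<^sub>-\<^sub>1\<close> at a smaller index.\<close>

lemma altpath_vtx_distinct:
  assumes "proper \<sigma>" "altpath \<sigma> a b x fs" "a \<noteq> b" "b \<notin> cols \<sigma> x"
  shows "j \<le> length fs \<Longrightarrow> i < j \<Longrightarrow> vtx x fs i \<noteq> vtx x fs j"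
proof (induction j arbitrary: i rule: less_induct)
  case (less j)
  let ?y = "vtx x fs"
  have w: "walk x fs" and col: "\<And>k. k < length fs \<Longrightarrow> \<sigma> (fs ! k) = Some (if even k then a else b)"
    using assms by (auto simp: altpath_def)
  obtain j' where j: "j = Suc j'" using less.prems by (cases j) auto
  have j': "j' < length fs" using less.prems j by simp
  note W = walk_nth[OF w]
  show ?case
  proof
    assume eq: "?y i = ?y j"
    have yj: "?y i \<in> ends (fs ! j')" using W[OF j'] eq j by simp
    consider (agree) "i \<noteq> 0" "even (i - 1) = even j'" | (nxt) "even i = even j'" | (zero) "i = 0" "odd j'"
      by (cases i) auto
    then show False
    proof cases
      case agree
      define i' where "i' = i - 1"
      have i': "i = Suc i'" "i' < length fs" using agree less.prems by (auto simp: i'_def)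
      have "fs ! i' = fs ! j'"
        by (rule properD[OF assms(1) W(1) W(1) col, of i' j' "?y i"])
           (use i' j' agree yj W(3)[of i'] in \<open>auto simp: i'_def col\<close>)
      then have "ends (fs ! i') = ends (fs ! j')" by simp
      then have "?y i' = ?y j'" using W(4)[of i'] W(4)[of j'] W(5)[of i'] W(5)[of j'] i' j' j eq by auto
      then show False using less.IH[of j' i'] i' j less.prems by auto
    next
      case nxt
      have il: "i < length fs" using less.prems by simp
      have "fs ! i = fs ! j'"
        by (rule properD[OF assms(1) W(1) W(1) col, of i j' "?y i"])
           (use il j' nxt yj W(2)[of i] in \<open>auto simp: col\<close>)
      then have e: "?y (Suc i) = ?y j'" using W(4)[of i] W(4)[of j'] W(5)[of i] W(5)[of j'] il j' j eq by auto
      show False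
      proof (cases "i = j'")
        case True then show False using eq W(5)[OF j'] j by simp
      next
        case False
        then have "Suc i < j'" using \<open>even i = even j'\<close> less.prems j
          by (metis Suc_lessI even_Suc less_Suc_eq)
        then show False using less.IH[of j' "Suc i"] e j less.prems by auto
      qed
    next
      case zero
      then have "b \<in> cols \<sigma> x" using W(1)[OF j'] col[OF j'] yj by (auto simp: cols_def)
      then show False using assms by simp
    qed
  qed
qed

lemma altpath_inj:
  assumes "proper \<sigma>" "altpath \<sigma> a b x fs" "a \<noteq> b" "b \<notin> cols \<sigma> x"
  shows "inj_on (vtx x fs) {..length fs}" "distinct fs"
proof -
  note d = altpath_vtx_distinct[OF assms]
  show "inj_on (vtx x fs) {..length fs}"
    by (rule linorder_inj_onI) (use d in auto)
  have w: "walk x fs" using assms by (simp add: altpath_def)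
  have "fs ! i \<noteq> fs ! j" if "i < j" "j < length fs" for i j
  proof
    assume "fs ! i = fs ! j"
    then have "vtx x fs i \<in> {vtx x fs j, vtx x fs (Suc j)}"
      using walk_nth[OF w, of i] walk_nth[OF w, of j] that by auto
    then show False using d[of j i] d[of "Suc j" i] that by auto
  qed
  then show "distinct fs" by (metis distinct_conv_nth linorder_neqE_nat)
qed

lemma altpath_length:
  assumes "proper \<sigma>" "altpath \<sigma> a b x fs" "a \<noteq> b" "b \<notin> cols \<sigma> x"
  shows "length fs \<le> m" and "finite V \<Longrightarrow> (\<And>i. i < m \<Longrightarrow> ends i \<subseteq> V) \<Longrightarrow> length fs \<le> card V"
proof -
  have w: "walk x fs" using assms by (simp add: altpath_def)
  have "set fs \<subseteq> {..<m}" using walk_nth(1)[OF w] by (auto simp: in_set_conv_nth)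
  then have "card (set fs) \<le> m" by (metis card_lessThan card_mono finite_lessThan)
  then show "length fs \<le> m" using distinct_card[OF altpath_inj(2)[OF assms]] by simp
  assume V: "finite V" "\<And>i. i < m \<Longrightarrow> ends i \<subseteq> V"
  have "vtx x fs ` {..<length fs} \<subseteq> V"
    using walk_nth[OF w] V(2) by blast
  moreover have "inj_on (vtx x fs) {..<length fs}"
    using altpath_inj(1)[OF assms] by (rule inj_on_subset) auto
  ultimately show "length fs \<le> card V"
    using card_inj_on_le[of "vtx x fs" "{..<length fs}" V] V by simp
qed

text \<open>In a proper coloring every next edge is forced by its color, so two such paths agree as
  long as both last, and a path that cannot be extended is not a proper prefix of the other.\<close>

lemma altpath_unique:
  assumes "proper \<sigma>" "altpath \<sigma> a b x fs" "altpath \<sigma> a b x gs" "length fs \<le> length gs"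
    and "(if even (length fs) then a else b) \<notin> cols \<sigma> (vend x fs)"
  shows "fs = gs"
proof -
  have wf: "walk x fs" and wg: "walk x gs" using assms by (auto simp: altpath_def)
  have *: "take k fs = take k gs" if "k \<le> length fs" for k
    using that
  proof (induction k)
    case (Suc k)
    then have t: "take k fs = take k gs" by simp
    then have v: "vtx x fs k = vtx x gs k" by (simp add: vtx_def)
    have "fs ! k = gs ! k"
      by (rule properD[OF assms(1), of _ _ "if even k then a else b" "vtx x fs k"])
        (use Suc.prems assms walk_nth(1,2)[OF wf, of k] walk_nth(1,2)[OF wg, of k] v in
          \<open>auto simp: altpath_def\<close>)
    then show ?case using t Suc.prems assms(4) by (simp add: take_Suc_conv_app_nth)
  qed simp
  have pre: "fs = take (length fs) gs" using *[of "length fs"] by simp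
  have "\<not> length fs < length gs"
  proof
    assume l: "length fs < length gs"
    then have "vtx x gs (length fs) = vend x fs" using pre by (simp add: vtx_def)
    then have "(if even (length fs) then a else b) \<in> cols \<sigma> (vend x fs)"
      using walk_nth(1,2)[OF wg l] assms(3) l by (fastforce simp: altpath_def cols_def)
    then show False using assms(5) by simp
  qed
  then show ?thesis using pre assms(4) by simp
qed

section \<open>Paths that close a bichromatic cycle\<close>

definition closes :: "(nat \<Rightarrow> nat option) \<Rightarrow> nat \<Rightarrow> nat \<Rightarrow> nat list \<Rightarrow> bool" where
  "closes \<sigma> c e fs \<longleftrightarrow> fs \<noteq> [] \<and> vend (p e) fs = r e \<and> (\<exists>a. a \<noteq> c \<and> altpath \<sigma> a c (p e) fs)"

definition free :: "(nat \<Rightarrow> nat option) \<Rightarrow> nat \<Rightarrow> nat \<Rightarrow> bool" where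
  "free \<sigma> e c \<longleftrightarrow> c \<notin> cols \<sigma> (p e) \<and> c \<notin> cols \<sigma> (r e)"

text \<open>This is the choice made by the program, which follows the paths from \<open>p e\<close> in the order of their
  first edges.\<close>

definition closing :: "(nat \<Rightarrow> nat option) \<Rightarrow> nat \<Rightarrow> nat \<Rightarrow> nat list option" where
  "closing \<sigma> c e = (if \<exists>fs. closes \<sigma> c e fs
     then Some (THE fs. closes \<sigma> c e fs \<and> hd fs = (LEAST j. \<exists>gs. closes \<sigma> c e gs \<and> hd gs = j))
     else None)"

text \<open>A path of even length would end with an edge of color \<open>c\<close> at
  \<open>r e\<close>, where \<open>c\<close> is missing.\<close>

lemma closes_odd:
  assumes "free \<sigma> e c" "closes \<sigma> c e fs"
  shows "odd (length fs)"
proof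
  assume ev: "even (length fs)"
  obtain a where w: "walk (p e) fs" and col: "\<And>k. k < length fs \<Longrightarrow> \<sigma> (fs ! k) = Some (if even k then a else c)"
    and f: "fs \<noteq> []" "vend (p e) fs = r e"
    using assms by (auto simp: closes_def altpath_def)
  define k where "k = length fs - 1"
  have "0 < length fs" using f by simp
  then have k: "k < length fs" "Suc k = length fs" by (auto simp: k_def)
  then have k: "k < length fs" "Suc k = length fs" "odd k" using ev by (metis even_Suc)+
  then have "vtx (p e) fs (Suc k) = r e" using f by (simp add: vtx_length)
  then have "c \<in> cols \<sigma> (r e)"
    using walk_nth(1,3)[OF w k(1)] col[OF k(1)] k(3) by (auto simp: cols_def)
  then show False using assms by (simp add: free_def)
qed

text \<open>A single edge from \<open>p e\<close> to \<open>r e\<close> would be \<open>e\<close>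
  itself, which is uncolored.\<close>

lemma closes_length:
  assumes "free \<sigma> e c" "closes \<sigma> c e fs" "e < m" "\<sigma> e = None"
  shows "3 \<le> length fs"
proof -
  have "length fs \<noteq> 1"
  proof
    assume "length fs = 1"
    then obtain i where i: "fs = [i]" by (auto simp: length_Suc_conv)
    then have "i < m" "ends i = ends e" "\<sigma> i \<noteq> None"
    proof -
      obtain a where "altpath \<sigma> a c (p e) [i]" and v: "vend (p e) [i] = r e"
        using assms(2) unfolding closes_def i by blast
      then have *: "i < m" "p e \<in> ends i" "\<sigma> i = Some a" by (auto simp: altpath_def)
      then show "i < m" "\<sigma> i \<noteq> None" by auto
      show "ends i = ends e" using other_ends(3)[OF *(2)] v by (simp add: ends_def)
    qed
    then show False using ends_eqD[of i e] assms by simp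
  qed
  then show ?thesis using closes_odd[OF assms(1,2)] by presburger
qed

text \<open>The first edge fixes the color \<open>a\<close>, and a closing path cannot be extended
  because its length is odd and \<open>c\<close> is missing at \<open>r e\<close>. This justifies
  the definite description in \<open>closing\<close>.\<close>

lemma closes_unique:
  assumes "proper \<sigma>" "free \<sigma> e c" "closes \<sigma> c e fs" "closes \<sigma> c e gs" "hd fs = hd gs"
  shows "fs = gs"
proof -
  have *: "fs = gs" if cl: "closes \<sigma> c e fs" "closes \<sigma> c e gs" "hd fs = hd gs" "length fs \<le> length gs"
    for fs gs
  proof -
    obtain a where a: "altpath \<sigma> a c (p e) fs" and f: "fs \<noteq> []" "vend (p e) fs = r e"
      using cl(1) unfolding closes_def by blast
    obtain b where b: "altpath \<sigma> b c (p e) gs" and g: "gs \<noteq> []"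
      using cl(2) unfolding closes_def by blast
    have "\<sigma> (fs ! 0) = Some a" "\<sigma> (gs ! 0) = Some b"
      using a b f g unfolding altpath_def by (metis length_greater_0_conv even_zero)+
    then have "a = b" using cl(3) f g by (simp add: hd_conv_nth)
    moreover have "(if even (length fs) then a else c) \<notin> cols \<sigma> (vend (p e) fs)"
      using closes_odd[OF assms(2) cl(1)] f assms(2) by (simp add: free_def)
    ultimately show ?thesis
      using altpath_unique[OF assms(1) a _ cl(4)] b by simp
  qed
  show ?thesis
    using *[of fs gs] *[of gs fs] assms(3-5) by (cases "length fs \<le> length gs") auto
qed

lemma closing_eqI:
  assumes "proper \<sigma>" "free \<sigma> e c" "closes \<sigma> c e fs" "\<And>gs. closes \<sigma> c e gs \<Longrightarrow> hd fs \<le> hd gs"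
  shows "closing \<sigma> c e = Some fs"
proof -
  have "(LEAST j. \<exists>gs. closes \<sigma> c e gs \<and> hd gs = j) = hd fs"
    by (rule Least_equality) (use assms in auto)
  moreover have "(THE gs. closes \<sigma> c e gs \<and> hd gs = hd fs) = fs"
    by (rule the_equality) (use assms closes_unique[OF assms(1,2)] in auto)
  ultimately show ?thesis using assms(3) by (auto simp: closing_def)
qed

lemma closing_Some:
  assumes "proper \<sigma>" "free \<sigma> e c" "closing \<sigma> c e = Some fs"
  shows "closes \<sigma> c e fs"
proof -
  let ?P = "\<lambda>j. \<exists>gs. closes \<sigma> c e gs \<and> hd gs = j"
  have "\<exists>j. ?P j" using assms(3) by (auto simp: closing_def split: if_splits)
  then have "?P (Least ?P)" using LeastI_ex[of ?P] by simp
  then obtain gs where gs: "closes \<sigma> c e gs" "hd gs = Least ?P" by blast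
  have "hd gs \<le> hd hs" if "closes \<sigma> c e hs" for hs
    unfolding gs(2) by (rule Least_le) (use that in auto)
  then show ?thesis using closing_eqI[OF assms(1,2) gs(1)] gs assms(3) by simp
qed

lemma closing_None: "closing \<sigma> c e = None \<longleftrightarrow> (\<nexists>fs. closes \<sigma> c e fs)"
  by (auto simp: closing_def)

section \<open>Acyclic partial colorings\<close>

definition acyclic_coloring :: "(nat \<Rightarrow> nat option) \<Rightarrow> bool" where
  "acyclic_coloring \<sigma> \<longleftrightarrow> (\<forall>vs a b. 3 \<le> length vs \<longrightarrow> distinct vs \<longrightarrow>
     \<not> (\<forall>h\<in>cycle_edges vs. \<exists>i<m. ends i = h \<and> \<sigma> i \<in> {Some a, Some b}))"

text \<open>All edges of a forbidden cycle are colored, so taking colors away creates none. Hence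
  erasing needs no check.\<close>

lemma acyclic_coloring_mono: "acyclic_coloring \<sigma> \<Longrightarrow> \<tau> \<subseteq>\<^sub>m \<sigma> \<Longrightarrow> acyclic_coloring \<tau>"
proof -
  assume a: "acyclic_coloring \<sigma>" and le: "\<tau> \<subseteq>\<^sub>m \<sigma>"
  have t: "\<sigma> i = Some x" if "\<tau> i = Some x" for i x
    using le that unfolding map_le_def by (metis domI)
  show "acyclic_coloring \<tau>" unfolding acyclic_coloring_def
  proof (intro allI impI notI)
    fix vs :: "'v list" and c d
    assume vs: "3 \<le> length vs" "distinct vs"
      and all: "\<forall>h\<in>cycle_edges vs. \<exists>i<m. ends i = h \<and> \<tau> i \<in> {Some c, Some d}"
    have "\<forall>h\<in>cycle_edges vs. \<exists>i<m. ends i = h \<and> \<sigma> i \<in> {Some c, Some d}"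
    proof
      fix h assume "h \<in> cycle_edges vs"
      then obtain i where i: "i < m" "ends i = h" "\<tau> i \<in> {Some c, Some d}" using all by blast
      then have "\<sigma> i \<in> {Some c, Some d}" using t[of i c] t[of i d] by auto
      then show "\<exists>i<m. ends i = h \<and> \<sigma> i \<in> {Some c, Some d}" using i by blast
    qed
    moreover have "\<not> (\<forall>h\<in>cycle_edges vs. \<exists>i<m. ends i = h \<and> \<sigma> i \<in> {Some c, Some d})"
      using a vs unfolding acyclic_coloring_def by simp
    ultimately show False by simp
  qed
qed

lemma proper_insert:
  assumes "proper \<sigma>" "free \<sigma> e c"
  shows "proper (\<sigma>(e \<mapsto> c))"
  unfolding proper_def
proof (intro allI impI)
  fix i j \<kappa>
  assume ij: "i < m" "j < m" "(\<sigma>(e \<mapsto> c)) i = Some \<kappa>" "(\<sigma>(e \<mapsto> c)) j = Some \<kappa>" "ends i \<inter> ends j \<noteq> {}"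
  have new: False if "k < m" "k \<noteq> e" "\<sigma> k = Some c" "ends e \<inter> ends k \<noteq> {}" for k
    using that assms(2) by (auto simp: free_def cols_def ends_def)
  show "i = j"
  proof (cases "i = e \<or> j = e")
    case True
    then show ?thesis using ij new[of i] new[of j] by (auto split: if_splits)
  next
    case False
    then show ?thesis using ij assms(1) unfolding proper_def by simp
  qed
qed

lemma walk_of_vertices:
  assumes "\<And>k. k < L \<Longrightarrow> f k < m \<and> ends (f k) = {y k, y (Suc k)}"
  shows "walk (y 0) (map f [0..<L]) \<and> vend (y 0) (map f [0..<L]) = y L"
  using assms
proof (induction L)
  case (Suc L)
  have "y L \<in> ends (f L)" "f L < m" "ends (f L) = {y L, y (Suc L)}" using Suc.prems[of L] by auto
  then have "other (f L) (y L) = y (Suc L)"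
    using other_ends(3)[of "y L" "f L"] other_neq[of "f L" "y L"] by (metis doubleton_eq_iff)
  then show ?case using Suc by (simp add: walk_append vend_append)
qed simp

text \<open>Moves a chosen edge of a cycle to the last position, between the last and the first
  vertex.\<close>

lemma cycle_edges_rotate:
  assumes "i < length vs"
  defines "ws \<equiv> rotate (Suc i) vs"
  shows "cycle_edges ws = cycle_edges vs"
    and "ws ! (length vs - 1) = vs ! i" "ws ! 0 = vs ! (Suc i mod length vs)"
proof -
  let ?n = "length vs"
  have nth: "ws ! k = vs ! ((Suc i + k) mod ?n)" if "k < ?n" for k
    using nth_rotate[OF that, of "Suc i"] by (simp only: ws_def)
  show "ws ! (?n - 1) = vs ! i"
  proof -
    have "(Suc i + (?n - 1)) mod ?n = (i + ?n) mod ?n" using assms(1) by (intro arg_cong[of _ _ "\<lambda>x. x mod ?n"]) simp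
    also have "\<dots> = i" using assms(1) by simp
    finally show ?thesis using nth[of "?n - 1"] assms(1) by simp
  qed
  show "ws ! 0 = vs ! (Suc i mod ?n)" using nth[of 0] assms(1) by (cases vs) auto
  have bij: "(\<lambda>k. (Suc i + k) mod ?n) ` {..<?n} = {..<?n}"
  proof (rule endo_inj_surj)
    show "inj_on (\<lambda>k. (Suc i + k) mod ?n) {..<?n}"
    proof (rule inj_onI)
      fix x y assume xy: "x \<in> {..<?n}" "y \<in> {..<?n}" "(Suc i + x) mod ?n = (Suc i + y) mod ?n"
      show "x = y"
      proof (rule ccontr)
        assume "x \<noteq> y"
        then consider "x < y" | "y < x" by linarith
        then show False
        proof cases
          case 1
          then have "?n dvd (Suc i + y) - (Suc i + x)"
            using xy(3) mod_eq_dvd_iff_nat[of "Suc i + x" "Suc i + y" ?n] by simp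
          then show False using 1 xy by (auto dest: dvd_imp_le)
        next
          case 2
          then have "?n dvd (Suc i + x) - (Suc i + y)"
            using xy(3) mod_eq_dvd_iff_nat[of "Suc i + y" "Suc i + x" ?n] by simp
          then show False using 2 xy by (auto dest: dvd_imp_le)
        qed
      qed
    qed
  next
    have "0 < ?n" using assms(1) by linarith
    then show "(\<lambda>k. (Suc i + k) mod ?n) ` {..<?n} \<subseteq> {..<?n}" by auto
  qed simp
  have "cycle_edges ws = (\<lambda>k. {vs ! k, vs ! (Suc k mod ?n)}) ` ((\<lambda>k. (Suc i + k) mod ?n) ` {..<?n})"
    unfolding cycle_edges_def image_image
  proof (rule image_cong)
    fix k assume "k \<in> {..<?n}"
    then have k: "k < ?n" by simp
    have "ws ! (Suc k mod ?n) = vs ! ((Suc i + Suc k mod ?n) mod ?n)"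
      using nth[of "Suc k mod ?n"] k mod_less_divisor[of ?n "Suc k"] by linarith
    also have "\<dots> = vs ! (Suc ((Suc i + k) mod ?n) mod ?n)"
    proof -
      have "(Suc i + Suc k mod ?n) mod ?n = (Suc i + Suc k) mod ?n" by (rule mod_add_right_eq)
      moreover have "Suc ((Suc i + k) mod ?n) mod ?n = Suc (Suc i + k) mod ?n" by (rule mod_Suc_eq)
      ultimately show ?thesis by simp
    qed
    finally show "{ws ! k, ws ! (Suc k mod length ws)} =
        {vs ! ((Suc i + k) mod ?n), vs ! (Suc ((Suc i + k) mod ?n) mod ?n)}"
      using nth[OF k] by (simp add: ws_def)
  qed (simp add: ws_def)
  then show "cycle_edges ws = cycle_edges vs" unfolding bij by (simp add: cycle_edges_def)
qed

text \<open>A new bichromatic cycle contains \<open>e\<close>. Without \<open>e\<close> it is an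
  alternating path between the ends of \<open>e\<close>, possibly traversed from \<open>r e\<close>,
  and hence one that \<open>closes\<close> describes.\<close>

lemma acyclic_coloring_insert:
  assumes "proper \<sigma>" "acyclic_coloring \<sigma>" "free \<sigma> e c" "e < m" "\<sigma> e = None" "closing \<sigma> c e = None"
  shows "acyclic_coloring (\<sigma>(e \<mapsto> c))"
  unfolding acyclic_coloring_def
proof (intro allI impI notI)
  fix vs a0 b0 assume n: "3 \<le> length vs" and dv: "distinct vs"
    and all: "\<forall>h\<in>cycle_edges vs. \<exists>i<m. ends i = h \<and> (\<sigma>(e \<mapsto> c)) i \<in> {Some a0, Some b0}"
  let ?s = "\<sigma>(e \<mapsto> c)" and ?n = "length vs"
  have pr: "proper ?s" by (rule proper_insert) (use assms in auto)
  have "\<not> (\<forall>h\<in>cycle_edges vs. \<exists>i<m. ends i = h \<and> \<sigma> i \<in> {Some a0, Some b0})"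
    using assms(2) n dv unfolding acyclic_coloring_def by blast
  then obtain h i where h: "h \<in> cycle_edges vs" "i < m" "ends i = h" "?s i \<in> {Some a0, Some b0}"
    "\<sigma> i \<notin> {Some a0, Some b0}"
    using all by metis
  then have ie: "i = e" by (auto split: if_splits)
  then have c: "c \<in> {a0, b0}" using h by auto
  \<comment> \<open>The color of the cycle other than \<open>c\<close>. The value
    \<open>Suc c\<close> covers \<open>a0 = b0 = c\<close>, where any color different from
    \<open>c\<close> will do.\<close>
  define a where "a = (if a0 \<noteq> c then a0 else if b0 \<noteq> c then b0 else Suc c)"
  have a: "a \<noteq> c" "{Some a0, Some b0} \<subseteq> {Some a, Some c}" using c by (auto simp: a_def)
  obtain i0 where i0: "i0 < ?n" "h = {vs ! i0, vs ! (Suc i0 mod ?n)}"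
    using h by (auto simp: cycle_edges_def)
  define ws where "ws = rotate (Suc i0) vs"
  have lw: "length ws = ?n" "distinct ws" using dv by (simp_all add: ws_def)
  have ce: "cycle_edges ws = cycle_edges vs" and we: "ends e = {ws ! (?n - 1), ws ! 0}"
    using cycle_edges_rotate[OF i0(1)] i0 h ie by (auto simp: ws_def)
  define L where "L = ?n - 1"
  have L: "2 \<le> L" "?n = Suc L" using n by (auto simp: L_def)
  have "\<exists>i. i < m \<and> ends i = {ws ! k, ws ! Suc k} \<and> ?s i \<in> {Some a, Some c}" if "k < L" for k
  proof -
    have "Suc k mod length ws = Suc k" using that lw L by simp
    then have "{ws ! k, ws ! Suc k} \<in> cycle_edges ws"
      using that lw L unfolding cycle_edges_def by (intro image_eqI[of _ _ k]) auto
    then show ?thesis using all a(2) unfolding ce by blast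
  qed
  then obtain f where f: "\<And>k. k < L \<Longrightarrow> f k < m \<and> ends (f k) = {ws ! k, ws ! Suc k} \<and> ?s (f k) \<in> {Some a, Some c}"
    by metis
  have we': "ends e = {ws ! L, ws ! 0}" using we by (simp add: L_def)
  have ws_eq: "ws ! i = ws ! j \<longleftrightarrow> i = j" if "i \<le> L" "j \<le> L" for i j
    using that lw L by (simp add: nth_eq_iff_index_eq)
  have fe: "f k \<noteq> e" if "k < L" for k
  proof
    assume "f k = e"
    then have "{ws ! k, ws ! Suc k} = {ws ! L, ws ! 0}" using f[OF that] we' by auto
    then show False using that L by (auto simp: doubleton_eq_iff ws_eq)
  qed
  \<comment> \<open>The first path edge meets \<open>e\<close> at \<open>ws ! 0\<close> and so does
    not have color \<open>c\<close>; consecutive edges share a vertex, so the colors alternate from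
    there on.\<close>
  have col: "?s (f k) = Some (if even k then a else c)" if "k < L" for k
    using that
  proof (induction k)
    case 0
    have "?s (f 0) \<noteq> Some c"
    proof
      assume "?s (f 0) = Some c"
      then have "f 0 = e"
        by (intro properD[OF pr, of _ _ c "ws ! 0"]) (use f[OF 0] we' assms in auto)
      then show False using fe 0 by simp
    qed
    then show ?case using f[OF 0] by auto
  next
    case (Suc k)
    have ne: "f k \<noteq> f (Suc k)"
    proof
      assume "f k = f (Suc k)"
      then have "{ws ! k, ws ! Suc k} = {ws ! Suc k, ws ! Suc (Suc k)}"
        using f[of k] f[of "Suc k"] Suc.prems by auto
      then show False using Suc.prems L by (auto simp: doubleton_eq_iff ws_eq)
    qed
    have "?s (f k) \<noteq> ?s (f (Suc k))"
    proof
      assume eq: "?s (f k) = ?s (f (Suc k))"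
      have "f k = f (Suc k)"
        by (rule properD[OF pr, of _ _ "if even k then a else c" "ws ! Suc k"])
          (use f[of k] f[of "Suc k"] Suc eq in auto)
      then show False using ne by simp
    qed
    then show ?case using f[of "Suc k"] Suc by (auto split: if_splits)
  qed
  define fs where "fs = map f [0..<L]"
  have wfs: "walk (ws ! 0) fs" "vend (ws ! 0) fs = ws ! L"
    using walk_of_vertices[of L f "(!) ws"] f by (auto simp: fs_def)
  have cfs: "\<sigma> (fs ! k) = Some (if even k then a else c)" if "k < length fs" for k
    using col[of k] fe[of k] that by (simp add: fs_def)
  have lfs: "length fs = L" "fs \<noteq> []" using L by (auto simp: fs_def)
  \<comment> \<open>Otherwise the last path edge has color \<open>c\<close> and meets
    \<open>e\<close> at \<open>ws ! L\<close>. Odd length also makes the reversed path start with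
    color \<open>a\<close>.\<close>
  have "odd L"
  proof
    assume "even L"
    define k where "k = L - 1"
    have k: "k < L" "odd k" "Suc k = L" using L \<open>even L\<close> by (auto simp: k_def)
    then have "f k = e"
      by (intro properD[OF pr, of _ _ c "ws ! L"]) (use f[of k] col[of k] assms we' in auto)
    then show False using fe k by simp
  qed
  have "\<exists>fs. closes \<sigma> c e fs"
  proof (cases "ws ! 0 = p e")
    case True
    then have "ws ! L = r e" using we' ends_distinct[OF assms(4)] by (auto simp: ends_def doubleton_eq_iff)
    then have "altpath \<sigma> a c (p e) fs" "vend (p e) fs = r e"
      using True wfs cfs by (simp_all add: altpath_def)
    then show ?thesis using lfs a(1) unfolding closes_def by blast
  next
    case False
    then have e: "ws ! 0 = r e" "ws ! L = p e"
      using we' ends_distinct[OF assms(4)] by (auto simp: ends_def doubleton_eq_iff)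
    have "walk (p e) (rev fs)" "vend (p e) (rev fs) = r e" using walk_rev[OF wfs(1)] wfs(2) e by auto
    moreover have "\<sigma> (rev fs ! k) = Some (if even k then a else c)" if "k < length (rev fs)" for k
      using cfs[of "L - Suc k"] that lfs \<open>odd L\<close> by (auto simp: rev_nth)
    ultimately have "altpath \<sigma> a c (p e) (rev fs)" "vend (p e) (rev fs) = r e"
      by (simp_all add: altpath_def)
    moreover have "rev fs \<noteq> []" using lfs by simp
    ultimately show ?thesis using a(1) unfolding closes_def by blast
  qed
  then show False using assms(6) by (auto simp: closing_None)
qed

section \<open>The recoloring process and its failure probability\<close>

definition first :: "(nat \<Rightarrow> nat option) \<Rightarrow> nat" where
  "first \<sigma> = (LEAST i. i \<ge> m \<or> \<sigma> i = None)"

lemma first_props: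
  "first \<sigma> \<le> m" "i < first \<sigma> \<Longrightarrow> \<sigma> i \<noteq> None" "first \<sigma> < m \<Longrightarrow> \<sigma> (first \<sigma>) = None"
  "first \<sigma> < m \<longleftrightarrow> \<not> {..<m} \<subseteq> dom \<sigma>"
proof -
  let ?P = "\<lambda>i. i \<ge> m \<or> \<sigma> i = None"
  show 1: "first \<sigma> \<le> m" unfolding first_def by (rule Least_le) simp
  show 2: "i < first \<sigma> \<Longrightarrow> \<sigma> i \<noteq> None" for i unfolding first_def using not_less_Least[of i ?P] by auto
  have "?P (first \<sigma>)" unfolding first_def by (rule LeastI[of ?P m]) simp
  then show 3: "first \<sigma> < m \<Longrightarrow> \<sigma> (first \<sigma>) = None" by auto
  show "first \<sigma> < m \<longleftrightarrow> \<not> {..<m} \<subseteq> dom \<sigma>"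
  proof (cases "first \<sigma> < m")
    case True
    then show ?thesis using 3 by (auto simp: domIff)
  next
    case False
    then have "first \<sigma> = m" using 1 by simp
    then have "{..<m} \<subseteq> dom \<sigma>" using 2 by (auto simp: domIff)
    then show ?thesis using False by simp
  qed
qed

text \<open>Pattern \<open>j\<close> keeps the edges of the cycle at positions \<open>kept j\<close> and \<open>kept j + 1\<close>; their common
  vertex is \<open>z = y (mid_pos j)\<close>. Patterns \<open>3\<close> and \<open>4\<close> keep the same edges and differ in the end \<open>a =
  y (priv_pos j)\<close> from which these are reconstructed. With only the four patterns \<open>j < 4\<close> the disjoint
  sets \<open>priv \<sigma> y j\<close> could have \<open>\<Delta> - 1\<close> elements each.\<close>

definition priv_pos :: "nat \<Rightarrow> nat" where "priv_pos j = (if j = 4 then 5 else j)"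
definition mid_pos :: "nat \<Rightarrow> nat" where "mid_pos j = (if j = 4 then 4 else Suc j)"

text \<open>Only \<open>y 0\<close> to \<open>y 5\<close> are compared, because these vertices exist
  even on the shortest cycle treated here, the one with six edges. The middle vertex is left out
  because the trace of the cycle does not determine it.\<close>

definition priv :: "(nat \<Rightarrow> nat option) \<Rightarrow> (nat \<Rightarrow> 'v) \<Rightarrow> nat \<Rightarrow> nat set" where
  "priv \<sigma> y j = {\<kappa>. \<kappa> < q \<and> \<kappa> \<in> cols \<sigma> (y (priv_pos j)) \<and> (\<forall>i<6. i \<noteq> priv_pos j \<longrightarrow> i \<noteq> mid_pos j \<longrightarrow> \<kappa> \<notin> cols \<sigma> (y i))}"

definition kept :: "nat \<Rightarrow> nat" where "kept j = min j 3"

definition uncolor :: "(nat \<Rightarrow> nat option) \<Rightarrow> nat list \<Rightarrow> nat \<Rightarrow> nat \<Rightarrow> nat option" where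
  "uncolor \<sigma> fs j = \<sigma> |` (- (set (take (kept j) fs) \<union> set (drop (kept j + 2) fs)))"

text \<open>The pattern is drawn at most twice: the sum over \<open>j'\<close> is the second draw,
  which is accepted without a test.\<close>

definition cycle_avg :: "((nat \<Rightarrow> nat option) \<Rightarrow> real) \<Rightarrow> (nat \<Rightarrow> nat option) \<Rightarrow> nat \<Rightarrow> nat list \<Rightarrow> real" where
  "cycle_avg F \<sigma> e fs = (\<Sum>j<5. (\<Sum>\<kappa><q. if \<kappa> \<in> priv \<sigma> (vtx (p e) fs) j
     then (\<Sum>j'<5. F (uncolor \<sigma> fs j')) / 5 else F (uncolor \<sigma> fs j)) / real q) / 5"

definition color_avg :: "((nat \<Rightarrow> nat option) \<Rightarrow> real) \<Rightarrow> (nat \<Rightarrow> nat option) \<Rightarrow> nat \<Rightarrow> nat \<Rightarrow> real" where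
  "color_avg F \<sigma> e c = (if free \<sigma> e c then
     (case closing \<sigma> c e of None \<Rightarrow> F (\<sigma>(e \<mapsto> c))
      | Some fs \<Rightarrow> if length fs \<le> 3 then F \<sigma> else cycle_avg F \<sigma> e fs)
     else F \<sigma>)"

text \<open>The probability that \<open>N\<close> rounds starting from \<open>\<sigma>\<close> do not lead to a complete coloring.\<close>

primrec fail :: "nat \<Rightarrow> (nat \<Rightarrow> nat option) \<Rightarrow> real" where
  "fail 0 \<sigma> = (if first \<sigma> < m then 1 else 0)"
| "fail (Suc N) \<sigma> =
     (if first \<sigma> < m then (\<Sum>c<q. color_avg (fail N) \<sigma> (first \<sigma>) c) / real q else 0)"

section \<open>Counting the possible predecessors of a coloring\<close>

fun nonback :: "'v \<Rightarrow> nat \<Rightarrow> nat list \<Rightarrow> bool" where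
  "nonback x pr [] = True"
| "nonback x pr (i # fs) = (i < m \<and> x \<in> ends i \<and> i \<noteq> pr \<and> nonback (other i x) i fs)"

definition chains :: "'v \<Rightarrow> nat \<Rightarrow> nat \<Rightarrow> nat list set" where
  "chains x pr k = {fs. length fs = k \<and> nonback x pr fs}"

lemma nonback_of_distinct: "walk x fs \<Longrightarrow> distinct (pr # fs) \<Longrightarrow> nonback x pr fs"
  by (induction fs arbitrary: x pr) auto

lemma card_incident: "card {i. i < m \<and> w \<in> ends i} \<le> Suc D"
  using degree by (simp add: ends_def)

lemma card_incident_but:
  assumes "j < m" "w \<in> ends j"
  shows "card {i. i < m \<and> w \<in> ends i \<and> i \<noteq> j} \<le> D"
proof -
  have "{i. i < m \<and> w \<in> ends i \<and> i \<noteq> j} = {i. i < m \<and> w \<in> ends i} - {j}" by auto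
  then have "card {i. i < m \<and> w \<in> ends i \<and> i \<noteq> j} = card {i. i < m \<and> w \<in> ends i} - 1"
    using assms by (simp add: card_Diff_singleton)
  then show ?thesis using card_incident[of w] by simp
qed

text \<open>The edge just used takes one of the \<open>D + 1\<close> places at a vertex, which
  leaves \<open>D\<close> ways to continue without turning back.\<close>

lemma card_chains:
  assumes "pr < m" "x \<in> ends pr"
  shows "finite (chains x pr k) \<and> card (chains x pr k) \<le> D ^ k"
  using assms
proof (induction k arbitrary: x pr)
  case 0
  have "chains x pr 0 = {[]}" by (auto simp: chains_def)
  then show ?case by simp
next
  case (Suc k)
  let ?I = "{i. i < m \<and> x \<in> ends i \<and> i \<noteq> pr}"
  have eq: "chains x pr (Suc k) = (\<Union>i\<in>?I. (#) i ` chains (other i x) i k)"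
    by (auto simp: chains_def length_Suc_conv)
  have IH: "finite (chains (other i x) i k)" "card (chains (other i x) i k) \<le> D ^ k" if "i \<in> ?I" for i
    using Suc.IH[of i "other i x"] that other_ends(1) by auto
  have fin: "finite ?I" by (rule finite_subset[of _ "{..<m}"]) auto
  have "card (chains x pr (Suc k)) \<le> (\<Sum>i\<in>?I. card ((#) i ` chains (other i x) i k))"
    unfolding eq by (rule card_UN_le[OF fin])
  also have "\<dots> \<le> (\<Sum>i\<in>?I. D ^ k)"
  proof (rule sum_mono)
    fix i assume i: "i \<in> ?I"
    have "card ((#) i ` chains (other i x) i k) \<le> card (chains (other i x) i k)"
      by (rule card_image_le) (rule IH(1)[OF i])
    then show "card ((#) i ` chains (other i x) i k) \<le> D ^ k" using IH(2)[OF i] by simp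
  qed
  also have "\<dots> \<le> D * D ^ k"
    using card_incident_but[OF Suc.prems] by simp
  finally show ?case unfolding eq using IH fin by auto
qed

section \<open>Colors that leave the coloring unchanged\<close>

lemma finite_cols: "finite (cols \<sigma> w)"
proof (rule finite_subset)
  show "cols \<sigma> w \<subseteq> (\<lambda>i. the (\<sigma> i)) ` {..<m}" by (force simp: cols_def)
qed simp

lemma card_cols:
  assumes "j < m" "w \<in> ends j" "\<sigma> j = None"
  shows "card (cols \<sigma> w) \<le> D"
proof -
  let ?I = "{i. i < m \<and> w \<in> ends i \<and> i \<noteq> j}"
  have fin: "finite ?I" by (rule finite_subset[of _ "{..<m}"]) auto
  have "cols \<sigma> w \<subseteq> (\<lambda>i. the (\<sigma> i)) ` ?I" using assms by (force simp: cols_def)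
  then have "card (cols \<sigma> w) \<le> card ?I" by (rule surj_card_le[OF fin])
  then show ?thesis using card_incident_but[OF assms(1,2)] by linarith
qed

lemma ends_pr [simp]: "p e \<in> ends e" "r e \<in> ends e"
  by (auto simp: ends_def)

text \<open>The injection sends \<open>c\<close> to the other color \<open>a\<close> of such a
  4-cycle. By properness \<open>a\<close> determines the cycle edges at \<open>p e\<close> and
  \<open>r e\<close>; in a simple graph these determine the edge opposite to \<open>e\<close>, whose
  color is \<open>c\<close>.\<close>

lemma card_four_cycle_colors:
  assumes "proper \<sigma>" "e < m"
  shows "card {c. free \<sigma> e c \<and> (\<exists>fs. closes \<sigma> c e fs \<and> length fs = 3)} \<le> card (cols \<sigma> (p e) \<inter> cols \<sigma> (r e))"
proof -
  let ?S = "{c. free \<sigma> e c \<and> (\<exists>fs. closes \<sigma> c e fs \<and> length fs = 3)}"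
  define R where "R c a \<longleftrightarrow> (\<exists>i j k. i < m \<and> j < m \<and> k < m \<and> \<sigma> i = Some a \<and> \<sigma> j = Some c \<and>
      \<sigma> k = Some a \<and> p e \<in> ends i \<and> r e \<in> ends k \<and> ends j = {other i (p e), other k (r e)})" for c a
  have ex: "\<exists>a. R c a" if c: "c \<in> ?S" for c
  proof -
    obtain fs a where fs: "length fs = 3" "vend (p e) fs = r e" "altpath \<sigma> a c (p e) fs"
      using c by (auto simp: closes_def)
    then obtain i j k where ijk: "fs = [i, j, k]" by (auto simp: numeral_3_eq_3 length_Suc_conv)
    have w: "walk (p e) fs" and col: "\<And>l. l < 3 \<Longrightarrow> \<sigma> (fs ! l) = Some (if even l then a else c)"
      using fs by (auto simp: altpath_def)
    have W: "i < m" "p e \<in> ends i" "j < m" "other i (p e) \<in> ends j" "k < m" "other j (other i (p e)) \<in> ends k"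
      "other k (other j (other i (p e))) = r e"
      using w fs(2) by (auto simp: ijk)
    have "r e \<in> ends k" "other k (r e) = other j (other i (p e))" using other_ends(1,2)[OF W(6)] W(7) by auto
    then have "ends j = {other i (p e), other k (r e)}" using other_ends(3)[OF W(4)] by simp
    moreover have "\<sigma> i = Some a" "\<sigma> j = Some c" "\<sigma> k = Some a"
      using col[of 0] col[of 1] col[of 2] by (simp_all add: ijk)
    ultimately have "R c a" unfolding R_def using W \<open>r e \<in> ends k\<close> by blast
    then show ?thesis ..
  qed
  define a where "a c = (SOME b. R c b)" for c
  have a: "R c (a c)" if "c \<in> ?S" for c
    unfolding a_def by (rule someI_ex) (rule ex[OF that])
  have "inj_on a ?S"
  proof (rule inj_onI)
    fix c c' assume cc: "c \<in> ?S" "c' \<in> ?S" "a c = a c'"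
    obtain i j k where f: "i < m" "j < m" "k < m" "\<sigma> i = Some (a c)" "\<sigma> j = Some c" "\<sigma> k = Some (a c)"
      "p e \<in> ends i" "r e \<in> ends k" "ends j = {other i (p e), other k (r e)}"
      using a[OF cc(1)] unfolding R_def by blast
    obtain i' j' k' where f': "i' < m" "j' < m" "k' < m" "\<sigma> i' = Some (a c)" "\<sigma> j' = Some c'" "\<sigma> k' = Some (a c)"
      "p e \<in> ends i'" "r e \<in> ends k'" "ends j' = {other i' (p e), other k' (r e)}"
      using a[OF cc(2)] unfolding R_def cc(3) by blast
    have "i = i'" using properD[OF assms(1) f(1) f'(1) f(4) f'(4) f(7) f'(7)] .
    moreover have "k = k'" using properD[OF assms(1) f(3) f'(3) f(6) f'(6) f(8) f'(8)] .
    ultimately have "j = j'" using ends_eqD f f' by simp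
    then show "c = c'" using f f' by simp
  qed
  moreover have "a ` ?S \<subseteq> cols \<sigma> (p e) \<inter> cols \<sigma> (r e)"
  proof
    fix b assume "b \<in> a ` ?S"
    then obtain c where "c \<in> ?S" "b = a c" by blast
    then show "b \<in> cols \<sigma> (p e) \<inter> cols \<sigma> (r e)" using a[of c] unfolding R_def cols_def by blast
  qed
  ultimately show ?thesis by (intro card_inj_on_le[of a]) (auto simp: finite_cols)
qed

definition stall_colors :: "(nat \<Rightarrow> nat option) \<Rightarrow> nat \<Rightarrow> nat set" where
  "stall_colors \<sigma> e = {c. c < q \<and> (\<not> free \<sigma> e c \<or> (\<exists>fs. closing \<sigma> c e = Some fs \<and> length fs \<le> 3))}"

text \<open>The 4-cycle colors are charged to the colors common to both ends, and
  \<open>card (?A \<union> ?B) + card (?A \<inter> ?B)\<close> is \<open>card ?A + card ?B\<close>,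
  where the uncolored edge \<open>e\<close> leaves at most \<open>D\<close> colors at either
  end.\<close>

lemma card_stall_colors:
  assumes "proper \<sigma>" "e < m" "\<sigma> e = None"
  shows "card (stall_colors \<sigma> e) \<le> 2 * D"
proof -
  let ?A = "cols \<sigma> (p e)" and ?B = "cols \<sigma> (r e)"
  let ?S = "{c. free \<sigma> e c \<and> (\<exists>fs. closes \<sigma> c e fs \<and> length fs = 3)}"
  have "c \<in> (?A \<union> ?B) \<union> (?S \<inter> {..<q})" if c: "c \<in> stall_colors \<sigma> e" for c
  proof (cases "free \<sigma> e c")
    case True
    then obtain fs where fs: "closing \<sigma> c e = Some fs" "length fs \<le> 3" using c by (auto simp: stall_colors_def)
    then have "closes \<sigma> c e fs" using closing_Some assms True by blast
    then show ?thesis using closes_length[OF True _ assms(2,3)] True fs c by (auto simp: stall_colors_def intro: le_antisym)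
  qed (auto simp: free_def)
  then have "card (stall_colors \<sigma> e) \<le> card ((?A \<union> ?B) \<union> (?S \<inter> {..<q}))"
    by (intro card_mono) (auto simp: finite_cols)
  also have "\<dots> \<le> card (?A \<union> ?B) + card (?S \<inter> {..<q})" by (rule card_Un_le)
  also have "card (?S \<inter> {..<q}) \<le> card (?A \<inter> ?B)"
  proof (cases "finite ?S")
    case True
    then show ?thesis using card_four_cycle_colors[OF assms(1,2)] card_mono[OF True, of "?S \<inter> {..<q}"] by simp
  next
    case False
    have "?S \<subseteq> (\<lambda>i. the (\<sigma> i)) ` {..<m}"
    proof
      fix c assume "c \<in> ?S"
      then obtain fs a where fs: "length fs = 3" "altpath \<sigma> a c (p e) fs" by (auto simp: closes_def)
      then have "fs ! 1 < m" "\<sigma> (fs ! 1) = Some c"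
        using walk_nth(1)[of "p e" fs 1] by (auto simp: altpath_def)
      then show "c \<in> (\<lambda>i. the (\<sigma> i)) ` {..<m}" by force
    qed
    then show ?thesis using False finite_subset by blast
  qed
  also have "card (?A \<union> ?B) + card (?A \<inter> ?B) = card ?A + card ?B"
    using card_Un_Int[OF finite_cols finite_cols] by metis
  also have "\<dots> \<le> 2 * D"
    using card_cols[of e "p e" \<sigma>] card_cols[of e "r e" \<sigma>] assms by simp
  finally show ?thesis by simp
qed

text \<open>The five sets are disjoint, so on average they contain at most a fifth of the colors.\<close>

lemma sum_card_priv: "(\<Sum>j<5. card (priv \<sigma> y j)) \<le> q"
proof -
  have dis: "priv \<sigma> y i \<inter> priv \<sigma> y j = {}" if "i < j" "j < 5" for i j
  proof -
    have "i \<in> {0,1,2,3}" "j \<in> {1,2,3,4}" using that by auto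
    then show ?thesis using that unfolding priv_def priv_pos_def mid_pos_def by auto
  qed
  have fin: "finite (priv \<sigma> y j)" for j unfolding priv_def by simp
  have "card (\<Union>j\<in>{..<5}. priv \<sigma> y j) = (\<Sum>j<5. card (priv \<sigma> y j))"
  proof (rule card_UN_disjoint)
    show "\<forall>i\<in>{..<5}. \<forall>j\<in>{..<5}. i \<noteq> j \<longrightarrow> priv \<sigma> y i \<inter> priv \<sigma> y j = {}"
      using dis by (metis Int_commute lessThan_iff linorder_neqE_nat)
  qed (use fin in auto)
  moreover have "card (\<Union>j\<in>{..<5}. priv \<sigma> y j) \<le> card {..<q}"
    by (rule card_mono) (auto simp: priv_def)
  ultimately show ?thesis by simp
qed

text \<open>First summand: \<open>j\<close> is drawn and kept. Second summand: some pattern is drawn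
  and rejected, and the second draw yields \<open>j\<close>.\<close>

definition pattern_prob :: "nat \<Rightarrow> (nat \<Rightarrow> nat option) \<Rightarrow> (nat \<Rightarrow> 'v) \<Rightarrow> real" where
  "pattern_prob j \<sigma> y = (1 - card (priv \<sigma> y j) / q) / 5 + (\<Sum>j'<5. card (priv \<sigma> y j') / q) / 25"

lemma cycle_avg_eq:
  assumes "0 < q"
  shows "cycle_avg F \<sigma> e fs = (\<Sum>j<5. pattern_prob j \<sigma> (vtx (p e) fs) * F (uncolor \<sigma> fs j))"
proof -
  let ?priv = "\<lambda>j. priv \<sigma> (vtx (p e) fs) j"
  define S where "S = (\<Sum>j<5. F (uncolor \<sigma> fs j))"
  have 1: "(\<Sum>\<kappa><q. if \<kappa> \<in> ?priv j then S / 5 else F (uncolor \<sigma> fs j)) / real q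
      = card (?priv j) / q * (S / 5) + (1 - card (?priv j) / q) * F (uncolor \<sigma> fs j)" for j
  proof -
    have sub: "?priv j \<subseteq> {..<q}" by (auto simp: priv_def)
    have i: "{..<q} \<inter> {\<kappa>. \<kappa> \<in> ?priv j} = ?priv j" and d: "{..<q} \<inter> - {\<kappa>. \<kappa> \<in> ?priv j} = {..<q} - ?priv j" using sub by auto
    have c: "card ({..<q} - ?priv j) = q - card (?priv j)" "card (?priv j) \<le> q"
      using sub by (auto simp: card_Diff_subset finite_subset dest: card_mono[rotated])
    have "(\<Sum>\<kappa><q. if \<kappa> \<in> ?priv j then S / 5 else F (uncolor \<sigma> fs j))
       = card (?priv j) * (S / 5) + (real q - card (?priv j)) * F (uncolor \<sigma> fs j)"
      using i d c by (subst sum.If_cases) (simp_all only: finite_lessThan sum_constant of_nat_diff of_nat_eq_iff)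
    then show ?thesis using assms by (simp add: field_simps)
  qed
  have "cycle_avg F \<sigma> e fs = (\<Sum>j<5. card (?priv j) / q * (S / 5) + (1 - card (?priv j) / q) * F (uncolor \<sigma> fs j)) / 5"
    unfolding cycle_avg_def S_def[symmetric] 1 ..
  also have "\<dots> = (\<Sum>j<5. card (?priv j) / q) * S / 25 + (\<Sum>j<5. (1 - card (?priv j) / q) / 5 * F (uncolor \<sigma> fs j))"
    by (simp add: sum.distrib sum_distrib_right sum_divide_distrib add_divide_distrib mult.assoc)
  also have "\<dots> = (\<Sum>j<5. pattern_prob j \<sigma> (vtx (p e) fs) * F (uncolor \<sigma> fs j))"
  proof -
    define C where "C = (\<Sum>j<5. card (?priv j) / real q)"
    have "C * S / 25 = (\<Sum>j<5. C / 25 * F (uncolor \<sigma> fs j))"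
      by (simp add: S_def sum_distrib_left sum_divide_distrib)
    then show ?thesis unfolding pattern_prob_def C_def[symmetric] by (simp add: sum.distrib distrib_right)
  qed
  finally show ?thesis .
qed

text \<open>By disjointness of the private sets a second draw happens with probability at most
  \<open>1/5\<close>; this turns \<open>1\<close> into \<open>6/5\<close>.\<close>

lemma pattern_prob_bounds:
  assumes "0 < q"
  shows "0 \<le> pattern_prob j \<sigma> y" "pattern_prob j \<sigma> y \<le> (6/5 - card (priv \<sigma> y j) / q) / 5"
proof -
  have c: "card (priv \<sigma> y j) \<le> q" using card_mono[of "{..<q}" "priv \<sigma> y j"] by (auto simp: priv_def)
  have s: "(\<Sum>j'<5. card (priv \<sigma> y j') / q) = (\<Sum>j'<5. card (priv \<sigma> y j')) / real q"
    by (simp add: sum_divide_distrib)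
  also have "\<dots> \<le> real q / q" using sum_card_priv[of \<sigma> y] assms by (intro divide_right_mono) (simp_all flip: of_nat_sum)
  finally have s1: "(\<Sum>j'<5. card (priv \<sigma> y j') / q) \<le> 1" using assms by simp
  show "0 \<le> pattern_prob j \<sigma> y" unfolding pattern_prob_def using c assms by (intro add_nonneg_nonneg) (auto intro!: sum_nonneg)
  show "pattern_prob j \<sigma> y \<le> (6/5 - card (priv \<sigma> y j) / q) / 5" unfolding pattern_prob_def using s1 by (simp add: diff_divide_distrib sum_divide_distrib[symmetric])
qed

section \<open>A long cycle before and after the erasure\<close>

definition long_cycle :: "(nat \<Rightarrow> nat option) \<Rightarrow> nat \<Rightarrow> nat \<Rightarrow> nat \<Rightarrow> nat list \<Rightarrow> bool" where
  "long_cycle \<sigma> e c d fs \<longleftrightarrow> proper \<sigma> \<and> e < m \<and> \<sigma> e = None \<and> free \<sigma> e c \<and> d \<noteq> c \<and>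
     altpath \<sigma> d c (p e) fs \<and> vend (p e) fs = r e \<and> odd (length fs) \<and> 5 \<le> length fs \<and>
     distinct fs \<and> e \<notin> set fs"

lemma long_cycleI:
  assumes "proper \<sigma>" "e < m" "\<sigma> e = None" "free \<sigma> e c" "closing \<sigma> c e = Some fs" "3 < length fs"
  shows "\<exists>d. long_cycle \<sigma> e c d fs"
proof -
  have cl: "closes \<sigma> c e fs" by (rule closing_Some[OF assms(1,4,5)])
  then obtain d where d: "d \<noteq> c" "altpath \<sigma> d c (p e) fs" "vend (p e) fs = r e" by (auto simp: closes_def)
  have odd: "odd (length fs)" by (rule closes_odd[OF assms(4) cl])
  moreover have "distinct fs" using altpath_inj(2)[OF assms(1) d(2,1)] assms(4) by (simp add: free_def)
  moreover have "e \<notin> set fs"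
  proof
    assume "e \<in> set fs"
    then obtain k where "k < length fs" "fs ! k = e" by (auto simp: in_set_conv_nth)
    then show False using d(2) assms(3) by (auto simp: altpath_def)
  qed
  moreover have "5 \<le> length fs" using odd assms(6) by presburger
  ultimately show ?thesis using assms d by (auto simp: long_cycle_def)
qed

lemma take_kept_length: "5 \<le> length fs \<Longrightarrow> length (take (kept j) fs) = kept j"
  by (simp add: kept_def)

lemma long_cycle_split:
  assumes "5 \<le> length fs"
  shows "fs = take (kept j) fs @ [fs ! kept j, fs ! Suc (kept j)] @ drop (kept j + 2) fs"
proof -
  have "kept j < length fs" "Suc (kept j) < length fs" using assms by (auto simp: kept_def)
  then show ?thesis by (simp add: Cons_nth_drop_Suc)
qed

definition gone :: "nat list \<Rightarrow> nat \<Rightarrow> nat set" where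
  "gone fs j = set (take (kept j) fs) \<union> set (drop (kept j + 2) fs)"

lemma uncolor_gone: "uncolor \<sigma> fs j = \<sigma> |` (- gone fs j)"
  by (simp add: uncolor_def gone_def)

lemma gone_nth:
  assumes "distinct fs" "k < length fs"
  shows "fs ! k \<in> gone fs j \<longleftrightarrow> k < kept j \<or> kept j + 2 \<le> k"
proof -
  have "fs ! k \<in> set (take (kept j) fs) \<longleftrightarrow> k < kept j"
    using assms by (auto simp: in_set_conv_nth nth_eq_iff_index_eq)
  moreover have "fs ! k \<in> set (drop (kept j + 2) fs) \<longleftrightarrow> kept j + 2 \<le> k"
  proof
    assume "fs ! k \<in> set (drop (kept j + 2) fs)"
    then obtain l where "l < length (drop (kept j + 2) fs)" "drop (kept j + 2) fs ! l = fs ! k"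
      by (metis in_set_conv_nth)
    then have l: "kept j + 2 + l < length fs" "fs ! (kept j + 2 + l) = fs ! k" by auto
    then have "kept j + 2 + l = k" using nth_eq_iff_index_eq[OF assms(1) l(1) assms(2)] by simp
    then show "kept j + 2 \<le> k" by simp
  next
    assume "kept j + 2 \<le> k"
    then have "kept j + 2 + (k - (kept j + 2)) = k" by simp
    then have "fs ! k = drop (kept j + 2) fs ! (k - (kept j + 2))" "k - (kept j + 2) < length (drop (kept j + 2) fs)"
      using assms \<open>kept j + 2 \<le> k\<close> nth_drop[of "kept j + 2" fs "k - (kept j + 2)"] by (auto simp del: nth_drop)
    then show "fs ! k \<in> set (drop (kept j + 2) fs)" by (metis nth_mem)
  qed
  ultimately show ?thesis by (auto simp: gone_def)
qed

lemma gone_card: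
  assumes "distinct fs" "5 \<le> length fs"
  shows "card (gone fs j) = length fs - 2"
proof -
  have "set (take (kept j) fs) \<inter> set (drop (kept j + 2) fs) = {}"
    using assms set_take_disj_set_drop_if_distinct[of fs "kept j" "kept j + 2"] by simp
  then have "card (gone fs j) = card (set (take (kept j) fs)) + card (set (drop (kept j + 2) fs))"
    unfolding gone_def by (intro card_Un_disjoint) auto
  also have "\<dots> = kept j + (length fs - (kept j + 2))"
    using assms by (simp add: distinct_card kept_def)
  also have "\<dots> = length fs - 2" using assms by (auto simp: kept_def)
  finally show ?thesis .
qed

context
  fixes \<sigma> e c d fs
  assumes lc: "long_cycle \<sigma> e c d fs"
begin

lemma long_cycleD:
  shows "proper \<sigma>" "e < m" "\<sigma> e = None" "free \<sigma> e c" "d \<noteq> c" "walk (p e) fs" "vend (p e) fs = r e"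
    "odd (length fs)" "5 \<le> length fs" "distinct fs" "e \<notin> set fs"
    "\<And>k. k < length fs \<Longrightarrow> \<sigma> (fs ! k) = Some (if even k then d else c)"
  using lc by (auto simp: long_cycle_def altpath_def)

abbreviation (input) "cyc_vertex \<equiv> vtx (p e) fs"

lemma uncolor_proper: "proper (uncolor \<sigma> fs j)"
  by (rule proper_mono[OF long_cycleD(1)]) (auto simp: uncolor_gone map_le_def)

lemma uncolor_kept:
  "uncolor \<sigma> fs j (fs ! kept j) = Some (if even (kept j) then d else c)"
  "uncolor \<sigma> fs j (fs ! Suc (kept j)) = Some (if even (kept j) then c else d)"
proof -
  have k: "kept j < length fs" "Suc (kept j) < length fs" using long_cycleD(9) by (auto simp: kept_def)
  show "uncolor \<sigma> fs j (fs ! kept j) = Some (if even (kept j) then d else c)"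
    "uncolor \<sigma> fs j (fs ! Suc (kept j)) = Some (if even (kept j) then c else d)"
    using long_cycleD(12)[OF k(1)] long_cycleD(12)[OF k(2)] gone_nth[OF long_cycleD(10) k(1)] gone_nth[OF long_cycleD(10) k(2)]
    by (auto simp: uncolor_gone)
qed

text \<open>In \<open>\<sigma>\<close> the colors \<open>c\<close> and \<open>d\<close> occur at the
  vertices of the path only on path edges, by properness and because \<open>c\<close> is missing at
  both ends of the path. After the erasure only the two kept edges still carry them.\<close>

lemma cycle_color_gone:
  assumes "i \<le> length fs" "i \<noteq> Suc (kept j)" "\<kappa> \<in> {c, d}" "\<kappa> \<in> cols (uncolor \<sigma> fs j) (cyc_vertex i)"
  shows "i = kept j \<and> \<kappa> = (if even (kept j) then d else c) \<or> i = kept j + 2 \<and> \<kappa> = (if even (kept j) then c else d)"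
proof -
  obtain g where g: "g < m" "uncolor \<sigma> fs j g = Some \<kappa>" "cyc_vertex i \<in> ends g" using assms(4) by (auto simp: cols_def)
  then have sg: "\<sigma> g = Some \<kappa>" "g \<notin> gone fs j" by (auto simp: uncolor_gone restrict_map_def split: if_splits)
  have nc: "\<kappa> \<noteq> c" if "i = 0 \<or> i = length fs"
    using that long_cycleD(4,7) g sg(1) by (auto simp: free_def cols_def vtx_length)
  \<comment> \<open>Position of the path edge of color \<open>\<kappa>\<close> at vertex
    \<open>i\<close>. Even positions have color \<open>d\<close>, so this edge leaves vertex
    \<open>i\<close> if the parities fit and enters it otherwise.\<close>
  define k where "k = (if even i \<longleftrightarrow> \<kappa> = d then i else i - 1)"
  have "\<kappa> = c \<or> \<kappa> = d" using assms(3) by blast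
  then have k: "k < length fs" "i = k \<or> i = Suc k" "\<kappa> = (if even k then d else c)"
  proof -
    have *: "\<kappa> = (if even k then d else c) \<and> k < length fs \<and> (i = k \<or> i = Suc k)"
      using \<open>\<kappa> = c \<or> \<kappa> = d\<close>
    proof
      assume "\<kappa> = c"
      then have "i \<noteq> 0" "i \<noteq> length fs" using nc \<open>\<kappa> = c\<close> by metis+
      then have "i \<noteq> 0" "i < length fs" using assms(1) by auto
      then show ?thesis using \<open>\<kappa> = c\<close> long_cycleD(5) by (cases i) (auto simp: k_def)
    next
      assume kd: "\<kappa> = d"
      show ?thesis
      proof (cases "even i")
        case True
        then have "i < length fs" using assms(1) long_cycleD(8) by (cases "i = length fs") auto
        then show ?thesis using kd True by (auto simp: k_def)
      next
        case False
        then show ?thesis using kd assms(1) by (cases i) (auto simp: k_def)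
      qed
    qed
    then show "k < length fs" "i = k \<or> i = Suc k" "\<kappa> = (if even k then d else c)" by blast+
  qed
  have "g = fs ! k"
    by (rule properD[OF long_cycleD(1) g(1) walk_nth(1)[OF long_cycleD(6) k(1)] sg(1) _ g(3)])
       (use long_cycleD(12)[OF k(1)] k(2,3) walk_nth(2,3)[OF long_cycleD(6) k(1)] in auto)
  then have "\<not> (k < kept j \<or> kept j + 2 \<le> k)" using sg(2) gone_nth[OF long_cycleD(10) k(1)] by blast
  then have "k = kept j \<or> k = Suc (kept j)" by linarith
  then show ?thesis using k assms(2) by auto
qed

text \<open>The kept edge that joins the private vertex to the middle vertex: the second kept edge
  for pattern \<open>4\<close>, the first one for all other patterns.\<close>

definition key_edge :: "nat \<Rightarrow> nat" where
  "key_edge j = (if j = 4 then fs ! 4 else fs ! j)"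

definition key :: "nat \<Rightarrow> nat" where
  "key j = the (uncolor \<sigma> fs j (key_edge j))"

lemma key_props:
  assumes "j < 5"
  shows "uncolor \<sigma> fs j (key_edge j) = Some (key j)" "key j \<in> {c, d}" "key_edge j < m"
    "cyc_vertex (priv_pos j) \<in> ends (key_edge j)"
    "key j = (if j = 4 then d else if even j then d else c)"
proof -
  have "j < length fs" "Suc j < length fs \<or> j = 4" using assms long_cycleD(9) by auto
  have kept: "j = 4 \<Longrightarrow> kept j = 3" "j \<noteq> 4 \<Longrightarrow> kept j = j" using assms by (auto simp: kept_def)
  note u = uncolor_kept[of j]
  show k: "uncolor \<sigma> fs j (key_edge j) = Some (key j)" "key j \<in> {c, d}"
    "key j = (if j = 4 then d else if even j then d else c)"
    using u kept by (auto simp: key_edge_def key_def)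
  show "key_edge j < m" "cyc_vertex (priv_pos j) \<in> ends (key_edge j)"
    using walk_nth[OF long_cycleD(6), of j] walk_nth[OF long_cycleD(6), of 4] long_cycleD(9) assms
    by (auto simp: key_edge_def priv_pos_def eval_nat_numeral)
qed

lemma mid_pos_kept: "j < 5 \<Longrightarrow> mid_pos j = Suc (kept j)"
  by (auto simp: mid_pos_def kept_def)

lemma priv_pos_kept: "j < 5 \<Longrightarrow> priv_pos j = kept j \<and> kept j = j \<and> j \<noteq> 4 \<or> priv_pos j = kept j + 2 \<and> kept j = 3 \<and> j = 4"
  by (auto simp: priv_pos_def kept_def)

text \<open>Of the edges with colors \<open>c\<close> and \<open>d\<close> at the vertices of the
  cycle only the two kept ones survive, and the key color belongs to just one of them, whose ends
  are the private and the middle vertex. Counting private colors after the erasure therefore bounds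
  the number of keys.\<close>

lemma key_in_priv:
  assumes "j < 5" "key j < q"
  shows "key j \<in> priv (uncolor \<sigma> fs j) cyc_vertex j"
  unfolding priv_def
proof (intro CollectI conjI allI impI)
  show "key j \<in> cols (uncolor \<sigma> fs j) (cyc_vertex (priv_pos j))" using key_props[OF assms(1)] by (auto simp: cols_def)
  fix i :: nat assume i: "i < 6" "i \<noteq> priv_pos j" "i \<noteq> mid_pos j"
  show "key j \<notin> cols (uncolor \<sigma> fs j) (cyc_vertex i)"
  proof
    assume k: "key j \<in> cols (uncolor \<sigma> fs j) (cyc_vertex i)"
    have "i \<le> length fs" using i(1) long_cycleD(9) by simp
    from cycle_color_gone[OF this _ key_props(2)[OF assms(1)] k] i(3) mid_pos_kept[OF assms(1)]
    have "i = kept j \<and> key j = (if even (kept j) then d else c) \<or> i = kept j + 2 \<and> key j = (if even (kept j) then c else d)"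
      by simp
    then show False using priv_pos_kept[OF assms(1)] i(2) key_props(5)[OF assms(1)] long_cycleD(5)
      by (auto split: if_splits)
  qed
qed (use assms in auto)

text \<open>The erasure affects only the colors \<open>c\<close> and \<open>d\<close>, of which at
  most the key color is private afterwards; all other colors stay at the same vertices. This links
  the number of possible predecessors, counted after the erasure, to the probability of the pattern,
  which depends on the private colors before it.\<close>

lemma priv_uncolor_subset:
  assumes "j < 5"
  shows "priv (uncolor \<sigma> fs j) cyc_vertex j - {key j} \<subseteq> priv \<sigma> cyc_vertex j"
proof
  fix \<kappa> assume "\<kappa> \<in> priv (uncolor \<sigma> fs j) cyc_vertex j - {key j}"
  then have \<kappa>: "\<kappa> < q" "\<kappa> \<in> cols (uncolor \<sigma> fs j) (cyc_vertex (priv_pos j))" "\<kappa> \<noteq> key j"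
    "\<And>i. i < 6 \<Longrightarrow> i \<noteq> priv_pos j \<Longrightarrow> i \<noteq> mid_pos j \<Longrightarrow> \<kappa> \<notin> cols (uncolor \<sigma> fs j) (cyc_vertex i)"
    by (auto simp: priv_def)
  have priv_pos: "priv_pos j \<le> length fs" "priv_pos j \<noteq> Suc (kept j)" using long_cycleD(9) priv_pos_kept[OF assms] by (auto simp: kept_def)
  have ncd: "\<kappa> \<notin> {c, d}"
  proof
    assume "\<kappa> \<in> {c, d}"
    from cycle_color_gone[OF priv_pos this \<kappa>(2)] show False
      using priv_pos_kept[OF assms] \<kappa>(3) key_props(5)[OF assms] by (auto split: if_splits)
  qed
  have sub: "\<kappa> \<in> cols (uncolor \<sigma> fs j) w" if w: "\<kappa> \<in> cols \<sigma> w" for w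
  proof -
    obtain g where g: "g < m" "\<sigma> g = Some \<kappa>" "w \<in> ends g" using w by (auto simp: cols_def)
    have "g \<notin> gone fs j"
    proof
      assume "g \<in> gone fs j"
      then have "g \<in> set fs" by (auto simp: gone_def dest: in_set_takeD in_set_dropD)
      then obtain k where "k < length fs" "g = fs ! k" by (auto simp: in_set_conv_nth)
      then show False using long_cycleD(12)[of k] g(2) ncd by (auto split: if_splits)
    qed
    then show ?thesis using g by (auto simp: cols_def uncolor_gone)
  qed
  have sup: "\<kappa> \<in> cols \<sigma> w" if "\<kappa> \<in> cols (uncolor \<sigma> fs j) w" for w
    using that by (auto simp: cols_def uncolor_gone restrict_map_def split: if_splits)
  show "\<kappa> \<in> priv \<sigma> cyc_vertex j" unfolding priv_def using \<kappa> sub sup by blast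
qed

text \<open>After the erasure the private vertex has an uncolored edge: the erased path edge next to
  the kept ones or, if the private vertex is an end of the path, \<open>e\<close> itself.\<close>

lemma card_priv_uncolor:
  assumes "j < 5"
  shows "card (priv (uncolor \<sigma> fs j) cyc_vertex j) \<le> D"
proof -
  have "\<exists>g<m. cyc_vertex (priv_pos j) \<in> ends g \<and> uncolor \<sigma> fs j g = None"
  proof (cases "j = 4")
    case True
    show ?thesis
    proof (cases "length fs = 5")
      case True
      then have "cyc_vertex 5 = r e" using long_cycleD(7) vtx_length[of "p e" fs] by simp
      then show ?thesis using \<open>j = 4\<close> long_cycleD(2,3) by (intro exI[of _ e]) (auto simp: priv_pos_def uncolor_gone restrict_map_def)
    next
      case False
      then have l: "5 < length fs" using long_cycleD(9) by simp
      then have "fs ! 5 \<in> gone fs j" using gone_nth[OF long_cycleD(10) l] \<open>j = 4\<close> by (simp add: kept_def)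
      then show ?thesis using walk_nth[OF long_cycleD(6) l] \<open>j = 4\<close>
        by (intro exI[of _ "fs ! 5"]) (auto simp: priv_pos_def uncolor_gone)
    qed
  next
    case j: False
    then have priv_pos: "priv_pos j = j" "kept j = j" using assms by (auto simp: priv_pos_def kept_def)
    show ?thesis
    proof (cases j)
      case 0
      then show ?thesis using long_cycleD(2,3) priv_pos by (intro exI[of _ e]) (auto simp: uncolor_gone restrict_map_def)
    next
      case (Suc l)
      then have l: "l < length fs" using assms long_cycleD(9) by simp
      then have "fs ! l \<in> gone fs j" using gone_nth[OF long_cycleD(10) l] Suc priv_pos by simp
      then show ?thesis using walk_nth[OF long_cycleD(6) l] Suc priv_pos
        by (intro exI[of _ "fs ! l"]) (auto simp: uncolor_gone)
    qed
  qed
  then have "card (cols (uncolor \<sigma> fs j) (cyc_vertex (priv_pos j))) \<le> D" using card_cols by blast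
  moreover have "priv (uncolor \<sigma> fs j) cyc_vertex j \<subseteq> cols (uncolor \<sigma> fs j) (cyc_vertex (priv_pos j))" by (auto simp: priv_def)
  ultimately show ?thesis using card_mono[OF finite_cols] le_trans by blast
qed

end

end

section \<open>The numerical decay rate\<close>

lemma sum_odd_powers_le:
  fixes x :: real
  assumes "0 \<le> x" "x < 1" "finite S" "S \<subseteq> {L. odd L \<and> 5 \<le> L}"
  shows "(\<Sum>L\<in>S. x ^ (L - 2)) \<le> x ^ 3 / (1 - x\<^sup>2)"
proof -
  have x2: "x\<^sup>2 < 1" "0 \<le> x\<^sup>2" using assms power_less_one_iff[of x 2] by auto
  define f where "f k = 2 * k + (5::nat)" for k
  have inj: "inj f" by (auto simp: f_def inj_def)
  have sub: "S \<subseteq> range f"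
  proof
    fix L assume "L \<in> S"
    then have "odd L" "5 \<le> L" using assms by auto
    then have "L = f ((L - 5) div 2)" unfolding f_def by presburger
    then show "L \<in> range f" by blast
  qed
  obtain K where K: "S = f ` K" using sub subset_imageE by metis
  have fin: "finite K" using assms(3) unfolding K by (rule finite_imageD) (rule inj_on_subset[OF inj subset_UNIV])
  have "(\<Sum>L\<in>S. x ^ (L - 2)) = (\<Sum>k\<in>K. x ^ (f k - 2))"
    unfolding K by (subst sum.reindex[OF inj_on_subset[OF inj subset_UNIV]]) simp
  also have "\<dots> = x ^ 3 * (\<Sum>k\<in>K. (x\<^sup>2) ^ k)"
    unfolding sum_distrib_left
  proof (rule sum.cong)
    fix k
    have "f k - 2 = 3 + 2 * k" by (simp add: f_def)
    then show "x ^ (f k - 2) = x ^ 3 * (x\<^sup>2) ^ k" by (simp only: power_add power_mult)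
  qed simp
  also have "(\<Sum>k\<in>K. (x\<^sup>2) ^ k) \<le> (\<Sum>k. (x\<^sup>2) ^ k)"
    by (rule sum_le_suminf) (use x2 fin in \<open>auto intro!: summable_geometric\<close>)
  also have "(\<Sum>k. (x\<^sup>2) ^ k) = 1 / (1 - x\<^sup>2)"
    by (rule suminf_geometric) (use x2 in auto)
  finally show ?thesis using assms(1) by (simp add: mult_left_mono)
qed

text \<open>With \<open>y = D / q\<close>, the left-hand side is largest for \<open>y\<close> close to \<open>1 / 4\<close>, where it is about
  \<open>0.9952\<close>.\<close>

lemma decay_rate_bound:
  fixes y w :: real
  assumes "0 \<le> y" "0 \<le> w" "4 * y + w \<le> 1" "finite S" "S \<subseteq> {L. odd L \<and> 5 \<le> L}"
  shows "2 * y + 2/5 + y * (6/5 - y + w) * (\<Sum>L\<in>S. (5/2 * y) ^ (L - 2)) \<le> 996/1000"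
proof -
  let ?x = "5/2 * y"
  have y: "y \<le> 1/4" and x: "0 \<le> ?x" "?x \<le> 5/8" using assms by auto
  have x2: "?x\<^sup>2 \<le> 25/64" using power_mono[OF x(2,1), of 2] by (simp add: power2_eq_square)
  have "(\<Sum>L\<in>S. ?x ^ (L - 2)) \<le> ?x ^ 3 / (1 - ?x\<^sup>2)"
    using x assms by (intro sum_odd_powers_le) auto
  also have "\<dots> \<le> ?x ^ 3 / (39/64)" using x x2 by (intro divide_left_mono) auto
  also have "\<dots> = 1000/39 * y ^ 3" by (simp add: power3_eq_cube)
  finally have s: "(\<Sum>L\<in>S. ?x ^ (L - 2)) \<le> 1000/39 * y ^ 3" .
  have y3: "y ^ 3 \<le> 1/64" using power_mono[OF y assms(1), of 3] by (simp add: power3_eq_cube)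
  have g: "0 \<le> 6/5 - y + w" "6/5 - y + w \<le> 11/5 - 5 * y" using assms y by auto
  have "y * (6/5 - y + w) * (\<Sum>L\<in>S. ?x ^ (L - 2)) \<le> (y * (11/5 - 5 * y)) * (1000/39 * (1/64))"
    using s y3 g assms(1) y by (intro mult_mono) (auto intro!: sum_nonneg mult_nonneg_nonneg)
  moreover have "2 * y + 2/5 + (y * (11/5 - 5 * y)) * (1000/39 * (1/64)) \<le> 996/1000"
  proof -
    \<comment> \<open>If \<open>f y\<close> denotes the left-hand side of the claim, this product is
      \<open>f (1/4) - f y\<close>, and \<open>f (1/4)\<close> is below \<open>996/1000\<close>. The
      denominator 2496 is \<open>39 * 64\<close>.\<close>
    have "0 \<le> (1/4 - y) * (2 + 1000/2496 * (11/5) - 5 * (1000/2496) * (1/4 + y))"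
      using y assms(1) by (intro mult_nonneg_nonneg) auto
    then show ?thesis by (simp add: field_simps)
  qed
  ultimately show ?thesis by linarith
qed

context coloring_instance begin

section \<open>Reconstructing a cycle from its trace\<close>

definition trace :: "nat \<Rightarrow> nat list \<Rightarrow> nat list \<times> nat list" where
  "trace j fs = (take (kept j) fs, rev (drop (kept j + 2) fs))"

text \<open>Read from the two ends of \<open>e\<close>, both erased pieces continue \<open>e\<close>
  without turning back. With \<open>card_chains\<close>, a path of length \<open>L\<close> therefore
  has at most \<open>D ^ (L - 2)\<close> traces: the two kept edges are not counted here.\<close>

lemma trace_chains:
  assumes "long_cycle \<sigma> e c d fs"
  shows "fst (trace j fs) \<in> chains (p e) e (kept j)"
    "snd (trace j fs) \<in> chains (r e) e (length fs - (kept j + 2))"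
proof -
  note F = long_cycleD[OF assms]
  have "distinct (e # take (kept j) fs)" using F(10,11) by (auto dest: in_set_takeD)
  then show "fst (trace j fs) \<in> chains (p e) e (kept j)"
    using nonback_of_distinct[OF walk_take[OF F(6)]] take_kept_length[OF F(9)] by (simp add: trace_def chains_def)
  have "walk (r e) (rev fs)" using walk_rev[OF F(6)] F(7) by simp
  then have "walk (r e) (take (length fs - (kept j + 2)) (rev fs))" by (rule walk_take)
  then have "walk (r e) (rev (drop (kept j + 2) fs))"
    using F(9) by (simp add: take_rev kept_def)
  moreover have "distinct (e # rev (drop (kept j + 2) fs))" using F(10,11) by (auto dest: in_set_dropD)
  ultimately show "snd (trace j fs) \<in> chains (r e) e (length fs - (kept j + 2))"
    using nonback_of_distinct by (simp add: trace_def chains_def)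
qed

lemma vtx_trace:
  assumes "long_cycle \<sigma> e c d fs"
  shows "k \<le> kept j \<Longrightarrow> vtx (p e) fs k = vtx (p e) (fst (trace j fs)) k"
    "kept j + 2 \<le> k \<Longrightarrow> k \<le> length fs \<Longrightarrow> vtx (p e) fs k = vtx (r e) (snd (trace j fs)) (length fs - k)"
proof -
  note F = long_cycleD[OF assms]
  show "vtx (p e) fs k = vtx (p e) (fst (trace j fs)) k" if "k \<le> kept j"
    using that by (simp add: vtx_def trace_def min_absorb1)
  assume k: "kept j + 2 \<le> k" "k \<le> length fs"
  have "rev fs = rev (drop (kept j + 2) fs) @ rev (take (kept j + 2) fs)"
    by (metis append_take_drop_id rev_append)
  then have "vtx (r e) (rev fs) (length fs - k) = vtx (r e) (rev (drop (kept j + 2) fs)) (length fs - k)"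
    using k by (simp add: vtx_append1)
  then show "vtx (p e) fs k = vtx (r e) (snd (trace j fs)) (length fs - k)"
    using vtx_rev[OF F(6) k(2)] F(7) by (simp add: trace_def)
qed

lemma trace_gone: "set (fst (trace j fs)) \<union> set (snd (trace j fs)) = gone fs j"
  by (simp add: trace_def gone_def)

lemma trace_length:
  assumes "5 \<le> length fs" "5 \<le> length gs" "trace j fs = trace j gs"
  shows "length fs = length gs"
proof -
  have "length (snd (trace j fs)) = length (snd (trace j gs))" using assms(3) by simp
  then show ?thesis using assms(1,2) by (auto simp: trace_def kept_def)
qed

lemma vtx_trace_eq:
  assumes "long_cycle \<sigma>\<^sub>1 e c\<^sub>1 d\<^sub>1 fs" "long_cycle \<sigma>\<^sub>2 e c\<^sub>2 d\<^sub>2 gs" "trace j fs = trace j gs"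
    "k \<le> length fs" "k \<noteq> Suc (kept j)"
  shows "vtx (p e) fs k = vtx (p e) gs k"
proof -
  have l: "length fs = length gs" using trace_length long_cycleD(9) assms by blast
  have "k \<le> kept j \<or> kept j + 2 \<le> k" using assms(5) by linarith
  then show ?thesis
    using vtx_trace(1)[OF assms(1), of k j] vtx_trace(1)[OF assms(2), of k j]
      vtx_trace(2)[OF assms(1), of j k] vtx_trace(2)[OF assms(2), of j k] assms(3,4) l by auto
qed

text \<open>Given the trace and the coloring after the uncoloring step, the color of the key edge
  determines the two remaining cycle edges, hence the two colors, hence everything.\<close>

lemma long_cycle_inj:
  assumes lc: "long_cycle \<sigma>\<^sub>1 e c\<^sub>1 d\<^sub>1 fs" "long_cycle \<sigma>\<^sub>2 e c\<^sub>2 d\<^sub>2 gs" and j: "j < 5"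
    and rec: "trace j fs = trace j gs" and uncolor: "uncolor \<sigma>\<^sub>1 fs j = uncolor \<sigma>\<^sub>2 gs j"
    and key: "key \<sigma>\<^sub>1 fs j = key \<sigma>\<^sub>2 gs j"
  shows "\<sigma>\<^sub>1 = \<sigma>\<^sub>2 \<and> c\<^sub>1 = c\<^sub>2"
proof -
  note F = long_cycleD[OF lc(1)] and G = long_cycleD[OF lc(2)]
  note K1 = key_props[OF lc(1) j] and K2 = key_props[OF lc(2) j]
  let ?\<tau> = "uncolor \<sigma>\<^sub>1 fs j" and ?y = "vtx (p e) fs" and ?z = "vtx (p e) gs"
  have l: "length fs = length gs" using trace_length[OF F(9) G(9) rec] .
  have yz: "?y k = ?z k" if "k \<le> length fs" "k \<noteq> Suc (kept j)" for k
    using vtx_trace_eq[OF lc rec that] .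
  have kept: "Suc (Suc (kept j)) \<le> length fs" "Suc (kept j) < length fs" "kept j < length fs"
    using F(9) by (auto simp: kept_def)
  have priv_pos: "?y (priv_pos j) = ?z (priv_pos j)" using yz[of "priv_pos j"] priv_pos_kept[OF lc(1) j] kept by auto
  have ke: "key_edge fs j = key_edge gs j"
    by (rule properD[OF uncolor_proper[OF lc(1), of j] K1(3) K2(3) K1(1) _ K1(4)])
       (use K2(1,4) uncolor key priv_pos in auto)
  have ends: "ends (fs ! kept j) = {?y (kept j), ?y (Suc (kept j))}" "?y (kept j) \<noteq> ?y (Suc (kept j))"
    "ends (fs ! Suc (kept j)) = {?y (Suc (kept j)), ?y (Suc (Suc (kept j)))}" "?y (Suc (kept j)) \<noteq> ?y (Suc (Suc (kept j)))"
    "ends (gs ! kept j) = {?z (kept j), ?z (Suc (kept j))}" "?z (kept j) \<noteq> ?z (Suc (kept j))"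
    "ends (gs ! Suc (kept j)) = {?z (Suc (kept j)), ?z (Suc (Suc (kept j)))}" "?z (Suc (kept j)) \<noteq> ?z (Suc (Suc (kept j)))"
    using walk_nth(4,5)[OF F(6)] walk_nth(4,5)[OF G(6)] kept l by auto
  have lt: "fs ! kept j < m" "fs ! Suc (kept j) < m" "gs ! kept j < m" "gs ! Suc (kept j) < m"
    using walk_nth(1)[OF F(6)] walk_nth(1)[OF G(6)] kept l by auto
  have yz': "?y (kept j) = ?z (kept j)" "?y (Suc (Suc (kept j))) = ?z (Suc (Suc (kept j)))" using yz kept by auto
  have "?y (Suc (kept j)) = ?z (Suc (kept j))"
  proof (cases "j = 4")
    case True
    then have "fs ! Suc (kept j) = gs ! Suc (kept j)" using ke by (simp add: key_edge_def[OF lc(1)] key_edge_def[OF lc(2)] kept_def)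
    then show ?thesis using ends yz' by (auto simp: doubleton_eq_iff)
  next
    case False
    then have "fs ! kept j = gs ! kept j" using ke j by (simp add: key_edge_def[OF lc(1)] key_edge_def[OF lc(2)] kept_def min_absorb1)
    then show ?thesis using ends yz' by (auto simp: doubleton_eq_iff)
  qed
  then have mid: "fs ! kept j = gs ! kept j" "fs ! Suc (kept j) = gs ! Suc (kept j)"
    using ends yz' lt by (auto intro!: ends_eqD)
  have fg: "fs = gs"
    using long_cycle_split[OF F(9), of j] long_cycle_split[OF G(9), of j] mid rec
    by (metis (no_types, lifting) Pair_inject trace_def rev_rev_ident)
  have dc: "d\<^sub>1 = d\<^sub>2" "c\<^sub>1 = c\<^sub>2"
    using uncolor_kept[OF lc(1), of j] uncolor_kept[OF lc(2), of j] uncolor mid by (auto split: if_splits)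
  have "\<sigma>\<^sub>1 i = \<sigma>\<^sub>2 i" for i
  proof (cases "i \<in> gone fs j")
    case True
    then have "i \<in> set fs" by (auto simp: gone_def dest: in_set_takeD in_set_dropD)
    then obtain k where k: "k < length fs" "i = fs ! k" by (auto simp: in_set_conv_nth)
    then show ?thesis using F(12)[OF k(1)] G(12)[of k] fg dc by auto
  next
    case False
    then show ?thesis using fun_cong[OF uncolor, of i] fg by (simp add: uncolor_gone)
  qed
  then show ?thesis using dc by auto
qed

section \<open>Sums over the colorings with a given uncolored set\<close>

definition pcols_off :: "nat set \<Rightarrow> (nat \<Rightarrow> nat option) set" where
  "pcols_off U = {\<sigma> \<in> pcolorings. dom \<sigma> = {..<m} - U}"

lemma finite_pcols_off: "finite (pcols_off U)"
proof (rule finite_subset)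
  show "pcols_off U \<subseteq> {\<sigma>. dom \<sigma> = {..<m} - U \<and> ran \<sigma> \<subseteq> {..<q}}" by (auto simp: pcols_off_def pcolorings_def)
  show "finite {\<sigma>. dom \<sigma> = {..<m} - U \<and> ran \<sigma> \<subseteq> {..<q}}"
    by (rule finite_set_of_finite_maps) auto
qed

lemma card_pcols_off:
  assumes "U \<subseteq> {..<m}"
  shows "card (pcols_off U) \<le> q ^ (m - card U)"
proof -
  let ?A = "{..<m} - U"
  let ?f = "\<lambda>\<sigma>. restrict (\<lambda>i. the (\<sigma> i :: nat option)) ?A"
  have "inj_on ?f (pcols_off U)"
  proof (rule inj_onI, rule ext)
    fix \<sigma> \<tau> i assume st: "\<sigma> \<in> pcols_off U" "\<tau> \<in> pcols_off U" and eq: "?f \<sigma> = ?f \<tau>"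
    have ds: "dom \<sigma> = ?A" "dom \<tau> = ?A" using st by (auto simp: pcols_off_def)
    show "\<sigma> i = \<tau> i"
    proof (cases "i \<in> ?A")
      case True
      then have "i \<in> dom \<sigma>" "i \<in> dom \<tau>" using ds by blast+
      moreover have "the (\<sigma> i) = the (\<tau> i)" using fun_cong[OF eq, of i] True by simp
      ultimately show ?thesis by auto
    next
      case False
      then have "i \<notin> dom \<sigma>" "i \<notin> dom \<tau>" using ds by blast+
      then show ?thesis by (simp add: domIff)
    qed
  qed
  moreover have "?f ` pcols_off U \<subseteq> ?A \<rightarrow>\<^sub>E {..<q}"
  proof
    fix g assume "g \<in> ?f ` pcols_off U"
    then obtain \<sigma> where s: "\<sigma> \<in> pcols_off U" and g: "g = ?f \<sigma>" by blast
    have "the (\<sigma> i) < q" if "i \<in> ?A" for i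
    proof -
      have "i \<in> dom \<sigma>" "ran \<sigma> \<subseteq> {..<q}" using s that by (auto simp: pcols_off_def pcolorings_def)
      then show ?thesis by (auto simp: ran_def)
    qed
    then show "g \<in> ?A \<rightarrow>\<^sub>E {..<q}" by (auto simp: g)
  qed
  ultimately have "card (pcols_off U) \<le> card (?A \<rightarrow>\<^sub>E {..<q})"
    by (rule card_inj_on_le) (auto intro: finite_PiE)
  also have "\<dots> = q ^ (m - card U)"
    using assms by (simp add: card_PiE card_Diff_subset finite_subset)
  finally show ?thesis .
qed

text \<open>The next edge depends on the uncolored set alone, so all colorings in one weighted sum
  treat the same edge.\<close>

lemma first_pcols_off: "\<sigma> \<in> pcols_off U \<Longrightarrow> first \<sigma> = (LEAST i. i \<ge> m \<or> i \<in> U)"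
  unfolding first_def
proof -
  assume "\<sigma> \<in> pcols_off U"
  then have d: "dom \<sigma> = {..<m} - U" by (simp add: pcols_off_def)
  have "(i \<ge> m \<or> \<sigma> i = None) = (i \<ge> m \<or> i \<in> U)" for i
  proof -
    have "i \<in> dom \<sigma> \<longleftrightarrow> i \<in> {..<m} - U" by (simp add: d)
    then show ?thesis by (auto simp: domIff)
  qed
  then show "(LEAST i. i \<ge> m \<or> \<sigma> i = None) = (LEAST i. i \<ge> m \<or> i \<in> U)" by simp
qed

lemma fail_bounds: "0 < q \<Longrightarrow> 0 \<le> fail N \<sigma>"
proof (induction N arbitrary: \<sigma>)
  case (Suc N)
  have "0 \<le> cycle_avg (fail N) \<sigma> e fs" for e fs
    unfolding cycle_avg_def using Suc by (auto intro!: sum_nonneg divide_nonneg_nonneg)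
  then have "0 \<le> color_avg (fail N) \<sigma> e c" for e c
    unfolding color_avg_def using Suc by (auto split: option.split)
  then show ?case by (auto intro!: sum_nonneg divide_nonneg_nonneg)
qed simp

definition cycle_bound :: real where
  "cycle_bound = D * (6/5 - (real D - 1) / q)"

text \<open>The more predecessors there are, the less likely each of their patterns is, but the
  product is still largest at \<open>t = D\<close>: the difference of the two sides is
  \<open>(D - t) * (6/5 - (D + t - 1) / q)\<close>, and \<open>D + t\<close> is less than
  \<open>q\<close>.\<close>

lemma mult_le_cycle_bound:
  assumes "0 < m" "t \<le> D"
  shows "t * (6/5 - (real t - 1) / q) \<le> cycle_bound" "0 \<le> 6/5 - (real t - 1) / q"
proof -
  have q: "4 * D < q" using colors[OF assms(1)] .
  have "(real D + real t - 1) / q \<le> 6/5" using q assms(2) by (simp add: divide_le_eq)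
  then have "0 \<le> (real D - real t) * (6/5 - (real D + real t - 1) / q)"
    using assms(2) by (intro mult_nonneg_nonneg) auto
  also have "\<dots> = cycle_bound - t * (6/5 - (real t - 1) / q)"
    using q by (simp add: cycle_bound_def field_simps)
  finally show "t * (6/5 - (real t - 1) / q) \<le> cycle_bound" by simp
  show "0 \<le> 6/5 - (real t - 1) / q" using q assms(2) by (simp add: divide_le_eq)
qed

lemma cycle_bound_nonneg: "0 < m \<Longrightarrow> 0 \<le> cycle_bound"
  using mult_le_cycle_bound(1)[of 0] by simp

definition success_colors :: "(nat \<Rightarrow> nat option) \<Rightarrow> nat \<Rightarrow> nat set" where
  "success_colors \<sigma> e = {c. c < q \<and> free \<sigma> e c \<and> closing \<sigma> c e = None}"

definition long_colors :: "(nat \<Rightarrow> nat option) \<Rightarrow> nat \<Rightarrow> nat set" where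
  "long_colors \<sigma> e = {c. c < q \<and> free \<sigma> e c \<and> (\<exists>fs. closing \<sigma> c e = Some fs \<and> 3 < length fs)}"

definition the_cycle :: "(nat \<Rightarrow> nat option) \<Rightarrow> nat \<Rightarrow> nat \<Rightarrow> nat list" where
  "the_cycle \<sigma> c e = the (closing \<sigma> c e)"

lemma sum_color_avg:
  fixes F :: "(nat \<Rightarrow> nat option) \<Rightarrow> real"
  shows "(\<Sum>c<q. color_avg F \<sigma> e c) = card (stall_colors \<sigma> e) * F \<sigma> + (\<Sum>c\<in>success_colors \<sigma> e. F (\<sigma>(e \<mapsto> c)))
     + (\<Sum>c\<in>long_colors \<sigma> e. cycle_avg F \<sigma> e (the_cycle \<sigma> c e))"
proof -
  have "color_avg F \<sigma> e c = (if c \<in> stall_colors \<sigma> e then F \<sigma> else 0) + (if c \<in> success_colors \<sigma> e then F (\<sigma>(e \<mapsto> c)) else 0)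
     + (if c \<in> long_colors \<sigma> e then cycle_avg F \<sigma> e (the_cycle \<sigma> c e) else 0)" if "c < q" for c
    using that by (auto simp: color_avg_def stall_colors_def success_colors_def long_colors_def the_cycle_def split: option.split)
  then have "(\<Sum>c<q. color_avg F \<sigma> e c) = (\<Sum>c<q. if c \<in> stall_colors \<sigma> e then F \<sigma> else 0)
     + (\<Sum>c<q. if c \<in> success_colors \<sigma> e then F (\<sigma>(e \<mapsto> c)) else 0)
     + (\<Sum>c<q. if c \<in> long_colors \<sigma> e then cycle_avg F \<sigma> e (the_cycle \<sigma> c e) else 0)"
    by (simp add: sum.distrib)
  moreover have "{..<q} \<inter> stall_colors \<sigma> e = stall_colors \<sigma> e" "{..<q} \<inter> success_colors \<sigma> e = success_colors \<sigma> e"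
    "{..<q} \<inter> long_colors \<sigma> e = long_colors \<sigma> e"
    by (auto simp: stall_colors_def success_colors_def long_colors_def)
  ultimately show ?thesis by (simp add: sum.inter_restrict[symmetric])
qed

lemma long_colorsD:
  assumes "\<sigma> \<in> pcolorings" "e < m" "\<sigma> e = None" "c \<in> long_colors \<sigma> e"
  shows "\<exists>d. long_cycle \<sigma> e c d (the_cycle \<sigma> c e)"
  using assms long_cycleI by (auto simp: long_colors_def pcolorings_def the_cycle_def)

lemma uncolor_pcols_off:
  assumes "\<sigma> \<in> pcols_off U" "long_cycle \<sigma> e c d fs"
  shows "uncolor \<sigma> fs j \<in> pcols_off (U \<union> gone fs j)" "U \<inter> gone fs j = {}" "gone fs j \<subseteq> {..<m}"
proof -
  note F = long_cycleD[OF assms(2)]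
  have "g < m \<and> g \<in> dom \<sigma>" if "g \<in> gone fs j" for g
  proof -
    have "g \<in> set fs" using that by (auto simp: gone_def dest: in_set_takeD in_set_dropD)
    then obtain k where "k < length fs" "g = fs ! k" by (auto simp: in_set_conv_nth)
    then show ?thesis using F(12)[of k] walk_nth(1)[OF F(6), of k] by auto
  qed
  then show g: "U \<inter> gone fs j = {}" "gone fs j \<subseteq> {..<m}" using assms(1) by (auto simp: pcols_off_def)
  have "ran (uncolor \<sigma> fs j) \<subseteq> ran \<sigma>" by (auto simp: uncolor_gone ran_def restrict_map_def)
  then show "uncolor \<sigma> fs j \<in> pcols_off (U \<union> gone fs j)"
    using assms(1) uncolor_proper[OF assms(2), of j] by (auto simp: pcols_off_def pcolorings_def uncolor_gone)
qed

lemma key_less: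
  assumes "\<sigma> \<in> pcolorings" "long_cycle \<sigma> e c d fs" "j < 5"
  shows "key \<sigma> fs j < q"
proof -
  have "uncolor \<sigma> fs j (key_edge fs j) = Some (key \<sigma> fs j)" using key_props(1)[OF assms(2,3)] .
  then have "\<sigma> (key_edge fs j) = Some (key \<sigma> fs j)" by (auto simp: uncolor_gone restrict_map_def split: if_splits)
  then show ?thesis using assms(1) by (auto simp: pcolorings_def ran_def)
qed

definition preds :: "nat set \<Rightarrow> nat \<Rightarrow> nat \<Rightarrow> nat list \<times> nat list \<Rightarrow> (nat \<Rightarrow> nat option)
    \<Rightarrow> ((nat \<Rightarrow> nat option) \<times> nat) set" where
  "preds U e j R \<tau> = {(\<sigma>, c). \<sigma> \<in> pcols_off U \<and> c \<in> long_colors \<sigma> e \<and> trace j (the_cycle \<sigma> c e) = R \<and>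
     uncolor \<sigma> (the_cycle \<sigma> c e) j = \<tau>}"

text \<open>The keys embed the predecessors into the private set \<open>T\<close> of the outcome, so
  there are at most \<open>t = card T\<close> of them. Each had at least \<open>t - 1\<close>
  private colors before the erasure, which makes its pattern unlikely when \<open>t\<close> is
  large; \<open>cycle_bound\<close> is the worst product of the two.\<close>

lemma sum_preds:
  assumes e: "e < m" "e \<in> U" and j: "j < 5"
    and a: "\<And>\<sigma>. \<sigma> \<in> pcols_off U \<Longrightarrow> 0 \<le> a \<sigma> \<and> a \<sigma> \<le> H" and H: "0 \<le> H"
  shows "(\<Sum>(\<sigma>, c)\<in>preds U e j R \<tau>. a \<sigma> / q * pattern_prob j \<sigma> (vtx (p e) (the_cycle \<sigma> c e))) \<le> H / q * (cycle_bound / 5)"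
proof (cases "preds U e j R \<tau> = {}")
  case True
  then show ?thesis using H cycle_bound_nonneg e by simp
next
  case False
  let ?fs = "\<lambda>x. the_cycle (fst x) (snd x) e"
  have q: "0 < q" using colors e by fastforce
  have pr: "fst x \<in> pcols_off U" "fst x \<in> pcolorings" "\<exists>d. long_cycle (fst x) e (snd x) d (?fs x)" "trace j (?fs x) = R"
    "uncolor (fst x) (?fs x) j = \<tau>" if x: "x \<in> preds U e j R \<tau>" for x
  proof -
    show "fst x \<in> pcols_off U" "trace j (?fs x) = R" "uncolor (fst x) (?fs x) j = \<tau>" using x by (auto simp: preds_def)
    then show "fst x \<in> pcolorings" by (simp add: pcols_off_def)
    have "e \<notin> dom (fst x)" using \<open>fst x \<in> pcols_off U\<close> e by (simp add: pcols_off_def)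
    then have "fst x e = None" by (simp add: domIff)
    then show "\<exists>d. long_cycle (fst x) e (snd x) d (?fs x)"
      using long_colorsD[OF \<open>fst x \<in> pcolorings\<close> e(1)] x by (auto simp: preds_def)
  qed
  obtain x0 where x0: "x0 \<in> preds U e j R \<tau>" using False by blast
  obtain d0 where l0: "long_cycle (fst x0) e (snd x0) d0 (?fs x0)" using pr(3)[OF x0] by blast
  define T where "T = priv \<tau> (vtx (p e) (?fs x0)) j"
  \<comment> \<open>\<open>T\<close> is the same for all predecessors: \<open>priv\<close> ignores
    the middle vertex, and the common trace fixes all other vertices.\<close>
  have T: "priv \<tau> (vtx (p e) (?fs x)) j = T" if x: "x \<in> preds U e j R \<tau>" for x
  proof -
    obtain d where l: "long_cycle (fst x) e (snd x) d (?fs x)" using pr(3)[OF x] by blast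
    have tr: "trace j (?fs x) = trace j (?fs x0)" using pr(4) x x0 by simp
    have eq: "vtx (p e) (?fs x) k = vtx (p e) (?fs x0) k" if "k < 6" "k \<noteq> mid_pos j" for k
      using vtx_trace_eq[OF l l0 tr, of k] long_cycleD(9)[OF l] that mid_pos_kept[OF l j] by simp
    have "priv_pos j < 6" "priv_pos j \<noteq> mid_pos j" using j by (auto simp: priv_pos_def mid_pos_def)
    then show ?thesis unfolding T_def priv_def using eq by auto
  qed
  define t where "t = card T"
  have fT: "finite T" by (simp add: T_def priv_def)
  have tD: "t \<le> D" using card_priv_uncolor[OF l0 j] pr(5)[OF x0] by (simp add: t_def T_def)
  have "inj_on (\<lambda>x. key (fst x) (?fs x) j) (preds U e j R \<tau>)"
  proof (rule inj_onI)
    fix x x' assume xx: "x \<in> preds U e j R \<tau>" "x' \<in> preds U e j R \<tau>" "key (fst x) (?fs x) j = key (fst x') (?fs x') j"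
    obtain d d' where "long_cycle (fst x) e (snd x) d (?fs x)" "long_cycle (fst x') e (snd x') d' (?fs x')"
      using pr(3)[OF xx(1)] pr(3)[OF xx(2)] by blast
    from long_cycle_inj[OF this j] pr(4,5)[OF xx(1)] pr(4,5)[OF xx(2)] xx(3) show "x = x'"
      by (simp add: prod_eq_iff)
  qed
  moreover have "(\<lambda>x. key (fst x) (?fs x) j) ` preds U e j R \<tau> \<subseteq> T"
  proof
    fix \<kappa> assume "\<kappa> \<in> (\<lambda>x. key (fst x) (?fs x) j) ` preds U e j R \<tau>"
    then obtain x where x: "x \<in> preds U e j R \<tau>" "\<kappa> = key (fst x) (?fs x) j" by blast
    obtain d where l: "long_cycle (fst x) e (snd x) d (?fs x)" using pr(3)[OF x(1)] by blast
    show "\<kappa> \<in> T"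
      using key_in_priv[OF l j key_less[OF pr(2)[OF x(1)] l j]] T[OF x(1)] pr(5)[OF x(1)] x(2) by simp
  qed
  ultimately have cp: "card (preds U e j R \<tau>) \<le> t" unfolding t_def using card_inj_on_le fT by blast
  have pattern_prob: "a (fst x) / q * pattern_prob j (fst x) (vtx (p e) (?fs x)) \<le> H / q * ((6/5 - (real t - 1) / q) / 5)"
    if x: "x \<in> preds U e j R \<tau>" for x
  proof -
    obtain d where l: "long_cycle (fst x) e (snd x) d (?fs x)" using pr(3)[OF x] by blast
    let ?priv = "priv (fst x) (vtx (p e) (?fs x)) j"
    have "T - {key (fst x) (?fs x) j} \<subseteq> ?priv" using priv_uncolor_subset[OF l j] T[OF x] pr(5)[OF x] by simp
    moreover have "finite ?priv" by (simp add: priv_def)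
    ultimately have "card (T - {key (fst x) (?fs x) j}) \<le> card ?priv" by (rule card_mono[rotated])
    then have "real t - 1 \<le> card ?priv" unfolding t_def using diff_card_le_card_Diff[of "{key (fst x) (?fs x) j}" T] by simp
    then have "(real t - 1) / q \<le> card ?priv / q" by (rule divide_right_mono) simp
    then have "pattern_prob j (fst x) (vtx (p e) (?fs x)) \<le> (6/5 - (real t - 1) / q) / 5"
      using pattern_prob_bounds(2)[OF q, of j "fst x" "vtx (p e) (?fs x)"] by simp
    moreover have "a (fst x) / q \<le> H / q" using a[OF pr(1)[OF x]] by (simp add: divide_right_mono)
    ultimately show ?thesis
      using pattern_prob_bounds(1)[OF q, of j "fst x" "vtx (p e) (?fs x)"] H a[OF pr(1)[OF x]] by (intro mult_mono) auto
  qed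
  have "(\<Sum>(\<sigma>, c)\<in>preds U e j R \<tau>. a \<sigma> / q * pattern_prob j \<sigma> (vtx (p e) (the_cycle \<sigma> c e)))
     = (\<Sum>x\<in>preds U e j R \<tau>. a (fst x) / q * pattern_prob j (fst x) (vtx (p e) (?fs x)))"
    by (simp add: case_prod_unfold)
  also have "\<dots> \<le> (\<Sum>x\<in>preds U e j R \<tau>. H / q * ((6/5 - (real t - 1) / q) / 5))"
    by (rule sum_mono) (rule pattern_prob)
  also have "\<dots> = card (preds U e j R \<tau>) * (H / q * ((6/5 - (real t - 1) / q) / 5))" by simp
  also have "\<dots> \<le> t * (H / q * ((6/5 - (real t - 1) / q) / 5))"
    using cp H mult_le_cycle_bound(2)[OF _ tD] e by (intro mult_right_mono mult_nonneg_nonneg) auto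
  also have "\<dots> = H / q * (t * (6/5 - (real t - 1) / q) / 5)" by simp
  also have "\<dots> \<le> H / q * (cycle_bound / 5)"
    using H mult_le_cycle_bound(1)[OF _ tD] e by (intro mult_left_mono) auto
  finally show ?thesis .
qed

abbreviation (input) "\<rho> \<equiv> (996/1000 :: real)"

lemma sum_over_fibers:
  assumes "finite A" "finite B" "f ` A \<subseteq> B"
  shows "(\<Sum>x\<in>A. (g x :: real) * F (f x)) = (\<Sum>y\<in>B. (\<Sum>x\<in>{x\<in>A. f x = y}. g x) * F y)"
proof -
  have "(\<Sum>x\<in>A. g x * F (f x)) = (\<Sum>y\<in>B. \<Sum>x\<in>{x\<in>A. f x = y}. g x * F (f x))"
    by (rule sum.group[OF assms, symmetric])
  also have "\<dots> = (\<Sum>y\<in>B. (\<Sum>x\<in>{x\<in>A. f x = y}. g x) * F y)"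
    unfolding sum_distrib_right by (intro sum.cong) auto
  finally show ?thesis .
qed

section \<open>The failure probability\<close>

text \<open>Here \<open>a \<sigma>\<close> is the probability of a fixed history, that is, a fixed sequence of sets of
  uncolored edges, ending with the coloring \<open>\<sigma>\<close>. Each of the colors present in \<open>\<sigma>\<close> was hit with
  probability \<open>1 / q\<close>, which is compensated by the number of colorings with a given domain. The factor
  \<open>5/2\<close> per uncolored edge is close to optimal for the sum over all histories.\<close>

definition decay :: "nat \<Rightarrow> bool" where
  "decay N \<longleftrightarrow> (\<forall>U a h. U \<subseteq> {..<m} \<longrightarrow> 0 \<le> h \<longrightarrow> (\<forall>\<sigma>\<in>pcols_off U. 0 \<le> a \<sigma> \<and> a \<sigma> \<le> h / q ^ (m - card U)) \<longrightarrow>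
     (\<Sum>\<sigma>\<in>pcols_off U. a \<sigma> * fail N \<sigma>) \<le> h * (5/2) ^ card U * \<rho> ^ N)"

lemma decayD:
  assumes "decay N" "U \<subseteq> {..<m}" "0 \<le> h" "\<And>\<sigma>. \<sigma> \<in> pcols_off U \<Longrightarrow> 0 \<le> a \<sigma> \<and> a \<sigma> \<le> h / q ^ (m - card U)"
  shows "(\<Sum>\<sigma>\<in>pcols_off U. a \<sigma> * fail N \<sigma>) \<le> h * (5/2) ^ card U * \<rho> ^ N"
  using assms unfolding decay_def by simp

context
  fixes N U a h e
  assumes IH: "decay N" and U: "U \<subseteq> {..<m}" and h: "0 \<le> h"
    and a: "\<And>\<sigma>. \<sigma> \<in> pcols_off U \<Longrightarrow> 0 \<le> a \<sigma> \<and> a \<sigma> \<le> h / q ^ (m - card U)"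
    and e: "e < m" "e \<in> U"
begin

lemma q_pos: "0 < q"
  using colors e by fastforce

lemma pcols_off_e: "\<sigma> \<in> pcols_off U \<Longrightarrow> \<sigma> e = None \<and> proper \<sigma> \<and> \<sigma> \<in> pcolorings"
proof -
  assume s: "\<sigma> \<in> pcols_off U"
  then have "e \<notin> dom \<sigma>" using e by (simp add: pcols_off_def)
  then show ?thesis using s by (simp add: pcols_off_def pcolorings_def domIff)
qed

text \<open>The coloring stays the same, so its weight is merely multiplied by the fraction of
  stalling colors.\<close>

lemma stall_part:
  "(\<Sum>\<sigma>\<in>pcols_off U. a \<sigma> * card (stall_colors \<sigma> e) / q * fail N \<sigma>) \<le> h * (2 * D / q) * (5/2) ^ card U * \<rho> ^ N"
proof -
  have "0 \<le> a \<sigma> * card (stall_colors \<sigma> e) / q \<and> a \<sigma> * card (stall_colors \<sigma> e) / q \<le> h * (2 * D / q) / q ^ (m - card U)"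
    if s: "\<sigma> \<in> pcols_off U" for \<sigma>
  proof
    have c: "real (card (stall_colors \<sigma> e)) \<le> 2 * D" using card_stall_colors[OF _ e(1)] pcols_off_e[OF s] by force
    show "0 \<le> a \<sigma> * card (stall_colors \<sigma> e) / q" using a[OF s] by simp
    have "a \<sigma> * card (stall_colors \<sigma> e) / q \<le> h / q ^ (m - card U) * (2 * D) / q"
      using a[OF s] c by (intro divide_right_mono mult_mono) auto
    then show "a \<sigma> * card (stall_colors \<sigma> e) / q \<le> h * (2 * D / q) / q ^ (m - card U)" by (simp add: field_simps)
  qed
  then show ?thesis using U h by (intro decayD[OF IH]) auto
qed

text \<open>An outcome has only one predecessor, obtained by uncoloring \<open>e\<close>. The
  probability \<open>1 / q\<close> of the color is absorbed by the larger domain, and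
  \<open>2/5\<close> is the released weight of \<open>e\<close>.\<close>

lemma succ_part:
  "(\<Sum>\<sigma>\<in>pcols_off U. \<Sum>c\<in>success_colors \<sigma> e. a \<sigma> / q * fail N (\<sigma>(e \<mapsto> c))) \<le> h * (2/5) * (5/2) ^ card U * \<rho> ^ N"
proof -
  let ?A = "Sigma (pcols_off U) (\<lambda>\<sigma>. success_colors \<sigma> e)" and ?f = "\<lambda>(\<sigma>, c). \<sigma>(e \<mapsto> c)" and ?B = "pcols_off (U - {e})"
  have finA: "finite ?A" by (intro finite_SigmaI finite_pcols_off) (simp add: success_colors_def)
  have fAB: "?f ` ?A \<subseteq> ?B"
  proof
    fix \<tau> assume "\<tau> \<in> ?f ` ?A"
    then obtain \<sigma> c where s: "\<sigma> \<in> pcols_off U" "c \<in> success_colors \<sigma> e" "\<tau> = \<sigma>(e \<mapsto> c)" by auto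
    have "proper \<tau>" using proper_insert pcols_off_e[OF s(1)] s by (simp add: success_colors_def)
    moreover have "ran \<tau> \<subseteq> {..<q}" using s pcols_off_e[OF s(1)] by (auto simp: success_colors_def pcolorings_def ran_def)
    moreover have "dom \<tau> = {..<m} - (U - {e})" using s e by (auto simp: pcols_off_def)
    ultimately show "\<tau> \<in> ?B" by (auto simp: pcols_off_def pcolorings_def)
  qed
  have cU: "0 < card U" "card U \<le> m"
    using e U card_mono[OF _ U] card_gt_0_iff finite_subset[OF U] by auto
  then have cU': "m - card (U - {e}) = Suc (m - card U)" "card U = Suc (card (U - {e}))"
    using e finite_subset[OF U] by (auto simp: card_Diff_singleton)
  have "(\<Sum>\<sigma>\<in>pcols_off U. \<Sum>c\<in>success_colors \<sigma> e. a \<sigma> / q * fail N (\<sigma>(e \<mapsto> c))) = (\<Sum>x\<in>?A. a (fst x) / q * fail N (?f x))"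
    by (subst sum.Sigma[OF finite_pcols_off]) (auto simp: success_colors_def case_prod_unfold)
  also have "\<dots> = (\<Sum>\<tau>\<in>?B. (\<Sum>x\<in>{x\<in>?A. ?f x = \<tau>}. a (fst x) / q) * fail N \<tau>)"
    by (rule sum_over_fibers[OF finA finite_pcols_off fAB])
  also have "\<dots> \<le> h * (5/2) ^ card (U - {e}) * \<rho> ^ N"
  proof -
    have "0 \<le> (\<Sum>x\<in>{x\<in>?A. ?f x = \<tau>}. a (fst x) / q) \<and>
      (\<Sum>x\<in>{x\<in>?A. ?f x = \<tau>}. a (fst x) / q) \<le> h / q ^ (m - card (U - {e}))" for \<tau>
    proof
      show "0 \<le> (\<Sum>x\<in>{x\<in>?A. ?f x = \<tau>}. a (fst x) / q)" using a by (auto intro!: sum_nonneg)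
      have sub: "{x\<in>?A. ?f x = \<tau>} \<subseteq> {(\<tau>(e := None), the (\<tau> e))}"
      proof
        fix x assume "x \<in> {x\<in>?A. ?f x = \<tau>}"
        then obtain \<sigma> c where x: "x = (\<sigma>, c)" "\<sigma> \<in> pcols_off U" "\<sigma>(e \<mapsto> c) = \<tau>" by auto
        have "\<tau>(e := None) = \<sigma>" "\<tau> e = Some c" using pcols_off_e[OF x(2)] x(3) by auto
        then show "x \<in> {(\<tau>(e := None), the (\<tau> e))}" using x(1) by simp
      qed
      have "(\<Sum>x\<in>{x\<in>?A. ?f x = \<tau>}. a (fst x) / q) \<le> (\<Sum>x\<in>{x\<in>?A. ?f x = \<tau>}. h / q ^ (m - card U) / q)"
        using a by (intro sum_mono divide_right_mono) auto
      also have "\<dots> = card {x\<in>?A. ?f x = \<tau>} * (h / q ^ (m - card U) / q)" by simp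
      also have "\<dots> \<le> 1 * (h / q ^ (m - card U) / q)"
        using card_mono[OF _ sub] h by (intro mult_right_mono) auto
      also have "\<dots> = h / q ^ (m - card (U - {e}))" unfolding cU' by simp
      finally show "(\<Sum>x\<in>{x\<in>?A. ?f x = \<tau>}. a (fst x) / q) \<le> h / q ^ (m - card (U - {e}))" .
    qed
    moreover have "U - {e} \<subseteq> {..<m}" using U by blast
    ultimately show ?thesis using h by (intro decayD[OF IH])
  qed
  also have "\<dots> = h * (2/5) * (5/2) ^ card U * \<rho> ^ N" unfolding cU' by simp
  finally show ?thesis .
qed

lemma finite_long_colors: "finite (long_colors \<sigma> e)"
  by (simp add: long_colors_def)

text \<open>Fixing the trace fixes the erased set, so all outcomes lie in a single
  \<open>pcols_off U'\<close> and the induction hypothesis applies to them at once. Since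
  \<open>L - 2\<close> edges leave the domain, \<open>h\<close> is divided by
  \<open>q ^ (L - 2)\<close>, and these edges contribute the weight
  \<open>(5/2) ^ (L - 2)\<close>.\<close>

lemma trace_part:
  assumes j: "j < 5" and R: "fst R \<in> chains (p e) e (kept j)" "snd R \<in> chains (r e) e (L - (kept j + 2))"
    and L: "5 \<le> L"
  defines "X \<equiv> {(\<sigma>, c). \<sigma> \<in> pcols_off U \<and> c \<in> long_colors \<sigma> e \<and> trace j (the_cycle \<sigma> c e) = R}"
  shows "(\<Sum>(\<sigma>, c)\<in>X. a \<sigma> / q * pattern_prob j \<sigma> (vtx (p e) (the_cycle \<sigma> c e)) * fail N (uncolor \<sigma> (the_cycle \<sigma> c e) j))
    \<le> h / q ^ (L - 2) / q * (cycle_bound / 5) * (5/2) ^ (card U + (L - 2)) * \<rho> ^ N"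
proof (cases "X = {}")
  case True
  then show ?thesis using h cycle_bound_nonneg e by simp
next
  case False
  let ?fs = "\<lambda>x. the_cycle (fst x) (snd x) e"
  let ?f = "\<lambda>x. uncolor (fst x) (?fs x) j"
  define G where "G = set (fst R) \<union> set (snd R)"
  have X: "fst x \<in> pcols_off U" "\<exists>d. long_cycle (fst x) e (snd x) d (?fs x)" "gone (?fs x) j = G"
    "length (?fs x) = L" if x: "x \<in> X" for x
  proof -
    show s: "fst x \<in> pcols_off U" using x by (auto simp: X_def)
    show lc: "\<exists>d. long_cycle (fst x) e (snd x) d (?fs x)"
      using long_colorsD[OF _ e(1)] pcols_off_e[OF s] x by (auto simp: X_def)
    have tr: "trace j (?fs x) = R" using x by (auto simp: X_def)
    then show "gone (?fs x) j = G" using trace_gone[of j "?fs x"] by (simp add: G_def)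
    have "length (snd (trace j (?fs x))) = L - (kept j + 2)" using R(2) tr by (simp add: chains_def)
    then show "length (?fs x) = L" using lc L long_cycleD(9) by (fastforce simp: trace_def kept_def)
  qed
  obtain x0 where x0: "x0 \<in> X" using False by blast
  obtain d0 where l0: "long_cycle (fst x0) e (snd x0) d0 (?fs x0)" using X(2)[OF x0] by blast
  have G: "U \<inter> G = {}" "G \<subseteq> {..<m}" "card G = L - 2"
    using uncolor_pcols_off(2,3)[OF X(1)[OF x0] l0, of j] X(3,4)[OF x0] gone_card[of "?fs x0" j] long_cycleD(9,10)[OF l0] by auto
  define U' where "U' = U \<union> G"
  have U': "U' \<subseteq> {..<m}" "card U' = card U + (L - 2)"
    using U G by (auto simp: U'_def card_Un_disjoint finite_subset[OF U] finite_subset[OF G(2)])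
  have "card U' \<le> m" using card_mono[OF _ U'(1)] by simp
  then have pw: "m - card U = (m - card U') + (L - 2)" using U'(2) by simp
  have finX: "finite X"
    by (rule finite_subset[of _ "Sigma (pcols_off U) (\<lambda>\<sigma>. long_colors \<sigma> e)"])
       (auto simp: X_def finite_pcols_off finite_long_colors)
  have fX: "?f ` X \<subseteq> pcols_off U'"
  proof
    fix \<tau> assume "\<tau> \<in> ?f ` X"
    then obtain x where x: "x \<in> X" "\<tau> = ?f x" by blast
    obtain d where "long_cycle (fst x) e (snd x) d (?fs x)" using X(2)[OF x(1)] by blast
    from uncolor_pcols_off(1)[OF X(1)[OF x(1)] this, of j] show "\<tau> \<in> pcols_off U'" using X(3)[OF x(1)] x(2) by (simp add: U'_def)
  qed
  have "(\<Sum>(\<sigma>, c)\<in>X. a \<sigma> / q * pattern_prob j \<sigma> (vtx (p e) (the_cycle \<sigma> c e)) * fail N (uncolor \<sigma> (the_cycle \<sigma> c e) j))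
     = (\<Sum>x\<in>X. (a (fst x) / q * pattern_prob j (fst x) (vtx (p e) (?fs x))) * fail N (?f x))"
    by (simp add: case_prod_unfold)
  also have "\<dots> = (\<Sum>\<tau>\<in>pcols_off U'. (\<Sum>x\<in>{x\<in>X. ?f x = \<tau>}. a (fst x) / q * pattern_prob j (fst x) (vtx (p e) (?fs x))) * fail N \<tau>)"
    by (rule sum_over_fibers[OF finX finite_pcols_off fX])
  also have "\<dots> \<le> h / q ^ (L - 2) / q * (cycle_bound / 5) * (5/2) ^ card U' * \<rho> ^ N"
  proof -
    have "0 \<le> (\<Sum>x\<in>{x\<in>X. ?f x = \<tau>}. a (fst x) / q * pattern_prob j (fst x) (vtx (p e) (?fs x))) \<and>
      (\<Sum>x\<in>{x\<in>X. ?f x = \<tau>}. a (fst x) / q * pattern_prob j (fst x) (vtx (p e) (?fs x)))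
        \<le> h / q ^ (L - 2) / q * (cycle_bound / 5) / q ^ (m - card U')" for \<tau>
    proof
      show "0 \<le> (\<Sum>x\<in>{x\<in>X. ?f x = \<tau>}. a (fst x) / q * pattern_prob j (fst x) (vtx (p e) (?fs x)))"
        using a X(1) pattern_prob_bounds(1)[OF q_pos] by (intro sum_nonneg mult_nonneg_nonneg) auto
      have "{x\<in>X. ?f x = \<tau>} = preds U e j R \<tau>" by (auto simp: X_def preds_def)
      then have "(\<Sum>x\<in>{x\<in>X. ?f x = \<tau>}. a (fst x) / q * pattern_prob j (fst x) (vtx (p e) (?fs x)))
          = (\<Sum>(\<sigma>, c)\<in>preds U e j R \<tau>. a \<sigma> / q * pattern_prob j \<sigma> (vtx (p e) (the_cycle \<sigma> c e)))"
        by (simp add: case_prod_unfold)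
      also have "\<dots> \<le> h / q ^ (m - card U) / q * (cycle_bound / 5)"
        by (rule sum_preds[OF e j a]) (use h in auto)
      also have "\<dots> = h / q ^ (L - 2) / q * (cycle_bound / 5) / q ^ (m - card U')"
        unfolding pw by (simp add: power_add mult.commute)
      finally show "(\<Sum>x\<in>{x\<in>X. ?f x = \<tau>}. a (fst x) / q * pattern_prob j (fst x) (vtx (p e) (?fs x)))
        \<le> h / q ^ (L - 2) / q * (cycle_bound / 5) / q ^ (m - card U')" .
    qed
    moreover have "0 \<le> h / q ^ (L - 2) / q * (cycle_bound / 5)" using h cycle_bound_nonneg e by simp
    ultimately show ?thesis by (intro decayD[OF IH U'(1)])
  qed
  finally show ?thesis unfolding U'(2) .
qed

definition cycle_lengths :: "nat set" where
  "cycle_lengths = {L. odd L \<and> 5 \<le> L \<and> L \<le> m}"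

text \<open>\<open>trace_part\<close> is summed over the patterns, the lengths and at most
  \<open>D ^ (L - 2)\<close> traces; the number of patterns cancels the denominator in
  \<open>cycle_bound / 5\<close>.\<close>

lemma long_part:
  "(\<Sum>\<sigma>\<in>pcols_off U. \<Sum>c\<in>long_colors \<sigma> e. a \<sigma> / q * cycle_avg (fail N) \<sigma> e (the_cycle \<sigma> c e))
    \<le> h * (cycle_bound / q * (\<Sum>L\<in>cycle_lengths. (5/2 * (D / q)) ^ (L - 2))) * (5/2) ^ card U * \<rho> ^ N"
proof -
  let ?A = "Sigma (pcols_off U) (\<lambda>\<sigma>. long_colors \<sigma> e)"
  let ?w = "\<lambda>j (\<sigma>, c). a \<sigma> / q * pattern_prob j \<sigma> (vtx (p e) (the_cycle \<sigma> c e)) * fail N (uncolor \<sigma> (the_cycle \<sigma> c e) j)"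
  have finA: "finite ?A" by (intro finite_SigmaI finite_pcols_off finite_long_colors)
  have finL: "finite cycle_lengths" by (rule finite_subset[of _ "{..m}"]) (auto simp: cycle_lengths_def)
  have "(\<Sum>\<sigma>\<in>pcols_off U. \<Sum>c\<in>long_colors \<sigma> e. a \<sigma> / q * cycle_avg (fail N) \<sigma> e (the_cycle \<sigma> c e))
     = (\<Sum>(\<sigma>, c)\<in>?A. a \<sigma> / q * cycle_avg (fail N) \<sigma> e (the_cycle \<sigma> c e))"
    by (rule sum.Sigma) (auto simp: finite_pcols_off finite_long_colors)
  also have "\<dots> = (\<Sum>x\<in>?A. \<Sum>j<5. ?w j x)"
    by (simp add: cycle_avg_eq[OF q_pos] sum_distrib_left case_prod_unfold mult.assoc)
  also have "\<dots> = (\<Sum>j<5. \<Sum>x\<in>?A. ?w j x)" by (rule sum.swap)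
  also have "\<dots> \<le> (\<Sum>j<(5::nat). \<Sum>L\<in>cycle_lengths. D ^ (L - 2) * (h / q ^ (L - 2) / q * (cycle_bound / 5) * (5/2) ^ (card U + (L - 2)) * \<rho> ^ N))"
  proof (rule sum_mono)
    fix j :: nat assume "j \<in> {..<5}"
    then have j: "j < 5" by simp
    let ?bd = "\<lambda>L. h / q ^ (L - 2) / q * (cycle_bound / 5) * (5/2) ^ (card U + (L - 2)) * \<rho> ^ N"
    let ?C = "\<lambda>L. chains (p e) e (kept j) \<times> chains (r e) e (L - (kept j + 2))"
    let ?g = "\<lambda>(\<sigma>, c). (length (the_cycle \<sigma> c e), trace j (the_cycle \<sigma> c e))"
    have cC: "finite (?C L)" "card (?C L) \<le> D ^ (L - 2)" if L: "L \<in> cycle_lengths" for L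
    proof -
      note c1 = card_chains[OF e(1), of "p e" "kept j"] and c2 = card_chains[OF e(1), of "r e" "L - (kept j + 2)"]
      show "finite (?C L)" using c1 c2 by simp
      have "card (?C L) \<le> D ^ kept j * D ^ (L - (kept j + 2))"
        unfolding card_cartesian_product using c1 c2 by (intro mult_mono) auto
      also have "\<dots> = D ^ (L - 2)" unfolding power_add[symmetric]
        using L by (intro arg_cong[of _ _ "\<lambda>k. D ^ k"]) (auto simp: cycle_lengths_def kept_def)
      finally show "card (?C L) \<le> D ^ (L - 2)" .
    qed
    have gA: "?g ` ?A \<subseteq> Sigma cycle_lengths ?C"
    proof
      fix z assume "z \<in> ?g ` ?A"
      then obtain \<sigma> c where s: "\<sigma> \<in> pcols_off U" "c \<in> long_colors \<sigma> e" "z = ?g (\<sigma>, c)" by auto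
      then obtain d where lc: "long_cycle \<sigma> e c d (the_cycle \<sigma> c e)" using long_colorsD[OF _ e(1)] pcols_off_e by blast
      note F = long_cycleD[OF lc]
      have "length (the_cycle \<sigma> c e) \<le> m"
        using altpath_length(1)[of \<sigma> d c "p e" "the_cycle \<sigma> c e"] lc by (auto simp: long_cycle_def free_def)
      then show "z \<in> Sigma cycle_lengths ?C"
        using F(8,9) trace_chains[OF lc, of j] s(3) by (auto simp: cycle_lengths_def mem_Times_iff)
    qed
    define H where "H z = (\<Sum>x\<in>{x\<in>?A. ?g x = z}. ?w j x)" for z
    have "(\<Sum>x\<in>?A. ?w j x) = (\<Sum>z\<in>Sigma cycle_lengths ?C. H z)"
      unfolding H_def by (rule sum.group[symmetric, OF finA _ gA]) (use finL cC in auto)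
    also have "\<dots> = (\<Sum>L\<in>cycle_lengths. \<Sum>R\<in>?C L. H (L, R))"
      using cC(1) by (subst sum.Sigma[OF finL]) (auto simp: case_prod_unfold)
    also have "\<dots> \<le> (\<Sum>L\<in>cycle_lengths. \<Sum>R\<in>?C L. ?bd L)"
    proof (intro sum_mono)
      fix L R assume L: "L \<in> cycle_lengths" and R: "R \<in> ?C L"
      have L5: "5 \<le> L" using L by (simp add: cycle_lengths_def)
      let ?X = "{(\<sigma>, c). \<sigma> \<in> pcols_off U \<and> c \<in> long_colors \<sigma> e \<and> trace j (the_cycle \<sigma> c e) = R}"
      have "(\<Sum>x\<in>{x\<in>?A. ?g x = (L, R)}. ?w j x) \<le> (\<Sum>x\<in>?X. ?w j x)"
      proof (rule sum_mono2)
        show "finite ?X" by (rule finite_subset[OF _ finA]) auto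
        fix x assume "x \<in> ?X - {x\<in>?A. ?g x = (L, R)}"
        then show "0 \<le> ?w j x"
          using a pattern_prob_bounds(1)[OF q_pos] fail_bounds[OF q_pos] by (auto intro!: mult_nonneg_nonneg divide_nonneg_nonneg)
      qed auto
      also have "\<dots> \<le> ?bd L" using trace_part[OF j _ _ L5, of R] R by (auto simp: mem_Times_iff)
      finally show "H (L, R) \<le> ?bd L" unfolding H_def .
    qed
    also have "\<dots> = (\<Sum>L\<in>cycle_lengths. card (?C L) * ?bd L)" by simp
    also have "\<dots> \<le> (\<Sum>L\<in>cycle_lengths. D ^ (L - 2) * ?bd L)"
      using cC(2) h cycle_bound_nonneg e by (intro sum_mono mult_right_mono) (auto simp flip: of_nat_power)
    finally show "(\<Sum>x\<in>?A. ?w j x) \<le> (\<Sum>L\<in>cycle_lengths. D ^ (L - 2) * ?bd L)" .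
  qed
  also have "\<dots> = h * (cycle_bound / q * (\<Sum>L\<in>cycle_lengths. (5/2 * (D / q)) ^ (L - 2))) * (5/2) ^ card U * \<rho> ^ N"
    by (simp add: sum_distrib_left sum_distrib_right power_add power_mult_distrib power_divide mult_ac)
  finally show ?thesis .
qed

lemma step_part:
  assumes "\<And>\<sigma>. \<sigma> \<in> pcols_off U \<Longrightarrow> first \<sigma> = e"
  shows "(\<Sum>\<sigma>\<in>pcols_off U. a \<sigma> * fail (Suc N) \<sigma>) \<le> h * (5/2) ^ card U * \<rho> ^ Suc N"
proof -
  let ?y = "D / q :: real" and ?S = "\<Sum>L\<in>cycle_lengths. (5/2 * (D / q)) ^ (L - 2) :: real"
  have "(\<Sum>\<sigma>\<in>pcols_off U. a \<sigma> * fail (Suc N) \<sigma>) = (\<Sum>\<sigma>\<in>pcols_off U. a \<sigma> * card (stall_colors \<sigma> e) / q * fail N \<sigma>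
     + (\<Sum>c\<in>success_colors \<sigma> e. a \<sigma> / q * fail N (\<sigma>(e \<mapsto> c)))
     + (\<Sum>c\<in>long_colors \<sigma> e. a \<sigma> / q * cycle_avg (fail N) \<sigma> e (the_cycle \<sigma> c e)))"
  proof (rule sum.cong)
    fix \<sigma> assume "\<sigma> \<in> pcols_off U"
    then have "first \<sigma> = e" using assms by simp
    then have f: "fail (Suc N) \<sigma> = (card (stall_colors \<sigma> e) * fail N \<sigma> + (\<Sum>c\<in>success_colors \<sigma> e. fail N (\<sigma>(e \<mapsto> c)))
     + (\<Sum>c\<in>long_colors \<sigma> e. cycle_avg (fail N) \<sigma> e (the_cycle \<sigma> c e))) / q"
      using e by (simp add: sum_color_avg)
    then show "a \<sigma> * fail (Suc N) \<sigma> = a \<sigma> * card (stall_colors \<sigma> e) / q * fail N \<sigma>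
     + (\<Sum>c\<in>success_colors \<sigma> e. a \<sigma> / q * fail N (\<sigma>(e \<mapsto> c)))
     + (\<Sum>c\<in>long_colors \<sigma> e. a \<sigma> / q * cycle_avg (fail N) \<sigma> e (the_cycle \<sigma> c e))"
      unfolding f by (simp add: sum_distrib_left add_divide_distrib distrib_left sum_divide_distrib)
  qed simp
  also have "\<dots> \<le> h * (2 * D / q) * (5/2) ^ card U * \<rho> ^ N + h * (2/5) * (5/2) ^ card U * \<rho> ^ N
     + h * (cycle_bound / q * ?S) * (5/2) ^ card U * \<rho> ^ N"
    unfolding sum.distrib by (intro add_mono stall_part succ_part long_part)
  also have "\<dots> = h * (5/2) ^ card U * \<rho> ^ N * (2 * ?y + 2/5 + cycle_bound / q * ?S)" by (simp add: algebra_simps)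
  also have "cycle_bound / q = ?y * (6/5 - ?y + 1 / q)"
    by (simp add: cycle_bound_def diff_divide_distrib)
  also have "h * (5/2) ^ card U * \<rho> ^ N * (2 * ?y + 2/5 + ?y * (6/5 - ?y + 1 / q) * ?S) \<le>
     h * (5/2) ^ card U * \<rho> ^ N * \<rho>"
  proof (intro mult_left_mono decay_rate_bound)
    \<comment> \<open>Integrality makes room for the extra \<open>1 / q\<close>, which stems from
      having \<open>t - 1\<close> private colors rather than \<open>t\<close>.\<close>
    have "4 * real D + 1 \<le> q" using colors e(1) by linarith
    then show "4 * ?y + 1 / q \<le> 1" using q_pos by (simp add: field_simps)
    show "finite cycle_lengths" by (rule finite_subset[of _ "{..m}"]) (auto simp: cycle_lengths_def)
  qed (use h in \<open>auto simp: cycle_lengths_def\<close>)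
  finally show ?thesis by simp
qed

end

lemma decay: "decay N"
proof (induction N)
  case 0
  show ?case unfolding decay_def
  proof (intro allI impI)
    fix U and a :: "(nat \<Rightarrow> nat option) \<Rightarrow> real" and h :: real
    assume U: "U \<subseteq> {..<m}" and h: "0 \<le> h" and a: "\<forall>\<sigma>\<in>pcols_off U. 0 \<le> a \<sigma> \<and> a \<sigma> \<le> h / q ^ (m - card U)"
    show "(\<Sum>\<sigma>\<in>pcols_off U. a \<sigma> * fail 0 \<sigma>) \<le> h * (5/2) ^ card U * \<rho> ^ 0"
    proof (cases "m = 0")
      case True
      then have "\<not> first \<sigma> < m" for \<sigma> by linarith
      then show ?thesis using h by simp
    next
      case False
      then have q: "0 < q" using colors by fastforce
      have "(\<Sum>\<sigma>\<in>pcols_off U. a \<sigma> * fail 0 \<sigma>) \<le> (\<Sum>\<sigma>\<in>pcols_off U. h / q ^ (m - card U))"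
        using a h by (intro sum_mono) auto
      also have "\<dots> = card (pcols_off U) * (h / q ^ (m - card U))" by simp
      also have "\<dots> \<le> real (q ^ (m - card U)) * (h / q ^ (m - card U))"
        using card_pcols_off[OF U] h by (intro mult_right_mono) (auto simp flip: of_nat_power)
      also have "\<dots> = h * 1" using q by simp
      also have "\<dots> \<le> h * (5/2) ^ card U" using h by (intro mult_left_mono) auto
      finally show ?thesis by simp
    qed
  qed
next
  case (Suc N)
  show ?case unfolding decay_def
  proof (intro allI impI)
    fix U and a :: "(nat \<Rightarrow> nat option) \<Rightarrow> real" and h :: real
    assume U: "U \<subseteq> {..<m}" and h: "0 \<le> h" and a: "\<forall>\<sigma>\<in>pcols_off U. 0 \<le> a \<sigma> \<and> a \<sigma> \<le> h / q ^ (m - card U)"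
    define e where "e = (LEAST i. i \<ge> m \<or> i \<in> U)"
    have e: "e \<ge> m \<or> e \<in> U" unfolding e_def by (rule LeastI[of _ m]) simp
    show "(\<Sum>\<sigma>\<in>pcols_off U. a \<sigma> * fail (Suc N) \<sigma>) \<le> h * (5/2) ^ card U * \<rho> ^ Suc N"
    proof (cases "e < m")
      case True
      then show ?thesis using step_part[OF Suc U h, of a e] a e first_pcols_off by (auto simp: e_def)
    next
      case False
      then have "a \<sigma> * fail (Suc N) \<sigma> = 0" if "\<sigma> \<in> pcols_off U" for \<sigma> using first_pcols_off[OF that] by (simp add: e_def)
      then have "(\<Sum>\<sigma>\<in>pcols_off U. a \<sigma> * fail (Suc N) \<sigma>) = 0" by (intro sum.neutral) auto
      then show ?thesis using h by simp
    qed
  qed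
qed

text \<open>At the start the whole weight \<open>1\<close> sits on the empty coloring, and
  \<open>(5/2) ^ m\<close> is the weight of its uncolored edges.\<close>

theorem fail_empty_le: "fail N Map.empty \<le> (5/2) ^ m * \<rho> ^ N"
proof -
  have V: "Map.empty \<in> pcols_off {..<m}" by (simp add: pcols_off_def pcolorings_def proper_def)
  have "\<sigma> = Map.empty" if "\<sigma> \<in> pcols_off {..<m}" for \<sigma> using that by (simp add: pcols_off_def)
  with V have V: "pcols_off {..<m} = {Map.empty}" by blast
  have "(\<Sum>\<sigma>\<in>pcols_off {..<m}. 1 * fail N \<sigma>) \<le> 1 * (5/2) ^ card {..<m} * \<rho> ^ N"
    using decay[of N, unfolded decay_def, rule_format, of "{..<m}" 1 "\<lambda>_. 1"] by simp
  then show ?thesis unfolding V by simp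
qed

section \<open>The invariant of the process and the existence of complete colorings\<close>

definition good :: "(nat \<Rightarrow> nat option) \<Rightarrow> bool" where
  "good \<sigma> \<longleftrightarrow> \<sigma> \<in> pcolorings \<and> acyclic_coloring \<sigma>"

lemma good_empty: "good Map.empty"
proof -
  have "acyclic_coloring Map.empty"
    unfolding acyclic_coloring_def
  proof (intro allI impI notI)
    fix vs :: "'v list" and a b
    assume vs: "3 \<le> length vs"
      and all: "\<forall>h\<in>cycle_edges vs. \<exists>i<m. ends i = h \<and> (None :: nat option) \<in> {Some a, Some b}"
    have "{vs ! 0, vs ! (Suc 0 mod length vs)} \<in> cycle_edges vs"
      unfolding cycle_edges_def using vs by (intro image_eqI[of _ _ 0]) auto
    then show False using all by auto
  qed
  then show ?thesis by (simp add: good_def pcolorings_def proper_def)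
qed

lemma good_insert:
  assumes "good \<sigma>" "e < m" "\<sigma> e = None" "free \<sigma> e c" "closing \<sigma> c e = None" "c < q"
  shows "good (\<sigma>(e \<mapsto> c))"
  using assms proper_insert[of \<sigma> e c] acyclic_coloring_insert[of \<sigma> e c] by (auto simp: good_def pcolorings_def ran_def)

lemma good_uncolor: "good \<sigma> \<Longrightarrow> good (uncolor \<sigma> fs j)"
proof -
  assume g: "good \<sigma>"
  have le: "uncolor \<sigma> fs j \<subseteq>\<^sub>m \<sigma>" by (auto simp: uncolor_gone map_le_def)
  have "dom (uncolor \<sigma> fs j) \<subseteq> dom \<sigma>" "ran (uncolor \<sigma> fs j) \<subseteq> ran \<sigma>"
    by (auto simp: uncolor_gone ran_def restrict_map_def split: if_splits)
  then show ?thesis using g proper_mono[OF _ le] acyclic_coloring_mono[OF _ le] by (auto simp: good_def pcolorings_def)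
qed

lemma cycle_avg_ge:
  assumes "0 < q" "\<And>j. x \<le> F (uncolor \<sigma> fs j)"
  shows "x \<le> cycle_avg F \<sigma> e fs"
proof -
  have "5 * x = (\<Sum>j<(5::nat). x)" by simp
  also have "\<dots> \<le> (\<Sum>j<5. F (uncolor \<sigma> fs j))" by (intro sum_mono assms)
  finally have 1: "x \<le> (\<Sum>j<5. F (uncolor \<sigma> fs j)) / 5" by simp
  have "x \<le> (\<Sum>\<kappa><q. if \<kappa> \<in> priv \<sigma> (vtx (p e) fs) j then (\<Sum>j'<5. F (uncolor \<sigma> fs j')) / 5 else F (uncolor \<sigma> fs j)) / real q"
    for j
  proof -
    have "q * x = (\<Sum>\<kappa><q. x)" by simp
    also have "\<dots> \<le> (\<Sum>\<kappa><q. if \<kappa> \<in> priv \<sigma> (vtx (p e) fs) j then (\<Sum>j'<5. F (uncolor \<sigma> fs j')) / 5 else F (uncolor \<sigma> fs j))"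
      using 1 assms(2) by (intro sum_mono) auto
    finally show ?thesis using assms(1) by (simp add: field_simps)
  qed
  then have "(\<Sum>j<(5::nat). x) \<le> (\<Sum>j<5. (\<Sum>\<kappa><q. if \<kappa> \<in> priv \<sigma> (vtx (p e) fs) j
     then (\<Sum>j'<5. F (uncolor \<sigma> fs j')) / 5 else F (uncolor \<sigma> fs j)) / real q)"
    by (intro sum_mono)
  then show ?thesis unfolding cycle_avg_def by simp
qed

text \<open>Good colorings lead only to good colorings, so without a complete one the process never
  ends.\<close>

lemma fail_ge_1:
  assumes "0 < q" "\<nexists>\<tau>. good \<tau> \<and> {..<m} \<subseteq> dom \<tau>" "good \<sigma>"
  shows "1 \<le> fail N \<sigma>"
  using assms(3)
proof (induction N arbitrary: \<sigma>)
  case 0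
  then show ?case using assms(2) first_props(4) by auto
next
  case (Suc N)
  let ?e = "first \<sigma>"
  have e: "?e < m" "\<sigma> ?e = None" using assms(2) Suc.prems first_props(3,4) by auto
  have "1 \<le> color_avg (fail N) \<sigma> ?e c" if "c < q" for c
    using Suc.IH Suc.prems good_insert[OF Suc.prems e _ _ that] cycle_avg_ge[OF assms(1), of 1 "fail N" \<sigma>] good_uncolor[OF Suc.prems]
    by (auto simp: color_avg_def split: option.split)
  then have "(\<Sum>c<q. (1::real)) \<le> (\<Sum>c<q. color_avg (fail N) \<sigma> ?e c)" by (intro sum_mono) auto
  then show ?case using e assms(1) by (simp add: field_simps)
qed

text \<open>Otherwise any number of rounds would fail with certainty, against the geometric decay in
  \<open>fail_empty_le\<close>.\<close>

lemma ex_complete: "\<exists>\<tau>. good \<tau> \<and> {..<m} \<subseteq> dom \<tau>"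
proof (cases "m = 0")
  case True
  have "{..<m} \<subseteq> dom (Map.empty :: nat \<Rightarrow> nat option)" unfolding True by simp
  then show ?thesis using good_empty by blast
next
  case False
  then have q: "0 < q" using colors by fastforce
  show ?thesis
  proof (rule ccontr)
    assume none: "\<not> ?thesis"
    have *: "1 \<le> (5/2) ^ m * \<rho> ^ N" for N
      by (rule order_trans[OF fail_ge_1[OF q none good_empty] fail_empty_le])
    obtain N where "\<rho> ^ N < 1 / (5/2) ^ m"
      using real_arch_pow_inv[of "1 / (5/2) ^ m" \<rho>] by auto
    then show False using *[of N] by (simp add: field_simps)
  qed
qed

lemma complete_acyclic_edge_coloring:
  assumes "good \<tau>" "{..<m} \<subseteq> dom \<tau>" and \<phi>: "\<And>i. i < m \<Longrightarrow> \<tau> i = Some (\<phi> (ends i))"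
  shows "acyclic_edge_coloring V (ends ` {..<m}) q \<phi>"
  unfolding acyclic_edge_coloring_def proper_edge_coloring_def
proof (intro conjI ballI notI)
  show "\<phi> ` ends ` {..<m} \<subseteq> {..<q}"
    using assms(1) \<phi> by (auto simp: good_def pcolorings_def ran_def)
next
  fix v
  show "inj_on \<phi> {h \<in> ends ` {..<m}. v \<in> h}"
  proof (rule inj_onI)
    fix h h' assume h: "h \<in> {h \<in> ends ` {..<m}. v \<in> h}" "h' \<in> {h \<in> ends ` {..<m}. v \<in> h}" "\<phi> h = \<phi> h'"
    then obtain i j where ij: "i < m" "j < m" "h = ends i" "h' = ends j" "v \<in> ends i" "v \<in> ends j" by auto
    then have "i = j" using properD[of \<tau> i j "\<phi> h" v] assms(1) \<phi> h(3) by (auto simp: good_def pcolorings_def)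
    then show "h = h'" using ij by simp
  qed
next
  assume "\<exists>vs. is_cycle (ends ` {..<m}) vs \<and> bichromatic \<phi> vs"
  then obtain vs where vs: "3 \<le> length vs" "distinct vs" "cycle_edges vs \<subseteq> ends ` {..<m}"
    "card (\<phi> ` cycle_edges vs) = 2"
    by (auto simp: is_cycle_def bichromatic_def)
  then obtain a b where ab: "\<phi> ` cycle_edges vs = {a, b}" by (auto simp: card_2_iff)
  have "\<exists>i<m. ends i = h \<and> \<tau> i \<in> {Some a, Some b}" if h: "h \<in> cycle_edges vs" for h
  proof -
    obtain i where i: "i < m" "h = ends i" using vs(3) h by auto
    moreover have "\<phi> h \<in> {a, b}" using ab h by blast
    ultimately show ?thesis using \<phi>[OF i(1)] by (intro exI[of _ i]) auto
  qed
  then show False using assms(1) vs(1,2) unfolding good_def acyclic_coloring_def by blast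
qed

lemma complete_ex_coloring:
  assumes "good \<tau>" "{..<m} \<subseteq> dom \<tau>"
  shows "\<exists>\<phi>. acyclic_edge_coloring V (ends ` {..<m}) q \<phi> \<and> (\<forall>i<m. \<tau> i = Some (\<phi> (ends i)))"
proof -
  define \<phi> where "\<phi> h = the (\<tau> (THE i. i < m \<and> ends i = h))" for h
  have "\<tau> i = Some (\<phi> (ends i))" if "i < m" for i
  proof -
    have "(THE j. j < m \<and> ends j = ends i) = i" using that ends_eqD by (intro the_equality) auto
    then show ?thesis using assms(2) that by (auto simp: \<phi>_def)
  qed
  then show ?thesis using complete_acyclic_edge_coloring[OF assms] by blast
qed

lemma ex_acyclic_edge_coloring: "\<exists>\<phi>. acyclic_edge_coloring V (ends ` {..<m}) q \<phi>"
  using ex_complete complete_ex_coloring by blast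

end

section \<open>Existence\<close>

lemma max_degree_ge:
  assumes "sgraph V E"
  shows "card {e \<in> E. v \<in> e} \<le> max_degree V E"
proof (cases "v \<in> V")
  case True
  then show ?thesis using assms unfolding max_degree_def sgraph_def by (intro Max_ge) auto
next
  case False
  then have "{e \<in> E. v \<in> e} = {}" using assms by (auto simp: sgraph_def)
  then show ?thesis by (simp only: card.empty)
qed

lemma sgraph_finite: "sgraph V E \<Longrightarrow> finite E"
  by (rule finite_subset[of _ "Pow V"]) (auto simp: sgraph_def)

lemma coloring_instance_of_sgraph:
  fixes V :: "'v set"
  assumes G: "sgraph V E" and q: "int q > 4 * (int (max_degree V E) - 1)"
    and bij: "bij_betw (\<lambda>i. {p i, r i}) {..<m} E"
  shows "coloring_instance m p r q (max_degree V E - 1)"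
proof
  have E: "{p i, r i} \<in> E" if "i < m" for i using bij that by (auto simp: bij_betw_def)
  show "p i \<noteq> r i" if "i < m" for i
  proof
    assume "p i = r i"
    then have "card {p i, r i} = 1" by simp
    then show False using E[OF that] G by (auto simp: sgraph_def)
  qed
  show "i = j" if "i < m" "j < m" "{p i, r i} = {p j, r j}" for i j
    using bij that by (auto simp: bij_betw_def inj_on_def)
  have c: "card {i. i < m \<and> w \<in> {p i, r i}} \<le> max_degree V E" for w
  proof -
    have "card {i. i < m \<and> w \<in> {p i, r i}} \<le> card {e \<in> E. w \<in> e}"
    proof (rule card_inj_on_le)
      show "inj_on (\<lambda>i. {p i, r i}) {i. i < m \<and> w \<in> {p i, r i}}"
        using bij unfolding bij_betw_def by (auto elim: inj_on_subset)
    qed (use E sgraph_finite[OF G] in auto)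
    then show ?thesis using max_degree_ge[OF G, of w] by simp
  qed
  then show "card {i. i < m \<and> w \<in> {p i, r i}} \<le> Suc (max_degree V E - 1)" for w
    using le_trans[OF c[of w]] by simp
  \<comment> \<open>An edge forces \<Delta> to be positive, so the truncated difference agrees with
    the integer one in the hypothesis on \<open>q\<close>.\<close>
  show "4 * (max_degree V E - 1) < q" if "0 < m"
  proof -
    have "0 \<in> {i. i < m \<and> p 0 \<in> {p i, r i}}" using that by simp
    then have "0 < card {i. i < m \<and> p 0 \<in> {p i, r i}}" by (subst card_gt_0_iff) auto
    then have "0 < max_degree V E" using c[of "p 0"] by linarith
    then show ?thesis using q by (simp add: nat_diff_split_asm of_nat_diff)
  qed
qed

lemma acyclic_edge_coloring_exists:
  fixes V :: "'v set"
  assumes G: "sgraph V E" and q: "int q > 4 * (int (max_degree V E) - 1)"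
  shows "\<exists>\<phi>. acyclic_edge_coloring V E q \<phi>"
proof -
  obtain f where f: "bij_betw f {0..<card E} E" using ex_bij_betw_nat_finite[OF sgraph_finite[OF G]] by blast
  have "\<exists>x y. f i = {x, y}" if "i < card E" for i
  proof -
    have "card (f i) = 2" using f that G by (auto simp: bij_betw_def sgraph_def)
    then show ?thesis by (auto simp: card_2_iff)
  qed
  then obtain p r where pr: "\<And>i. i < card E \<Longrightarrow> f i = {p i, r i}" by metis
  have "bij_betw (\<lambda>i. {p i, r i}) {..<card E} E"
    using f pr by (subst bij_betw_cong[of _ _ f]) (auto simp: lessThan_atLeast0)
  then interpret coloring_instance "card E" p r q "max_degree V E - 1" using coloring_instance_of_sgraph[OF G q] by blast
  have "ends ` {..<card E} = E"
    using \<open>bij_betw (\<lambda>i. {p i, r i}) {..<card E} E\<close> by (auto simp: bij_betw_def ends_def)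
  then show ?thesis using ex_acyclic_edge_coloring[of V] by simp
qed

section \<open>Reasoning about programs\<close>

type_synonym state = "(nat \<Rightarrow> nat) \<times> (nat \<Rightarrow> nat)"

lemma run_add: "run B (s + t) cfg = bind_pmf (run B s cfg) (run B t)"
proof (induction s arbitrary: cfg)
  case (Suc s)
  have "run B (s + t) = (\<lambda>cfg. bind_pmf (run B s cfg) (run B t))" using Suc by blast
  then show ?case by (simp add: bind_assoc_pmf)
qed (simp add: bind_return_pmf)

text \<open>Here \<open>priv\<close> is a postcondition, not a set of private colors. The quantified
  continuation \<open>rest\<close> makes pieces of code composable, and \<open>s\<close> is only an
  upper bound, so that branches of different duration fit one statement.\<close>

definition wp :: "nat \<Rightarrow> instr list \<Rightarrow> nat \<Rightarrow> (state \<Rightarrow> bool) \<Rightarrow> state \<Rightarrow> bool" where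
  "wp B p s priv st \<longleftrightarrow>
     (\<exists>s'\<le>s. \<exists>st'. priv st' \<and> (\<forall>rest. run B s' (p @ rest, st) = return_pmf (rest, st')))"

lemma wp_mono: "wp B p s priv st \<Longrightarrow> s \<le> s' \<Longrightarrow> (\<And>st. priv st \<Longrightarrow> priv' st) \<Longrightarrow> wp B p s' priv' st"
  unfolding wp_def by (meson le_trans)

lemma wp_Nil: "priv st \<Longrightarrow> wp B [] s priv st"
  unfolding wp_def by (intro exI[of _ 0] conjI exI[of _ st]) auto

lemma wp_append:
  assumes "wp B p s (wp B p' s' priv) st"
  shows "wp B (p @ p') (s + s') priv st"
proof -
  obtain t st1 where t: "t \<le> s" "wp B p' s' priv st1" "\<And>rest. run B t (p @ rest, st) = return_pmf (rest, st1)"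
    using assms unfolding wp_def by blast
  then obtain t' st2 where t': "t' \<le> s'" "priv st2" "\<And>rest. run B t' (p' @ rest, st1) = return_pmf (rest, st2)"
    unfolding wp_def by blast
  have "run B (t + t') ((p @ p') @ rest, st) = return_pmf (rest, st2)" for rest
    using t(3) t'(3) by (simp add: run_add bind_return_pmf)
  then show ?thesis unfolding wp_def using t(1) t'(1,2) by (intro exI[of _ "t + t'"] conjI exI[of _ st2]) auto
qed

lemma wp_seq:
  assumes "wp B p s P st" "\<And>st'. P st' \<Longrightarrow> wp B p' s' priv st'"
  shows "wp B (p @ p') (s + s') priv st"
  by (rule wp_append, rule wp_mono[OF assms(1) order_refl assms(2)])

lemma wp_step:
  assumes "\<And>rest. step B (i # p @ rest, st) = return_pmf (p' @ rest, st')" "wp B p' (s - 1) priv st'" "0 < s"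
  shows "wp B (i # p) s priv st"
proof -
  obtain t st2 where t: "t \<le> s - 1" "priv st2" "\<And>rest. run B t (p' @ rest, st') = return_pmf (rest, st2)"
    using assms(2) unfolding wp_def by blast
  then have "run B (Suc t) ((i # p) @ rest, st) = return_pmf (rest, st2)" for rest
    using assms(1) by (simp add: bind_return_pmf)
  then show ?thesis unfolding wp_def using t assms(3) by (intro exI[of _ "Suc t"] conjI exI[of _ st2]) auto
qed

lemma run_halted: "run B t ([], st) = return_pmf ([], st)"
  by (induction t) (cases st, simp add: bind_return_pmf)+

lemma wp_Nil_eq: "wp B [] s priv st \<longleftrightarrow> priv st"
proof
  assume "wp B [] s priv st"
  then obtain s' st' where "priv st'" "run B s' ([] @ [], st) = return_pmf ([], st')" unfolding wp_def by blast
  then show "priv st" by (simp add: run_halted)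
qed (rule wp_Nil)

text \<open>As an equivalence, which holds because the step is deterministic, the rule can be used
  for rewriting: with \<open>wp_simps\<close> the simplifier executes loop-free code
  symbolically.\<close>

lemma wp_step_eq:
  assumes "\<And>rest. step B (i # p @ rest, st) = return_pmf (p' @ rest, st')" "0 < s"
  shows "wp B (i # p) s priv st \<longleftrightarrow> wp B p' (s - 1) priv st'"
proof
  assume "wp B (i # p) s priv st"
  then obtain t st2 where t: "t \<le> s" "priv st2" "\<And>rest. run B t ((i # p) @ rest, st) = return_pmf (rest, st2)"
    unfolding wp_def by blast
  have "t \<noteq> 0" using t(3)[of "[]"] by (intro notI) simp
  then obtain t' where t': "t = Suc t'" by (cases t) auto
  have "run B t' (p' @ rest, st') = return_pmf (rest, st2)" for rest
    using t(3)[of rest] assms(1) by (simp add: t' bind_return_pmf)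
  then show "wp B p' (s - 1) priv st'" unfolding wp_def using t t' by (intro exI[of _ t'] conjI exI[of _ st2]) auto
qed (rule wp_step[OF assms(1) _ assms(2)])

lemma wp_eqs:
  "0 < s \<Longrightarrow> c < B \<Longrightarrow> wp B (Const i c # p) s priv (v, M) \<longleftrightarrow> wp B p (s - 1) priv (v(i := c), M)"
  "0 < s \<Longrightarrow> v j + v l < B \<Longrightarrow> wp B (Add i j l # p) s priv (v, M) \<longleftrightarrow> wp B p (s - 1) priv (v(i := v j + v l), M)"
  "0 < s \<Longrightarrow> v j - v l < B \<Longrightarrow> wp B (Sub i j l # p) s priv (v, M) \<longleftrightarrow> wp B p (s - 1) priv (v(i := v j - v l), M)"
  "0 < s \<Longrightarrow> M (v j) < B \<Longrightarrow> wp B (Load i j # p) s priv (v, M) \<longleftrightarrow> wp B p (s - 1) priv (v(i := M (v j)), M)"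
  "0 < s \<Longrightarrow> wp B (Store i j # p) s priv (v, M) \<longleftrightarrow> wp B p (s - 1) priv (v, M(v i := v j))"
  "0 < s \<Longrightarrow> wp B (If i p1 p2 # p) s priv (v, M) \<longleftrightarrow> wp B ((if v i \<noteq> 0 then p1 else p2) @ p) (s - 1) priv (v, M)"
  by (rule wp_step_eq; simp add: assign_def)+

lemmas wp_simps = wp_Nil_eq wp_eqs

lemma wp_While_False: "v i = 0 \<Longrightarrow> 0 < s \<Longrightarrow> priv (v, M) \<Longrightarrow> wp B [While i p1] s priv (v, M)"
  by (rule wp_step[of _ _ _ _ "[]"]) (auto simp: wp_Nil_eq)

text \<open>The induction is on the number \<open>d\<close> of remaining iterations. The cost
  \<open>c k\<close> may depend on the iteration, as it must in \<open>wp_detect\<close>, where only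
  the edges at \<open>p e\<close> start a walk.\<close>

lemma wp_While_from:
  assumes "\<And>k st. k < N \<Longrightarrow> I k st \<Longrightarrow> fst st g \<noteq> 0 \<and> wp B body (c k) (I (Suc k)) st"
    "\<And>st. I N st \<Longrightarrow> fst st g = 0"
  shows "d \<le> N \<Longrightarrow> I (N - d) st \<Longrightarrow> wp B [While g body] ((\<Sum>k=N-d..<N. c k + 1) + 1) (I N) st"
proof (induction d arbitrary: st)
  case 0
  then show ?case using assms(2)[of st] by (cases st) (auto intro!: wp_While_False)
next
  case (Suc d)
  let ?k = "N - Suc d"
  have k: "?k < N" "Suc ?k = N - d" using Suc.prems by auto
  obtain v M where st: "st = (v, M)" by fastforce
  have body: "v g \<noteq> 0" "wp B body (c ?k) (I (N - d)) st" using assms(1)[OF k(1) Suc.prems(2)] k st by auto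
  have "wp B (body @ [While g body]) (c ?k + ((\<Sum>k=N-d..<N. c k + 1) + 1)) (I N) st"
    by (rule wp_seq[OF body(2)]) (use Suc in auto)
  then have "wp B [While g body] (Suc (c ?k + ((\<Sum>k=N-d..<N. c k + 1) + 1))) (I N) (v, M)"
    unfolding st by (intro wp_step[of _ _ _ _ "body @ [While g body]"]) (use body in auto)
  moreover have "(\<Sum>k=?k..<N. c k + 1) = c ?k + 1 + (\<Sum>k=N-d..<N. c k + 1)"
    using k by (simp add: sum.atLeast_Suc_lessThan)
  ultimately show ?case unfolding st by simp
qed

lemma wp_While:
  assumes "I 0 st" "\<And>k st. k < N \<Longrightarrow> I k st \<Longrightarrow> fst st g \<noteq> 0 \<and> wp B body (c k) (I (Suc k)) st"
    "\<And>st. I N st \<Longrightarrow> fst st g = 0"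
  shows "wp B [While g body] ((\<Sum>k<N. c k + 1) + 1) (I N) st"
  using wp_While_from[of N I g B body c N st] assms by (simp add: lessThan_atLeast0)

lemma wp_While_const:
  assumes "I 0 st" "\<And>k v M. k < N \<Longrightarrow> I k (v, M) \<Longrightarrow> v g \<noteq> 0 \<and> wp B body c (I (Suc k)) (v, M)"
    "\<And>v M. I N (v, M) \<Longrightarrow> v g = 0"
  shows "wp B [While g body] (N * (c + 1) + 1) (I N) st"
  using wp_While[of I st N g B body "\<lambda>_. c"] assms by fastforce

text \<open>Unlike \<open>wp\<close>, which is restricted to deterministic code, \<open>val\<close> also copes with \<open>Rand\<close>.\<close>

definition val :: "nat \<Rightarrow> config set \<Rightarrow> nat \<Rightarrow> config \<Rightarrow> real" where
  "val B G t cfg = measure_pmf.prob (run B t cfg) G"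

lemma measure_bind_pmf:
  "measure_pmf.prob (bind_pmf p f) G = measure_pmf.expectation p (\<lambda>x. measure_pmf.prob (f x) G)"
proof -
  have i: "integrable (measure_pmf p) (\<lambda>x. measure_pmf.prob (f x) G)"
    by (rule measure_pmf.integrable_const_bound[of _ 1]) auto
  have "ennreal (measure_pmf.prob (bind_pmf p f) G) = (\<integral>\<^sup>+x. ennreal (measure_pmf.prob (f x) G) \<partial>measure_pmf p)"
    by (simp flip: measure_pmf.emeasure_eq_measure)
  also have "\<dots> = ennreal (measure_pmf.expectation p (\<lambda>x. measure_pmf.prob (f x) G))"
    by (rule nn_integral_eq_integral[OF i]) simp
  finally show ?thesis by (subst (asm) ennreal_inj) (auto intro!: integral_nonneg_AE)
qed

lemma measure_bind_pmf_ge: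
  assumes "\<And>x. x \<in> G \<Longrightarrow> f x = return_pmf x"
  shows "measure_pmf.prob p G \<le> measure_pmf.prob (bind_pmf p f) G"
proof -
  have "measure_pmf.prob p G = measure_pmf.expectation p (indicator G)" by simp
  also have "\<dots> \<le> measure_pmf.expectation p (\<lambda>x. measure_pmf.prob (f x) G)"
  proof (rule integral_mono)
    show "integrable (measure_pmf p) (\<lambda>x. measure_pmf.prob (f x) G)"
      by (rule measure_pmf.integrable_const_bound[of _ 1]) auto
    show "indicat_real G x \<le> measure_pmf.prob (f x) G" for x
      using assms[of x] by (cases "x \<in> G") (auto simp: measure_return_pmf indicator_def)
    show "integrable (measure_pmf p) (indicat_real G)"
      by (rule measure_pmf.integrable_const_bound[of _ 1]) auto
  qed
  also have "\<dots> = measure_pmf.prob (bind_pmf p f) G"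
    by (simp add: measure_bind_pmf)
  finally show ?thesis .
qed

text \<open>Halted configurations persist, so additional time never hurts and time bounds may be
  rounded up freely.\<close>

lemma val_mono:
  assumes "\<And>cfg. cfg \<in> G \<Longrightarrow> fst cfg = []" "t \<le> t'"
  shows "val B G t cfg \<le> val B G t' cfg"
proof -
  have "run B t' cfg = bind_pmf (run B t cfg) (run B (t' - t))" using run_add[of B t "t' - t" cfg] assms(2) by simp
  then show ?thesis unfolding val_def
    using measure_bind_pmf_ge[of G "run B (t' - t)"] assms(1) run_halted by (metis prod.collapse)
qed

lemma val_wp:
  assumes "\<And>cfg. cfg \<in> G \<Longrightarrow> fst cfg = []" "wp B p s priv st" "\<And>st'. priv st' \<Longrightarrow> x \<le> val B G t (rest, st')"
  shows "x \<le> val B G (s + t) (p @ rest, st)"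
proof -
  obtain s' st' where s: "s' \<le> s" "priv st'" "\<And>rest. run B s' (p @ rest, st) = return_pmf (rest, st')"
    using assms(2) unfolding wp_def by blast
  have "x \<le> val B G (s' + t) (p @ rest, st)"
    using assms(3)[OF s(2)] s(3) by (simp add: val_def run_add bind_return_pmf)
  also have "\<dots> \<le> val B G (s + t) (p @ rest, st)" by (rule val_mono) (use assms s in auto)
  finally show ?thesis .
qed

lemma val_If:
  assumes "v i \<noteq> 0 \<Longrightarrow> x \<le> val B G t (p1 @ p, v, M)" "v i = 0 \<Longrightarrow> x \<le> val B G t (p2 @ p, v, M)"
  shows "x \<le> val B G (Suc t) (If i p1 p2 # p, v, M)"
  using assms by (auto simp: val_def bind_return_pmf)

lemma val_While:
  assumes "v i \<noteq> 0" "x \<le> val B G t (p1 @ While i p1 # p, v, M)"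
  shows "x \<le> val B G (Suc t) (While i p1 # p, v, M)"
  using assms by (auto simp: val_def bind_return_pmf)

lemma val_Rand:
  assumes "v j = k" "0 < k" "k \<le> B" "\<And>a. a < k \<Longrightarrow> x a \<le> val B G t (p, v(i := a), M)"
  shows "(\<Sum>a<k. x a) / k \<le> val B G (Suc t) (Rand i j # p, v, M)"
proof -
  have eq: "run B (Suc t) (Rand i j # p, v, M)
      = bind_pmf (pmf_of_set {..<k}) (\<lambda>a. run B t (assign B i a (Rand i j # p, v, M)))"
    using assms(1,2) by (simp add: bind_map_pmf)
  have ne: "{..<k} \<noteq> {}" using assms(2) by auto
  have "val B G (Suc t) (Rand i j # p, v, M)
      = measure_pmf.expectation (pmf_of_set {..<k}) (\<lambda>a. measure_pmf.prob (run B t (assign B i a (Rand i j # p, v, M))) G)"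
    unfolding val_def eq by (simp add: measure_bind_pmf)
  also have "\<dots> = (\<Sum>a<k. measure_pmf.prob (run B t (assign B i a (Rand i j # p, v, M))) G) / k"
    using ne by (simp add: integral_pmf_of_set)
  also have "(\<Sum>a<k. x a) / k \<le> \<dots>"
  proof (intro divide_right_mono sum_mono)
    fix a assume "a \<in> {..<k}"
    then have "assign B i a (Rand i j # p, v, M) = (p, v(i := a), M)" "x a \<le> val B G t (p, v(i := a), M)"
      using assms(3,4) by (auto simp: assign_def)
    then show "x a \<le> measure_pmf.prob (run B t (assign B i a (Rand i j # p, v, M))) G" by (simp add: val_def)
  qed simp
  finally show ?thesis .
qed

section \<open>The program\<close>

text \<open>
  Registers \<open>0\<close> to \<open>8\<close> hold the constants listed in \<open>regs\<close> below. While edge \<open>e\<close> is processed, register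
  \<open>9\<close> is \<open>2 e + 1\<close>, register \<open>10\<close> is nonzero, and registers \<open>11\<close>, \<open>12\<close>, \<open>13\<close>, \<open>27\<close> hold the drawn color, the ends of \<open>e\<close>
  and the address for the output color of \<open>e\<close>. The length of a detected path and its first color are
  kept in registers \<open>14\<close> and \<open>26\<close>, the pattern and the test color in registers \<open>24\<close> and \<open>25\<close>.
\<close>

definition scan_code :: "instr list" where
  "scan_code = [Const 9 1, Add 17 5 9, Load 18 17, Add 27 1 1] @
     ([While 18 [Add 9 9 4, Add 17 5 9, Load 18 17, Add 27 27 3]] @ [Sub 10 8 9])"

definition color_code :: "instr list" where
  "color_code = [Add 17 12 11, Store 17 9, Add 17 13 11, Store 17 9, Add 17 5 9, Add 18 11 3, Store 17 18,
     Store 27 11]"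

text \<open>The next vertex is the sum of both ends of the edge minus the current vertex, so no
  comparison is made. Register \<open>0\<close> is zero, so \<open>Add i j 0\<close> copies;
  registers \<open>20\<close> and \<open>21\<close> hold the two colors and are swapped in each
  step.\<close>

definition walk_body :: "instr list" where
  "walk_body = [Add 17 6 23, Store 17 22, Sub 17 22 3, Load 17 17, Load 18 22, Add 17 17 18, Sub 19 17 19,
     Add 23 23 3, Add 17 7 23, Store 17 19, Add 17 20 0, Add 20 21 0, Add 21 17 0, Add 17 19 20, Load 22 17]"

text \<open>The two truncated differences add up to \<open>0\<close> exactly if the path ends at the
  other end of \<open>e\<close>; only then is its length recorded in register
  \<open>14\<close>.\<close>

definition walk_code :: "instr list" where
  "walk_code = [Add 19 12 0, Add 20 26 0, Add 21 11 0, Const 23 0, Store 7 19, Add 17 19 20, Load 22 17] @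
     ([While 22 walk_body] @ [Sub 17 19 13, Sub 18 13 19, Add 17 17 18, If 17 [] [Add 14 23 0]])"

section \<open>The memory layout and its invariant\<close>

locale coloring_machine = coloring_instance m p r q D for m and p r :: "nat \<Rightarrow> nat" and q D +
  fixes n B :: nat
  assumes vert: "j < m \<Longrightarrow> p j < n \<and> r j < n"
    and B: "2 * ((n + 1) * q) + 20 * m + 40 \<le> B"
begin

text \<open>
  A vertex \<open>x\<close> is represented by the address \<open>row x\<close> of its row in a table which contains, for each
  color \<open>\<kappa>\<close>, the number \<open>2 j + 1\<close> if \<open>j\<close> is the edge of color \<open>\<kappa>\<close> at \<open>x\<close>, and \<open>0\<close> if there is none. Since \<open>2 j\<close>
  and \<open>2 j + 1\<close> are the addresses of the ends of \<open>j\<close>, no multiplication is needed to follow a path.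
  Cell \<open>3 m + (2 j + 1)\<close> contains the successor of the color of \<open>j\<close>, or \<open>0\<close> if \<open>j\<close> is uncolored, and
  cell \<open>5 m + 1\<close> is a sentinel. The path followed last is stored from \<open>5 m + 2\<close> (edges) and from
  \<open>6 m + 2\<close> (vertices) on.
\<close>

definition row :: "nat \<Rightarrow> nat" where
  "row x = 7 * m + 3 + x * q"

lemma row_bound: "x < n \<Longrightarrow> \<kappa> \<le> q \<Longrightarrow> 2 * (row x + \<kappa>) + 6 * m + 30 \<le> B"
proof -
  assume "x < n" "\<kappa> \<le> q"
  then have "x * q + \<kappa> \<le> n * q + q" by (intro add_mono mult_right_mono) auto
  then show ?thesis using B by (simp add: row_def)
qed

lemma B_bound: "20 * m + 2 * q + 40 \<le> B"
  using B by simp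

lemma row_inj: "\<kappa> < q \<Longrightarrow> \<mu> < q \<Longrightarrow> row x + \<kappa> = row z + \<mu> \<longleftrightarrow> x = z \<and> \<kappa> = \<mu>"
proof -
  assume k: "\<kappa> < q" "\<mu> < q"
  have "x = z \<and> \<kappa> = \<mu>" if "row x + \<kappa> = row z + \<mu>"
  proof -
    have eq: "x * q + \<kappa> = z * q + \<mu>" using that by (simp add: row_def)
    have "(x * q + \<kappa>) div q = x" "(z * q + \<mu>) div q = z" using k by auto
    then have "x = z" using eq by simp
    then show ?thesis using eq by simp
  qed
  then show ?thesis by auto
qed

lemma row_inj0: "0 < q \<Longrightarrow> row x = row z \<longleftrightarrow> x = z"
  using row_inj[of 0 0 x z] by simp

definition regs :: "(nat \<Rightarrow> nat) \<Rightarrow> bool" where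
  "regs v \<longleftrightarrow> v 0 = 0 \<and> v 1 = m \<and> v 2 = q \<and> v 3 = 1 \<and> v 4 = 2 \<and> v 5 = 3 * m \<and> v 6 = 5 * m + 2 \<and>
     v 7 = 6 * m + 2 \<and> v 8 = 2 * m + 1"

definition flag :: "(nat \<Rightarrow> nat option) \<Rightarrow> nat \<Rightarrow> nat" where
  "flag \<sigma> j = (case \<sigma> j of None \<Rightarrow> 0 | Some \<kappa> \<Rightarrow> Suc \<kappa>)"

text \<open>The output cell \<open>2 * m + j\<close> is prescribed only while \<open>j\<close> is
  colored, so that erasing a color may leave a stale value there. The cell \<open>5 * m + 1\<close>
  continues the flags as if there were an uncolored edge \<open>m\<close>.\<close>

definition rep :: "(nat \<Rightarrow> nat option) \<Rightarrow> (nat \<Rightarrow> nat) \<Rightarrow> bool" where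
  "rep \<sigma> M \<longleftrightarrow> (\<forall>j<m. M (2 * j) = row (p j) \<and> M (2 * j + 1) = row (r j)) \<and>
     (\<forall>j<m. M (3 * m + (2 * j + 1)) = flag \<sigma> j) \<and> M (5 * m + 1) = 0 \<and>
     (\<forall>j<m. \<forall>\<kappa>. \<sigma> j = Some \<kappa> \<longrightarrow> M (2 * m + j) = \<kappa>) \<and>
     (\<forall>x<n. \<forall>\<kappa><q. (\<kappa> \<notin> cols \<sigma> x \<longrightarrow> M (row x + \<kappa>) = 0) \<and>
        (\<forall>j<m. \<sigma> j = Some \<kappa> \<longrightarrow> x \<in> ends j \<longrightarrow> M (row x + \<kappa>) = 2 * j + 1))"

lemma repD:
  assumes "rep \<sigma> M"
  shows "j < m \<Longrightarrow> M (2 * j) = row (p j)" "j < m \<Longrightarrow> M (2 * j + 1) = row (r j)"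
    "j < m \<Longrightarrow> M (3 * m + (2 * j + 1)) = flag \<sigma> j" "M (5 * m + 1) = 0"
    "j < m \<Longrightarrow> \<sigma> j = Some \<kappa> \<Longrightarrow> M (2 * m + j) = \<kappa>"
    "x < n \<Longrightarrow> \<kappa> < q \<Longrightarrow> \<kappa> \<notin> cols \<sigma> x \<Longrightarrow> M (row x + \<kappa>) = 0"
    "x < n \<Longrightarrow> \<kappa> < q \<Longrightarrow> j < m \<Longrightarrow> \<sigma> j = Some \<kappa> \<Longrightarrow> x \<in> ends j \<Longrightarrow> M (row x + \<kappa>) = 2 * j + 1"
  using assms unfolding rep_def by auto

lemma tab_bound:
  assumes "rep \<sigma> M" "x < n" "\<kappa> < q"
  shows "M (row x + \<kappa>) \<le> 2 * m"
proof (cases "\<kappa> \<in> cols \<sigma> x")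
  case True
  then obtain j where "j < m" "\<sigma> j = Some \<kappa>" "x \<in> ends j" by (auto simp: cols_def)
  then show ?thesis using repD(7)[OF assms] by fastforce
qed (simp add: repD(6)[OF assms])

lemma tab_zero:
  assumes "rep \<sigma> M" "x < n" "\<kappa> < q"
  shows "M (row x + \<kappa>) = 0 \<longleftrightarrow> \<kappa> \<notin> cols \<sigma> x"
proof (cases "\<kappa> \<in> cols \<sigma> x")
  case True
  then obtain j where "j < m" "\<sigma> j = Some \<kappa>" "x \<in> ends j" by (auto simp: cols_def)
  then show ?thesis using repD(7)[OF assms] True by fastforce
qed (simp add: repD(6)[OF assms])

lemma rep_scratch:
  assumes "rep \<sigma> M" "5 * m + 2 \<le> a" "a < 7 * m + 3"
  shows "rep \<sigma> (M(a := x))"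
proof -
  have "row z + \<kappa> \<noteq> a" for z \<kappa> using assms(3) by (simp add: row_def)
  then show ?thesis using assms unfolding rep_def by auto
qed

lemma flag_le: "\<sigma> \<in> pcolorings \<Longrightarrow> flag \<sigma> j \<le> q"
  by (auto simp: flag_def pcolorings_def ran_def split: option.split intro!: Suc_leI)

definition scanned :: "(nat \<Rightarrow> nat option) \<Rightarrow> (nat \<Rightarrow> nat) \<Rightarrow> bool" where
  "scanned \<sigma> v \<longleftrightarrow> regs v \<and> v 9 = 2 * first \<sigma> + 1 \<and> v 10 = 2 * (m - first \<sigma>) \<and> v 27 = 2 * m + first \<sigma>"

lemma wp_scan:
  assumes rep: "rep \<sigma> M" and pc: "\<sigma> \<in> pcolorings" and v: "regs v"
  shows "wp B scan_code (5 * m + 10) (\<lambda>(v', M'). M' = M \<and> scanned \<sigma> v') (v, M)"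
proof -
  let ?I = "\<lambda>k (v', M'). M' = M \<and> regs v' \<and> v' 9 = 2 * k + 1 \<and> v' 18 = M (3 * m + (2 * k + 1)) \<and> v' 27 = 2 * m + k"
  let ?body = "[Add 9 9 4, Add 17 5 9, Load 18 17, Add 27 27 3]"
  \<comment> \<open>For \<open>k = m\<close> this is the sentinel cell, which stops the scan without
    a test of the range.\<close>
  have fl: "M (3 * m + (2 * k + 1)) \<le> q" if "k \<le> m" for k
  proof (cases "k = m")
    case False
    then show ?thesis using repD(3)[OF rep, of k] flag_le[OF pc, of k] that by simp
  qed (use repD(4)[OF rep] in simp)
  have f: "first \<sigma> \<le> m" by (rule first_props)
  have init: "wp B [Const 9 1, Add 17 5 9, Load 18 17, Add 27 1 1] 4 (?I 0) (v, M)"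
    using v fl[of 0] B_bound by (simp add: wp_simps regs_def)
  have loop: "wp B [While 18 ?body] (first \<sigma> * (4 + 1) + 1) (?I (first \<sigma>)) st'" if "?I 0 st'" for st'
  proof (rule wp_While_const[where I = ?I, OF that])
    fix k v' M' assume k: "k < first \<sigma>" and I: "?I k (v', M')"
    have "M (3 * m + (2 * k + 1)) \<noteq> 0"
      using repD(3)[OF rep, of k] first_props(2)[OF k] k f by (auto simp: flag_def)
    moreover have "wp B ?body 4 (?I (Suc k)) (v', M')"
      using I fl[of "Suc k"] k f B_bound by (simp add: wp_simps regs_def)
    ultimately show "v' 18 \<noteq> 0 \<and> wp B ?body 4 (?I (Suc k)) (v', M')" using I by simp
  next
    fix v' M' assume I: "?I (first \<sigma>) (v', M')"
    have "M (3 * m + (2 * first \<sigma> + 1)) = 0"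
    proof (cases "first \<sigma> < m")
      case True
      then show ?thesis using repD(3)[OF rep True] first_props(3)[OF True] by (simp add: flag_def)
    next
      case False
      then show ?thesis using f repD(4)[OF rep] by simp
    qed
    then show "v' 18 = 0" using I by simp
  qed
  have fin: "wp B [Sub 10 8 9] 1 (\<lambda>(v', M'). M' = M \<and> scanned \<sigma> v') st'" if "?I (first \<sigma>) st'" for st'
    using that f B_bound by (cases st') (simp add: wp_simps regs_def scanned_def)
  have "wp B scan_code (4 + ((first \<sigma> * (4 + 1) + 1) + 1)) (\<lambda>(v', M'). M' = M \<and> scanned \<sigma> v') (v, M)"
    unfolding scan_code_def by (rule wp_seq[OF init], rule wp_seq[OF loop], assumption, rule fin)
  then show ?thesis by (rule wp_mono) (use f in auto)
qed

lemma wp_color: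
  assumes rep: "rep \<sigma> M" and pc: "\<sigma> \<in> pcolorings" and v: "regs v" and e: "e < m" "\<sigma> e = None" and c: "c < q"
    and free: "free \<sigma> e c"
    and vv: "v 9 = 2 * e + 1" "v 27 = 2 * m + e" "v 11 = c" "v 12 = row (p e)" "v 13 = row (r e)"
  shows "wp B color_code 8 (\<lambda>(v', M'). regs v' \<and> rep (\<sigma>(e \<mapsto> c)) M') (v, M)"
proof -
  define M' where "M' = M(row (p e) + c := 2 * e + 1, row (r e) + c := 2 * e + 1,
    3 * m + (2 * e + 1) := Suc c, 2 * m + e := c)"
  have run: "wp B color_code 8 (\<lambda>(v', M1). regs v' \<and> M1 = M') (v, M)"
    using v vv B_bound c e row_bound[of "p e" c] row_bound[of "r e" c] vert[OF e(1)] unfolding color_code_def M'_def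
    by (simp add: wp_simps regs_def)
  have "rep (\<sigma>(e \<mapsto> c)) M'"
  proof -
    have big: "row x + \<kappa> \<noteq> 2 * m + j" "row x + \<kappa> \<noteq> 3 * m + (2 * j + 1)" "row x + \<kappa> \<noteq> 5 * m + 1"
      "row x + \<kappa> \<noteq> 2 * j" "row x + \<kappa> \<noteq> 2 * j + 1" if "j < m" for x \<kappa> j
      using that by (simp_all add: row_def)
    have low: "M' a = M a" if "a < 2 * m \<or> a = 5 * m + 1" for a
      using that e by (auto simp: M'_def row_def)
    have 1: "M' (2 * j) = row (p j) \<and> M' (2 * j + 1) = row (r j)" if "j < m" for j
      using that repD(1,2)[OF rep that] by (simp add: low)
    have 2: "M' (3 * m + (2 * j + 1)) = flag (\<sigma>(e \<mapsto> c)) j" if "j < m" for j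
      using that e repD(3)[OF rep that] by (auto simp: M'_def row_def flag_def)
    have 3: "M' (5 * m + 1) = 0" using repD(4)[OF rep] by (simp add: low)
    have 4: "M' (2 * m + j) = \<kappa>" if "j < m" "(\<sigma>(e \<mapsto> c)) j = Some \<kappa>" for j \<kappa>
      using that e repD(5)[OF rep, of j \<kappa>] by (auto simp: M'_def row_def split: if_splits)
    have cols: "cols (\<sigma>(e \<mapsto> c)) x = (if x \<in> ends e then insert c (cols \<sigma> x) else cols \<sigma> x)" for x
    proof -
      have "\<mu> \<in> cols (\<sigma>(e \<mapsto> c)) x" if mu: "\<mu> \<in> cols \<sigma> x" for \<mu>
      proof -
        obtain i where i: "i < m" "\<sigma> i = Some \<mu>" "x \<in> ends i" using mu by (auto simp: cols_def)
        then have "i \<noteq> e" using e by auto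
        then show ?thesis using i by (auto simp: cols_def intro!: exI[of _ i])
      qed
      moreover have "c \<in> cols (\<sigma>(e \<mapsto> c)) x" if "x \<in> ends e"
        using that e by (auto simp: cols_def intro!: exI[of _ e])
      moreover have "cols (\<sigma>(e \<mapsto> c)) x \<subseteq> (if x \<in> ends e then insert c (cols \<sigma> x) else cols \<sigma> x)"
        by (auto simp: cols_def split: if_splits)
      ultimately show ?thesis by auto
    qed
    have tab: "M' (row x + \<kappa>) = (if x \<in> ends e \<and> \<kappa> = c then 2 * e + 1 else M (row x + \<kappa>))"
      if "x < n" "\<kappa> < q" for x \<kappa>
    proof -
      have "row x + \<kappa> \<noteq> 3 * m + (2 * e + 1)" "row x + \<kappa> \<noteq> 2 * m + e" using big e by auto
      then show ?thesis using row_inj[OF that(2) c] by (auto simp: M'_def ends_def)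
    qed
    have 5: "M' (row x + \<kappa>) = 0" if "x < n" "\<kappa> < q" "\<kappa> \<notin> cols (\<sigma>(e \<mapsto> c)) x" for x \<kappa>
      using that tab[OF that(1,2)] repD(6)[OF rep that(1,2)] by (auto simp: cols split: if_splits)
    have 6: "M' (row x + \<kappa>) = 2 * j + 1" if "x < n" "\<kappa> < q" "j < m" "(\<sigma>(e \<mapsto> c)) j = Some \<kappa>" "x \<in> ends j" for x \<kappa> j
    proof (cases "j = e")
      case True
      then show ?thesis using that tab[OF that(1,2)] by simp
    next
      case False
      then have s: "\<sigma> j = Some \<kappa>" using that by simp
      have "\<not> (x \<in> ends e \<and> \<kappa> = c)"
        using free s that(3,5) by (auto simp: free_def cols_def ends_def)
      then show ?thesis using tab[OF that(1,2)] repD(7)[OF rep that(1,2,3) s that(5)] by auto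
    qed
    show ?thesis unfolding rep_def using 1 2 3 4 5 6 by blast
  qed
  then show ?thesis by (intro wp_mono[OF run]) auto
qed

end

section \<open>Following a maximal alternating path\<close>

context coloring_instance begin

lemma altpath_snoc:
  assumes "altpath \<sigma> a b x fs" "g < m" "\<sigma> g = Some (if even (length fs) then a else b)" "vend x fs \<in> ends g"
  shows "altpath \<sigma> a b x (fs @ [g])"
  using assms by (auto simp: altpath_def walk_append nth_append less_Suc_eq)

lemma ex_maximal_altpath:
  assumes "proper \<sigma>" "a \<noteq> b" "b \<notin> cols \<sigma> x"
  shows "\<exists>fs. altpath \<sigma> a b x fs \<and> (if even (length fs) then a else b) \<notin> cols \<sigma> (vend x fs)"
proof -
  let ?P = "\<lambda>fs. altpath \<sigma> a b x fs"
  have "?P []" by (simp add: altpath_def)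
  moreover have "\<forall>fs. ?P fs \<longrightarrow> length fs < Suc m" using altpath_length(1)[OF assms(1) _ assms(2,3)] le_imp_less_Suc by blast
  ultimately obtain fs where fs: "?P fs" "\<And>gs. ?P gs \<Longrightarrow> length gs \<le> length fs"
    using ex_has_greatest_nat[of ?P "[]" length "Suc m"] by blast
  have "(if even (length fs) then a else b) \<notin> cols \<sigma> (vend x fs)"
  proof
    assume "(if even (length fs) then a else b) \<in> cols \<sigma> (vend x fs)"
    then obtain g where "g < m" "\<sigma> g = Some (if even (length fs) then a else b)" "vend x fs \<in> ends g"
      by (auto simp: cols_def)
    then have "?P (fs @ [g])" by (rule altpath_snoc[OF fs(1)])
    from fs(2)[OF this] show False by simp
  qed
  then show ?thesis using fs(1) by blast
qed

end

context coloring_machine begin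

definition stored :: "nat \<Rightarrow> nat list \<Rightarrow> nat \<Rightarrow> (nat \<Rightarrow> nat) \<Rightarrow> bool" where
  "stored u fs i M \<longleftrightarrow> (\<forall>k<i. M (5 * m + 2 + k) = 2 * (fs ! k) + 1) \<and> (\<forall>k\<le>i. M (6 * m + 2 + k) = row (vtx u fs k))"

definition agree :: "nat set \<Rightarrow> (nat \<Rightarrow> nat) \<Rightarrow> (nat \<Rightarrow> nat) \<Rightarrow> bool" where
  "agree S v v' \<longleftrightarrow> (\<forall>x\<in>S. v' x = v x)"

lemma wp_walk_step:
  assumes v: "regs v" and g: "g < m" "w \<in> ends g" and k: "k < m"
    and M: "M (2 * g) = row (p g)" "M (2 * g + 1) = row (r g)"
    and vv: "v 23 = k" "v 22 = 2 * g + 1" "v 19 = row w" "v 20 = a" "v 21 = b" and ab: "a < q" "b < q"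
    and T: "M (row (other g w) + b) \<le> 2 * m"
  shows "wp B walk_body 15 (\<lambda>(v', M'). regs v' \<and> M' = M(5 * m + 2 + k := 2 * g + 1, 6 * m + 2 + Suc k := row (other g w))
     \<and> v' 23 = Suc k \<and> v' 22 = M (row (other g w) + b) \<and> v' 19 = row (other g w) \<and> v' 20 = b \<and> v' 21 = a
     \<and> agree {9,10,11,12,13,14,15,16,26,27} v v') (v, M)"
proof -
  let ?w = "other g w"
  have w: "w = p g \<and> ?w = r g \<or> w = r g \<and> ?w = p g"
    using g ends_distinct[OF g(1)] by (auto simp: ends_def other_def)
  have rb: "2 * row (p g) + 6 * m + 30 \<le> B" "2 * row (r g) + 6 * m + 30 \<le> B" "2 * (row ?w + b) + 6 * m + 30 \<le> B"
    using row_bound[of "p g" 0] row_bound[of "r g" 0] row_bound[of ?w b] vert[OF g(1)] ab w by auto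
  have s: "row (p g) + row (r g) - row w = row ?w" using w by auto
  have ne: "2 * g \<noteq> 5 * m + 2 + k" "2 * g + 1 \<noteq> 5 * m + 2 + k" "row ?w + b \<noteq> 5 * m + 2 + k"
    "row ?w + b \<noteq> 6 * m + 2 + Suc k"
    using g(1) k by (auto simp: row_def)
  show ?thesis unfolding walk_body_def
    using v vv M s ne rb T B_bound g(1) k ab by (simp add: wp_simps regs_def agree_def)
qed

text \<open>The path that the machine is going to find is given in advance. Its maximality makes the
  table lookup at its end return \<open>0\<close>, which terminates the loop after
  \<open>length fs\<close> iterations.\<close>

lemma wp_walk:
  assumes rep: "rep \<sigma> M" and pc: "\<sigma> \<in> pcolorings" and v: "regs v" and e: "e < m"
    and free: "free \<sigma> e c" and c: "c < q" and d: "d < q" "d \<noteq> c"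
    and path: "altpath \<sigma> d c (p e) fs" "(if even (length fs) then d else c) \<notin> cols \<sigma> (vend (p e) fs)"
    and vv: "v 11 = c" "v 12 = row (p e)" "v 13 = row (r e)" "v 26 = d"
  shows "wp B walk_code (16 * length fs + 13) (\<lambda>(v', M'). regs v' \<and> rep \<sigma> M' \<and> stored (p e) fs (length fs) M'
     \<and> v' 14 = (if vend (p e) fs = r e then length fs else v 14)
     \<and> agree {9,10,11,12,13,15,16,26,27} v v') (v, M)"
proof -
  let ?L = "length fs" and ?y = "vtx (p e) fs"
  let ?ca = "\<lambda>k. if even k then d else c" and ?cb = "\<lambda>k. if even k then c else d"
  have pr: "proper \<sigma>" using pc by (simp add: pcolorings_def)
  have wk: "walk (p e) fs" and col: "\<And>k. k < ?L \<Longrightarrow> \<sigma> (fs ! k) = Some (?ca k)"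
    using path(1) by (auto simp: altpath_def)
  have L: "?L \<le> m" using altpath_length(1)[OF pr path(1) d(2)] free by (simp add: free_def)
  have yn: "?y k < n" if "k \<le> ?L" for k
  proof (cases k)
    case 0
    then show ?thesis using vert[OF e] by simp
  next
    case (Suc l)
    then show ?thesis using walk_nth(1,3)[OF wk, of l] vert[of "fs ! l"] that by (auto simp: ends_def)
  qed
  have tab: "M' (row (?y k) + ?ca k) = (if k < ?L then 2 * (fs ! k) + 1 else 0)" if "k \<le> ?L" "rep \<sigma> M'" for k M'
  proof (cases "k < ?L")
    case True
    have kk: "fs ! k < m" "\<sigma> (fs ! k) = Some (?ca k)" "?y k \<in> ends (fs ! k)"
      using walk_nth[OF wk True] col[OF True] by auto
    have "?ca k < q" using c d by simp
    from repD(7)[OF that(2) yn[OF that(1)] this kk] show ?thesis using True by simp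
  next
    case False
    then have "k = ?L" using that by simp
    then show ?thesis using repD(6)[OF that(2) yn[of ?L], of "?ca ?L"] path(2) c d by (simp add: vtx_length)
  qed
  let ?I = "\<lambda>k (v', M'). regs v' \<and> rep \<sigma> M' \<and> stored (p e) fs k M' \<and> v' 23 = k \<and>
     v' 22 = (if k < ?L then 2 * (fs ! k) + 1 else 0) \<and> v' 19 = row (?y k) \<and> v' 20 = ?ca k \<and> v' 21 = ?cb k \<and>
     agree {9,10,11,12,13,14,15,16,26,27} v v'"
  have init: "wp B [Add 19 12 0, Add 20 26 0, Add 21 11 0, Const 23 0, Store 7 19, Add 17 19 20, Load 22 17] 7 (?I 0) (v, M)"
  proof -
    let ?M = "M(6 * m + 2 := row (p e))"
    have r: "rep \<sigma> ?M" by (rule rep_scratch[OF rep]) auto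
    have t: "?M (row (p e) + d) = (if 0 < ?L then 2 * (fs ! 0) + 1 else 0)" using tab[OF _ r, of 0] by simp
    have st: "stored (p e) fs 0 ?M" by (simp add: stored_def)
    have tb: "?M (row (p e) + d) \<le> 2 * m" using tab_bound[OF r _ d(1)] vert[OF e] by blast
    have rb: "2 * (row (p e) + d) + 6 * m + 30 \<le> B" using row_bound[of "p e" d] vert[OF e] d by simp
    show ?thesis
      using v vv c d t st r tb rb B_bound
      by (simp add: wp_simps regs_def agree_def)
  qed
  have loop: "wp B [While 22 walk_body] (?L * (15 + 1) + 1) (?I ?L) st'" if "?I 0 st'" for st'
  proof (rule wp_While_const[where I = ?I, OF that])
    fix k v' M' assume k: "k < ?L" and I: "?I k (v', M')"
    let ?g = "fs ! k" and ?w = "?y (Suc k)"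
    let ?M = "M'(5 * m + 2 + k := 2 * ?g + 1, 6 * m + 2 + Suc k := row ?w)"
    have g: "?g < m" "?y k \<in> ends ?g" "?w = other ?g (?y k)" using walk_nth[OF wk k] vtx_Suc[OF k] by auto
    have rM: "rep \<sigma> M'" using I by simp
    have r1: "rep \<sigma> (M'(5 * m + 2 + k := 2 * ?g + 1))" by (rule rep_scratch[OF rM]) (use k L in auto)
    have r2: "rep \<sigma> ?M" by (rule rep_scratch[OF r1]) (use k L in auto)
    have ca: "?ca (Suc k) = ?cb k" "?cb (Suc k) = ?ca k" by auto
    have t: "M' (row ?w + ?cb k) = (if Suc k < ?L then 2 * (fs ! Suc k) + 1 else 0)"
      using tab[OF _ rM, of "Suc k"] k unfolding ca by simp
    have tb: "M' (row ?w + ?cb k) \<le> 2 * m" using tab_bound[OF rM yn[of "Suc k"], of "?cb k"] k c d by simp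
    have st: "stored (p e) fs (Suc k) ?M"
      unfolding stored_def
    proof (intro conjI allI impI)
      have s: "stored (p e) fs k M'" using I by simp
      fix l
      show "?M (5 * m + 2 + l) = 2 * (fs ! l) + 1" if "l < Suc k"
        using that s k L by (cases "l = k") (auto simp: stored_def)
      show "?M (6 * m + 2 + l) = row (?y l)" if "l \<le> Suc k"
        using that s k L by (cases "l = Suc k") (auto simp: stored_def)
    qed
    have "wp B walk_body 15 (\<lambda>(v1, M1). regs v1 \<and> M1 = ?M
     \<and> v1 23 = Suc k \<and> v1 22 = M' (row ?w + ?cb k) \<and> v1 19 = row ?w \<and> v1 20 = ?cb k \<and> v1 21 = ?ca k
     \<and> agree {9,10,11,12,13,14,15,16,26,27} v' v1) (v', M')"
      unfolding g(3) by (rule wp_walk_step) (use I g k L c d tb repD(1,2)[OF rM g(1)] in auto)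
    then have "wp B walk_body 15 (?I (Suc k)) (v', M')"
      by (rule wp_mono) (use I r2 st t ca in \<open>auto simp: agree_def\<close>)
    then show "v' 22 \<noteq> 0 \<and> wp B walk_body 15 (?I (Suc k)) (v', M')" using I k by simp
  qed auto
  have fin: "wp B [Sub 17 19 13, Sub 18 13 19, Add 17 17 18, If 17 [] [Add 14 23 0]] 5 (\<lambda>(v', M'). regs v' \<and> rep \<sigma> M' \<and> stored (p e) fs (length fs) M'
     \<and> v' 14 = (if vend (p e) fs = r e then length fs else v 14)
     \<and> agree {9,10,11,12,13,15,16,26,27} v v') st'" if I: "?I ?L st'" for st'
  proof -
    obtain v' M' where st': "st' = (v', M')" by fastforce
    have eq: "row (vend (p e) fs) = row (r e) \<longleftrightarrow> vend (p e) fs = r e" using row_inj0 c by simp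
    have rb: "2 * row (vend (p e) fs) + 6 * m + 30 \<le> B" "2 * row (r e) + 6 * m + 30 \<le> B"
      using row_bound[of "vend (p e) fs" 0] row_bound[of "r e" 0] yn[of ?L] vert[OF e] by (auto simp: vtx_length)
    have v': "v' 19 = row (vend (p e) fs)" "v' 13 = row (r e)" using I vv st' by (auto simp: vtx_length agree_def)
    show ?thesis unfolding st'
      using I eq rb v' B_bound L unfolding st'
      by (cases "vend (p e) fs = r e") (simp_all add: wp_simps regs_def agree_def vtx_length)
  qed
  have "wp B walk_code (7 + ((?L * (15 + 1) + 1) + 5)) (\<lambda>(v', M'). regs v' \<and> rep \<sigma> M' \<and> stored (p e) fs (length fs) M'
     \<and> v' 14 = (if vend (p e) fs = r e then length fs else v 14)
     \<and> agree {9,10,11,12,13,15,16,26,27} v v') (v, M)"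
    unfolding walk_code_def by (rule wp_seq[OF init], rule wp_seq[OF loop], assumption, rule fin)
  then show ?thesis by (rule wp_mono) auto
qed

end

section \<open>The search for a closing path\<close>

lemma wp_append_le:
  assumes "wp B p s1 P st" "\<And>v M. P (v, M) \<Longrightarrow> wp B p' s2 priv (v, M)" "s1 + s2 \<le> s"
  shows "wp B (p @ p') s priv st"
proof -
  have "wp B (p @ p') (s1 + s2) priv st" by (rule wp_seq[OF assms(1)]) (use assms(2) in auto)
  then show ?thesis by (rule wp_mono) (use assms(3) in auto)
qed

text \<open>A colored edge lies at \<open>p e\<close> exactly if the table entry for its color in
  the row of \<open>p e\<close> names this edge. So a single lookup tests incidence, and only
  incident edges start a walk.\<close>

definition probe_code :: "instr list" where
  "probe_code = [Add 17 5 15, Load 26 17, If 26 [Sub 26 26 3, Add 17 12 26, Load 17 17, Sub 18 17 15,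
     Sub 19 15 17, Add 17 18 19, If 17 [] walk_code] []]"

definition detect_code :: "instr list" where
  "detect_code = [Const 14 0, Const 15 1, Add 16 1 0] @
     [While 16 ([If 14 [] probe_code] @ [Add 15 15 4, Sub 16 16 3])]"

context coloring_instance begin

lemma closes_hd:
  assumes "closes \<sigma> c e gs"
  shows "hd gs < m" "p e \<in> ends (hd gs)" "\<exists>d. d \<noteq> c \<and> \<sigma> (hd gs) = Some d \<and> altpath \<sigma> d c (p e) gs"
    "gs \<noteq> []" "vend (p e) gs = r e"
proof -
  obtain a where a: "a \<noteq> c" "altpath \<sigma> a c (p e) gs" and g: "gs \<noteq> []" "vend (p e) gs = r e"
    using assms unfolding closes_def by blast
  then show "gs \<noteq> []" "vend (p e) gs = r e" by auto
  have w: "walk (p e) gs" "0 < length gs" using a g by (auto simp: altpath_def)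
  show "hd gs < m" "p e \<in> ends (hd gs)" using walk_nth(1,2)[OF w] g by (auto simp: hd_conv_nth)
  have "\<sigma> (hd gs) = Some a" using a w(2) g(1) unfolding altpath_def by (metis hd_conv_nth even_zero)
  then show "\<exists>d. d \<noteq> c \<and> \<sigma> (hd gs) = Some d \<and> altpath \<sigma> d c (p e) gs" using a by blast
qed

text \<open>Walking as far as possible misses no closing path: such a path cannot be extended beyond
  \<open>r e\<close>, where \<open>c\<close> is missing, so it is the maximal path with its first
  edge.\<close>

lemma maximal_altpath_closes:
  assumes pr: "proper \<sigma>" and free: "free \<sigma> e c" and k: "k < m" "p e \<in> ends k" "\<sigma> k = Some d"
    and path: "altpath \<sigma> d c (p e) fs" "(if even (length fs) then d else c) \<notin> cols \<sigma> (vend (p e) fs)"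
  shows "d \<noteq> c" "fs \<noteq> []" "hd fs = k" "vend (p e) fs = r e \<Longrightarrow> closes \<sigma> c e fs"
    "closes \<sigma> c e gs \<Longrightarrow> hd gs = k \<Longrightarrow> vend (p e) fs = r e"
proof -
  have dc: "d \<in> cols \<sigma> (p e)" using k by (auto simp: cols_def)
  then show d: "d \<noteq> c" using free by (auto simp: free_def)
  show fs: "fs \<noteq> []" using path(2) dc by (intro notI) simp
  then have "walk (p e) fs" "0 < length fs" "\<sigma> (fs ! 0) = Some d" using path(1) by (auto simp: altpath_def)
  then show "hd fs = k"
    using properD[OF pr, of "fs ! 0" k d "p e"] walk_nth(1,2)[of "p e" fs 0] k fs by (auto simp: hd_conv_nth)
  show "closes \<sigma> c e fs" if "vend (p e) fs = r e" using that fs d path(1) unfolding closes_def by blast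
  assume gs: "closes \<sigma> c e gs" "hd gs = k"
  obtain d' where d': "\<sigma> (hd gs) = Some d'" "altpath \<sigma> d' c (p e) gs" using closes_hd(3)[OF gs(1)] by blast
  then have ag: "altpath \<sigma> d c (p e) gs" using gs k by simp
  have "(if even (length gs) then d else c) \<notin> cols \<sigma> (vend (p e) gs)"
    using closes_odd[OF free gs(1)] closes_hd(5)[OF gs(1)] free by (simp add: free_def)
  then have "fs = gs"
    using altpath_unique[OF pr path(1) ag _ path(2)] altpath_unique[OF pr ag path(1)]
    by (cases "length fs \<le> length gs") auto
  then show "vend (p e) fs = r e" using closes_hd(5)[OF gs(1)] by simp
qed

end

context coloring_machine begin

text \<open>The invariant after all edges below \<open>k\<close> have been probed. As long as
  nothing is found, closing paths start at \<open>k\<close> or later, so the first hit is the one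
  with the least first edge, as \<open>closing\<close> demands.\<close>

definition detected :: "(nat \<Rightarrow> nat option) \<Rightarrow> nat \<Rightarrow> nat \<Rightarrow> nat \<Rightarrow> (nat \<Rightarrow> nat) \<Rightarrow> (nat \<Rightarrow> nat) \<Rightarrow> bool" where
  "detected \<sigma> e c k v M \<longleftrightarrow> (v 14 = 0 \<and> (\<forall>gs. closes \<sigma> c e gs \<longrightarrow> k \<le> hd gs)) \<or>
     (\<exists>fs. closing \<sigma> c e = Some fs \<and> fs \<noteq> [] \<and> v 14 = length fs \<and> stored (p e) fs (length fs) M \<and> \<sigma> (hd fs) = Some (v 26))"

lemma wp_probe:
  assumes rep: "rep \<sigma> M" and pc: "\<sigma> \<in> pcolorings" and v: "regs v" and e: "e < m"
    and free: "free \<sigma> e c" and c: "c < q" and k: "k < m"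
    and vv: "v 11 = c" "v 12 = row (p e)" "v 13 = row (r e)" "v 15 = 2 * k + 1"
    and det: "detected \<sigma> e c k v M"
  shows "wp B [If 14 [] probe_code] (11 + (if p e \<in> ends k then 16 * min n m + 13 else 0))
    (\<lambda>(v', M'). regs v' \<and> rep \<sigma> M' \<and> detected \<sigma> e c (Suc k) v' M' \<and> agree {9,10,11,12,13,15,16,27} v v') (v, M)"
proof (cases "v 14 = 0")
  case False
  then have "detected \<sigma> e c (Suc k) v M" using det by (auto simp: detected_def)
  then show ?thesis using False rep v by (simp add: wp_simps agree_def)
next
  case v14: True
  then have none: "k \<le> hd gs" if "closes \<sigma> c e gs" for gs
    using det that by (auto simp: detected_def dest: closing_Some)
  have f: "M (3 * m + (2 * k + 1)) = flag \<sigma> k" using repD(3)[OF rep k] .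
  have fq: "flag \<sigma> k \<le> q" using flag_le[OF pc] .
  have skip: "detected \<sigma> e c (Suc k) v' M" if sk: "v' 14 = 0" "\<And>gs. closes \<sigma> c e gs \<Longrightarrow> hd gs \<noteq> k" for v' M
  proof -
    have "Suc k \<le> hd gs" if cl: "closes \<sigma> c e gs" for gs using none[OF cl] sk(2)[OF cl] by simp
    then show ?thesis using sk(1) by (simp add: detected_def)
  qed
  show ?thesis
  proof (cases "\<sigma> k")
    case None
    then have "closes \<sigma> c e gs \<Longrightarrow> hd gs \<noteq> k" for gs using closes_hd(3)[of \<sigma> c e gs] by auto
    then have "detected \<sigma> e c (Suc k) (v(17 := 3 * m + (2 * k + 1), 26 := 0)) M" using v14 by (intro skip) auto
    moreover have "flag \<sigma> k = 0" using None by (simp add: flag_def)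
    ultimately show ?thesis
      using v14 rep v f vv B_bound k by (simp add: wp_simps probe_code_def regs_def agree_def)
  next
    case (Some d)
    have fl: "flag \<sigma> k = Suc d" using Some by (simp add: flag_def)
    have d: "d < q" using pc Some by (auto simp: pcolorings_def ran_def)
    have pn: "p e < n" using vert[OF e] by simp
    have rb: "2 * (row (p e) + d) + 6 * m + 30 \<le> B" using row_bound[OF pn] d by simp
    have tb: "M (row (p e) + d) \<le> 2 * m" using tab_bound[OF rep pn d] .
    have teq: "M (row (p e) + d) = 2 * k + 1 \<longleftrightarrow> p e \<in> ends k"
    proof
      assume t: "M (row (p e) + d) = 2 * k + 1"
      then have "d \<in> cols \<sigma> (p e)" using repD(6)[OF rep pn d] by auto
      then obtain j where j: "j < m" "\<sigma> j = Some d" "p e \<in> ends j" by (auto simp: cols_def)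
      then have "j = k" using repD(7)[OF rep pn d j] t by simp
      then show "p e \<in> ends k" using j by simp
    qed (use repD(7)[OF rep pn d k Some] in auto)
    show ?thesis
    proof (cases "p e \<in> ends k")
      case False
      then have "closes \<sigma> c e gs \<Longrightarrow> hd gs \<noteq> k" for gs using closes_hd(2)[of \<sigma> c e gs] by auto
      then have sk: "v' 14 = 0 \<Longrightarrow> detected \<sigma> e c (Suc k) v' M" for v' by (intro skip) auto
      have ne: "M (row (p e) + d) < 2 * k + 1 \<or> 2 * k + 1 < M (row (p e) + d)" using teq False by linarith
      from ne show ?thesis
      proof
        assume "M (row (p e) + d) < 2 * k + 1"
        then show ?thesis
          using v14 rep v f fl vv B_bound k False rb tb d sk by (simp add: wp_simps probe_code_def regs_def agree_def)
      next
        assume "2 * k + 1 < M (row (p e) + d)"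
        then show ?thesis
          using v14 rep v f fl vv B_bound k False rb tb d sk by (simp add: wp_simps probe_code_def regs_def agree_def)
      qed
    next
      case True
      have pr: "proper \<sigma>" using pc by (simp add: pcolorings_def)
      have dc: "d \<noteq> c" "c \<notin> cols \<sigma> (p e)" using free True k Some by (auto simp: free_def cols_def)
      obtain fs where fs: "altpath \<sigma> d c (p e) fs" "(if even (length fs) then d else c) \<notin> cols \<sigma> (vend (p e) fs)"
        using ex_maximal_altpath[OF pr dc] by blast
      note mc = maximal_altpath_closes[OF pr free k True Some fs]
      have "length fs \<le> card {..<n}"
        by (rule altpath_length(2)[OF pr fs(1) dc]) (use vert in \<open>auto simp: ends_def\<close>)
      then have len: "length fs \<le> min n m" using altpath_length(1)[OF pr fs(1) dc] by simp
      let ?P = "\<lambda>(v', M'). regs v' \<and> rep \<sigma> M' \<and> detected \<sigma> e c (Suc k) v' M' \<and> agree {9,10,11,12,13,15,16,27} v v'"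
      have walk: "wp B walk_code (16 * length fs + 13) ?P (v1, M)"
        if v1: "regs v1" "agree {9,10,11,12,13,14,15,16,27} v v1" "v1 26 = d" for v1
      proof -
        have vv1: "v1 11 = c" "v1 12 = row (p e)" "v1 13 = row (r e)" "v1 14 = 0"
          using v1(2) vv v14 by (auto simp: agree_def)
        have post: "detected \<sigma> e c (Suc k) v' M'"
          if "v' 14 = (if vend (p e) fs = r e then length fs else v1 14)" "stored (p e) fs (length fs) M'" "v' 26 = d" for v' M'
        proof (cases "vend (p e) fs = r e")
          case True
          have "closing \<sigma> c e = Some fs"
            by (rule closing_eqI[OF pr free mc(4)[OF True]]) (use none mc(3) in auto)
          then show ?thesis using that True mc(2,3) Some by (auto simp: detected_def)
        next
          case False
          then have "closes \<sigma> c e gs \<Longrightarrow> hd gs \<noteq> k" for gs using mc(5) by blast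
          then show ?thesis using that(1) False vv1(4) by (intro skip) auto
        qed
        show ?thesis
          by (rule wp_mono[OF wp_walk[OF rep pc v1(1) e free c d dc(1) fs vv1(1-3) v1(3)]])
             (use post v1 in \<open>auto simp: agree_def\<close>)
      qed
      have walk': "wp B walk_code s ?P (v1, M)"
        if "regs v1" "agree {9,10,11,12,13,14,15,16,27} v v1" "v1 26 = d" "16 * length fs + 13 \<le> s" for v1 s
        by (rule wp_mono[OF walk[OF that(1-3)] that(4)])
      have t: "M (row (p e) + d) = 2 * k + 1" using teq True by simp
      let ?v1 = "v(17 := 0, 26 := d, 18 := 0, 19 := 0)"
      have r1: "regs ?v1" "agree {9,10,11,12,13,14,15,16,27} v ?v1" using v by (auto simp: regs_def agree_def)
      have "wp B walk_code (13 + 16 * min n m) ?P (?v1, M)" by (rule walk') (use r1 len in auto)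
      moreover have "wp B [If 14 [] probe_code] (11 + (16 * min n m + 13)) ?P (v, M)
         = wp B walk_code (13 + 16 * min n m) ?P (?v1, M)"
        using v14 v f fl vv B_bound k rb tb d t
        by (simp add: wp_simps probe_code_def regs_def fun_upd_twist)
      ultimately show ?thesis using True by simp
    qed
  qed
qed

text \<open>At most \<open>D + 1\<close> of the \<open>m\<close> iterations start a walk, so the
  time is of order \<open>m + (D + 1) * min n m\<close> and not \<open>m * min n m\<close>.\<close>

lemma wp_detect:
  assumes rep: "rep \<sigma> M" and pc: "\<sigma> \<in> pcolorings" and v: "regs v" and e: "e < m"
    and free: "free \<sigma> e c" and c: "c < q"
    and vv: "v 11 = c" "v 12 = row (p e)" "v 13 = row (r e)"
  shows "wp B detect_code (4 + 14 * m + (D + 1) * (16 * min n m + 13))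
    (\<lambda>(v', M'). regs v' \<and> rep \<sigma> M' \<and> agree {9,10,11,12,13,27} v v' \<and>
      (case closing \<sigma> c e of None \<Rightarrow> v' 14 = 0
       | Some fs \<Rightarrow> fs \<noteq> [] \<and> v' 14 = length fs \<and> stored (p e) fs (length fs) M' \<and> \<sigma> (hd fs) = Some (v' 26))) (v, M)"
proof -
  let ?body = "[If 14 [] probe_code] @ [Add 15 15 4, Sub 16 16 3]"
  let ?I = "\<lambda>k (v', M'). regs v' \<and> rep \<sigma> M' \<and> agree {9,10,11,12,13,27} v v' \<and> v' 15 = 2 * k + 1 \<and> v' 16 = m - k \<and>
     detected \<sigma> e c k v' M'"
  let ?t = "\<lambda>k. if p e \<in> ends k then 16 * min n m + 13 else 0"
  have init: "wp B [Const 14 0, Const 15 1, Add 16 1 0] 3 (?I 0) (v, M)"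
    using v rep B_bound by (simp add: wp_simps regs_def agree_def detected_def)
  have loop: "wp B [While 16 ?body] ((\<Sum>k<m. (13 + ?t k) + 1) + 1) (?I m) st'" if "?I 0 st'" for st'
  proof (rule wp_While[where I = ?I, OF that])
    fix k and st :: state assume k: "k < m" and I: "?I k st"
    obtain v' M' where st: "st = (v', M')" by fastforce
    have vv': "v' 11 = c" "v' 12 = row (p e)" "v' 13 = row (r e)" using I vv unfolding st by (auto simp: agree_def)
    have a: "rep \<sigma> M'" "regs v'" "v' 15 = 2 * k + 1" "detected \<sigma> e c k v' M'" using I st by auto
    have "wp B ?body (13 + ?t k) (?I (Suc k)) (v', M')"
    proof (rule wp_append_le[OF wp_probe[OF a(1) pc a(2) e free c k vv' a(3,4)]])
      fix v1 M1
      assume P: "case (v1, M1) of (v'', M'') \<Rightarrow> regs v'' \<and> rep \<sigma> M'' \<and> detected \<sigma> e c (Suc k) v'' M'' \<and>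
        agree {9,10,11,12,13,15,16,27} v' v''"
      have "detected \<sigma> e c (Suc k) (v1(15 := x, 16 := y)) M1" for x y using P by (simp add: detected_def)
      then show "wp B [Add 15 15 4, Sub 16 16 3] 2 (?I (Suc k)) (v1, M1)"
        using P I B_bound k unfolding st by (simp add: wp_simps regs_def agree_def)
    qed simp
    then show "fst st 16 \<noteq> 0 \<and> wp B ?body (13 + ?t k) (?I (Suc k)) st" using I k st by simp
  qed auto
  have "wp B detect_code (3 + ((\<Sum>k<m. (13 + ?t k) + 1) + 1)) (?I m) (v, M)"
    unfolding detect_code_def by (rule wp_seq[OF init], rule loop)
  moreover have "3 + ((\<Sum>k<m. (13 + ?t k) + 1) + 1) \<le> 4 + 14 * m + (D + 1) * (16 * min n m + 13)"
  proof -
    have "(\<Sum>k<m. ?t k) = (\<Sum>k\<in>{k\<in>{..<m}. p e \<in> ends k}. 16 * min n m + 13)"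
      by (rule sum.inter_filter[symmetric]) simp
    also have "\<dots> = card {k. k < m \<and> p e \<in> ends k} * (16 * min n m + 13)" by simp
    also have "\<dots> \<le> (D + 1) * (16 * min n m + 13)" using card_incident[of "p e"] by (intro mult_right_mono) auto
    finally show ?thesis by (simp add: sum.distrib)
  qed
  ultimately show ?thesis
  proof (rule wp_mono)
    fix st assume I: "?I m st"
    obtain v' M' where st: "st = (v', M')" by fastforce
    have "case closing \<sigma> c e of None \<Rightarrow> v' 14 = 0
       | Some fs \<Rightarrow> fs \<noteq> [] \<and> v' 14 = length fs \<and> stored (p e) fs (length fs) M' \<and> \<sigma> (hd fs) = Some (v' 26)"
    proof (cases "\<exists>fs. closes \<sigma> c e fs")
      case True
      then obtain fs where cl: "closes \<sigma> c e fs" by blast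
      then have "\<not> m \<le> hd fs" using closes_hd(1) by (simp add: not_le)
      then show ?thesis using I cl unfolding st by (auto simp: detected_def)
    next
      case False
      then have "closing \<sigma> c e = None" by (simp add: closing_None)
      then show ?thesis using I unfolding st by (auto simp: detected_def)
    qed
    then show "case st of (v', M') \<Rightarrow> regs v' \<and> rep \<sigma> M' \<and> agree {9,10,11,12,13,27} v v' \<and>
      (case closing \<sigma> c e of None \<Rightarrow> v' 14 = 0
       | Some fs \<Rightarrow> fs \<noteq> [] \<and> v' 14 = length fs \<and> stored (p e) fs (length fs) M' \<and> \<sigma> (hd fs) = Some (v' 26))"
      using I unfolding st by simp
  qed
qed

end

section \<open>Testing a private color and erasing a cycle\<close>

definition lookup_code :: "nat \<Rightarrow> instr list" where
  "lookup_code i = [Const 19 i, Add 19 7 19, Load 19 19, Add 19 19 25, Load 19 19]"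

text \<open>Table entries are \<open>0\<close> for missing colors and positive otherwise, so one sum
  tests that the color is missing at all the other vertices.\<close>

definition private_code :: "nat \<Rightarrow> nat \<Rightarrow> instr list" where
  "private_code a z = ([Const 17 0] @
     concat (map (\<lambda>i. lookup_code i @ [Add 17 17 19]) (filter (\<lambda>i. i \<noteq> a \<and> i \<noteq> z) [0..<6]))) @
     (lookup_code a @ [If 17 [Const 28 0] [Add 28 19 0]])"

definition check_code :: "instr list" where
  "check_code = [If 24 [Sub 29 24 3, If 29 [Sub 29 29 3, If 29 [Sub 29 29 3,
     If 29 (private_code 5 4) (private_code 3 4)] (private_code 2 3)] (private_code 1 2)] (private_code 0 1)]"

definition erase_code :: "instr list" where
  "erase_code = [Add 17 6 23, Load 22 17, Sub 17 22 3, Load 17 17, Add 17 17 20, Store 17 0, Load 17 22,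
     Add 17 17 20, Store 17 0, Add 17 5 22, Store 17 0]"

text \<open>Register \<open>24\<close> becomes \<open>kept j\<close>, computed as
  \<open>j - (j - 3)\<close>. In iteration \<open>k\<close> the truncated differences
  \<open>kept j - k\<close> and \<open>k - kept j - 1\<close> both vanish exactly at the two kept
  positions.\<close>

definition uncolor_code :: "instr list" where
  "uncolor_code = [Const 17 3, Sub 18 24 17, Sub 24 24 18, Add 20 26 0, Add 21 11 0, Const 23 0, Add 16 14 0] @
     [While 16 ([Sub 17 24 23, Sub 18 23 24, Sub 18 18 3, Add 17 17 18, If 17 erase_code []] @
        [Add 18 20 0, Add 20 21 0, Add 21 18 0, Add 23 23 3, Sub 16 16 3])]"

context coloring_machine begin

context
  fixes \<sigma> e fs M \<kappa>
  assumes rep: "rep \<sigma> M" and e: "e < m" and st: "stored (p e) fs (length fs) M" and len: "5 \<le> length fs" "length fs \<le> m"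
    and wk: "walk (p e) fs" and k: "\<kappa> < q"
begin

lemma vtx_less: "i \<le> length fs \<Longrightarrow> vtx (p e) fs i < n"
proof (cases i)
  case 0
  then show ?thesis using vert[OF e] by simp
next
  case (Suc l)
  assume "i \<le> length fs"
  then show ?thesis using walk_nth(1,3)[OF wk, of l] vert[of "fs ! l"] Suc by (auto simp: ends_def)
qed

lemma wp_lookup:
  assumes "i < 6" "regs v" "v 25 = \<kappa>"
  shows "wp B (lookup_code i) 5 (\<lambda>st. st = (v(19 := M (row (vtx (p e) fs i) + \<kappa>)), M)) (v, M)"
proof -
  let ?x = "vtx (p e) fs i"
  have i: "i \<le> length fs" using assms(1) len by simp
  have "M (6 * m + 2 + i) = row ?x" using st i by (simp add: stored_def)
  moreover have "2 * (row ?x + \<kappa>) + 6 * m + 30 \<le> B" using row_bound[OF vtx_less[OF i]] k by simp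
  moreover have "M (row ?x + \<kappa>) \<le> 2 * m" by (rule tab_bound[OF rep vtx_less[OF i] k])
  ultimately show ?thesis
    using assms B_bound by (simp add: wp_simps lookup_code_def regs_def)
qed

lemma wp_lookups:
  assumes "set is \<subseteq> {..<6}" "regs v" "v 25 = \<kappa>" "v 17 + 2 * m * length is \<le> 20 * m"
  shows "wp B (concat (map (\<lambda>i. lookup_code i @ [Add 17 17 19]) is)) (6 * length is)
    (\<lambda>(v', M'). M' = M \<and> regs v' \<and> agree {9,11,12,13,14,24,25,26,27} v v' \<and>
       v' 17 = v 17 + (\<Sum>i\<leftarrow>is. M (row (vtx (p e) fs i) + \<kappa>))) (v, M)"
  using assms
proof (induction "is" arbitrary: v)
  case Nil
  then show ?case by (simp add: wp_simps agree_def)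
next
  case (Cons i "is")
  let ?t = "M (row (vtx (p e) fs i) + \<kappa>)"
  have i: "i < 6" "i \<le> length fs" using Cons.prems(1) len by auto
  have t: "?t \<le> 2 * m" by (rule tab_bound[OF rep vtx_less[OF i(2)] k])
  let ?v = "v(19 := ?t, 17 := v 17 + ?t)"
  have one: "wp B (lookup_code i @ [Add 17 17 19]) 6 (\<lambda>st. st = (?v, M)) (v, M)"
  proof (rule wp_append_le[OF wp_lookup[OF i(1) Cons.prems(2,3)]])
    fix v' M' assume "(v', M') = (v(19 := ?t), M)"
    moreover have "v 17 + ?t < B" using t Cons.prems(4) B_bound by simp
    ultimately show "wp B [Add 17 17 19] 1 (\<lambda>st. st = (?v, M)) (v', M')" by (simp add: wp_simps)
  qed simp
  have rest: "wp B (concat (map (\<lambda>i. lookup_code i @ [Add 17 17 19]) is)) (6 * length is)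
    (\<lambda>(v', M'). M' = M \<and> regs v' \<and> agree {9,11,12,13,14,24,25,26,27} ?v v' \<and>
       v' 17 = ?v 17 + (\<Sum>i\<leftarrow>is. M (row (vtx (p e) fs i) + \<kappa>))) (?v, M)"
    by (rule Cons.IH) (use Cons.prems t in \<open>auto simp: regs_def\<close>)
  have "wp B ((lookup_code i @ [Add 17 17 19]) @ concat (map (\<lambda>i. lookup_code i @ [Add 17 17 19]) is)) (6 * length (i # is))
    (\<lambda>(v', M'). M' = M \<and> regs v' \<and> agree {9,11,12,13,14,24,25,26,27} ?v v' \<and>
       v' 17 = ?v 17 + (\<Sum>i\<leftarrow>is. M (row (vtx (p e) fs i) + \<kappa>))) (v, M)"
    by (rule wp_append_le[OF one]) (use rest in auto)
  then show ?case by (auto simp: agree_def elim!: wp_mono)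
qed

lemma wp_private:
  assumes "a < 6" "regs v" "v 25 = \<kappa>"
  shows "wp B (private_code a z) 44 (\<lambda>(v', M'). M' = M \<and> regs v' \<and> agree {9,11,12,13,14,24,25,26,27} v v' \<and>
     (v' 28 \<noteq> 0 \<longleftrightarrow> \<kappa> \<in> cols \<sigma> (vtx (p e) fs a) \<and> (\<forall>i<6. i \<noteq> a \<longrightarrow> i \<noteq> z \<longrightarrow> \<kappa> \<notin> cols \<sigma> (vtx (p e) fs i)))) (v, M)"
proof -
  let ?is = "filter (\<lambda>i. i \<noteq> a \<and> i \<noteq> z) [0..<6]" and ?T = "\<lambda>i. M (row (vtx (p e) fs i) + \<kappa>)"
  have il: "length ?is \<le> 6" using length_filter_le[of "\<lambda>i. i \<noteq> a \<and> i \<noteq> z" "[0..<6]"] by simp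
  have T0: "?T i = 0 \<longleftrightarrow> \<kappa> \<notin> cols \<sigma> (vtx (p e) fs i)" if "i < 6" for i
    using tab_zero[OF rep vtx_less[of i] k] that len by simp
  have S0: "(\<Sum>i\<leftarrow>?is. ?T i) = 0 \<longleftrightarrow> (\<forall>i<6. i \<noteq> a \<longrightarrow> i \<noteq> z \<longrightarrow> \<kappa> \<notin> cols \<sigma> (vtx (p e) fs i))"
    using T0 by (auto simp: sum_list_eq_0_iff)
  have T1: "0 < ?T a \<longleftrightarrow> \<kappa> \<in> cols \<sigma> (vtx (p e) fs a)" using T0[OF assms(1)] by auto
  have ta: "?T a \<le> 2 * m" using tab_bound[OF rep vtx_less[of a] k] assms(1) len by simp
  let ?v = "v(17 := 0)"
  let ?P = "\<lambda>(v', M'). M' = M \<and> regs v' \<and> agree {9,11,12,13,14,24,25,26,27} v v' \<and> v' 17 = (\<Sum>i\<leftarrow>?is. ?T i)"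
  have "wp B (concat (map (\<lambda>i. lookup_code i @ [Add 17 17 19]) ?is)) 36 ?P (?v, M)"
  proof (rule wp_mono[OF wp_lookups])
    have "2 * m * length ?is \<le> 2 * m * 6" by (rule mult_left_mono[OF il]) simp
    also have "\<dots> \<le> 20 * m" by simp
    finally show "?v 17 + 2 * m * length ?is \<le> 20 * m" by simp
  qed (use assms il in \<open>auto simp: regs_def agree_def\<close>)
  then have 1: "wp B ([Const 17 0] @ concat (map (\<lambda>i. lookup_code i @ [Add 17 17 19]) ?is)) 37 ?P (v, M)"
    using B_bound by (simp add: wp_simps)
  show ?thesis unfolding private_code_def
  proof (rule wp_append_le[OF 1])
    fix v' M' assume P: "?P (v', M')"
    then have P': "regs v'" "v' 25 = \<kappa>" "M' = M" using assms(3) by (auto simp: agree_def)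
    show "wp B (lookup_code a @ [If 17 [Const 28 0] [Add 28 19 0]]) 7
      (\<lambda>(v', M'). M' = M \<and> regs v' \<and> agree {9,11,12,13,14,24,25,26,27} v v' \<and>
       (v' 28 \<noteq> 0 \<longleftrightarrow> \<kappa> \<in> cols \<sigma> (vtx (p e) fs a) \<and> (\<forall>i<6. i \<noteq> a \<longrightarrow> i \<noteq> z \<longrightarrow> \<kappa> \<notin> cols \<sigma> (vtx (p e) fs i)))) (v', M')"
      unfolding P'(3)
    proof (rule wp_append_le[OF wp_lookup[OF assms(1) P'(1,2)]])
      fix v1 M1 assume v1: "(v1, M1) = (v'(19 := ?T a), M)"
      have s: "v' 17 = (\<Sum>i\<leftarrow>?is. ?T i)" using P by simp
      show "wp B [If 17 [Const 28 0] [Add 28 19 0]] 2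
      (\<lambda>(v', M'). M' = M \<and> regs v' \<and> agree {9,11,12,13,14,24,25,26,27} v v' \<and>
       (v' 28 \<noteq> 0 \<longleftrightarrow> \<kappa> \<in> cols \<sigma> (vtx (p e) fs a) \<and> (\<forall>i<6. i \<noteq> a \<longrightarrow> i \<noteq> z \<longrightarrow> \<kappa> \<notin> cols \<sigma> (vtx (p e) fs i)))) (v1, M1)"
      proof (cases "v' 17 = 0")
        case True
        then show ?thesis
          using v1 P T1 S0[folded s] ta B_bound by (simp add: wp_simps regs_def agree_def)
      next
        case False
        then show ?thesis
          using v1 P S0[folded s] B_bound by (simp add: wp_simps regs_def agree_def)
      qed
    qed simp
  qed simp
qed

lemma wp_test:
  assumes v: "regs v" "v 25 = \<kappa>" "v 24 = j" and j: "j < 5"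
  shows "wp B check_code 60 (\<lambda>(v', M'). M' = M \<and> regs v' \<and> agree {9,11,12,13,14,24,25,26,27} v v' \<and>
     (v' 28 \<noteq> 0 \<longleftrightarrow> \<kappa> \<in> priv \<sigma> (vtx (p e) fs) j)) (v, M)"
proof -
  define P where "P = (\<lambda>(v', M'). M' = M \<and> regs v' \<and> agree {9,11,12,13,14,24,25,26,27} v v' \<and>
     (v' 28 \<noteq> 0 \<longleftrightarrow> \<kappa> \<in> priv \<sigma> (vtx (p e) fs) j))"
  have blk: "wp B (private_code a z) s P (v', M)"
    if "a = priv_pos j" "z = mid_pos j" "regs v'" "agree {9,11,12,13,14,24,25,26,27} v v'" "44 \<le> s" for a z v' s
  proof (rule wp_mono[OF wp_private[of a v' z] that(5)])
    show "a < 6" using that(1) j by (simp add: priv_pos_def)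
    show "regs v'" "v' 25 = \<kappa>" using that(3,4) v by (auto simp: agree_def)
  qed (use that k in \<open>auto simp: priv_def agree_def P_def\<close>)
  have "j = 0 \<or> j = 1 \<or> j = 2 \<or> j = 3 \<or> j = 4" using j by auto
  moreover have "regs (v(29 := x))" "agree {9,11,12,13,14,24,25,26,27} v (v(29 := x))" "agree {9,11,12,13,14,24,25,26,27} v v" for x
    using v by (auto simp: regs_def agree_def)
  moreover have "v 3 = 1" using v by (simp add: regs_def)
  ultimately show ?thesis
    unfolding check_code_def P_def[symmetric] using v B_bound
    by (elim disjE) (simp_all add: wp_simps blk priv_pos_def mid_pos_def)
qed

end

text \<open>By properness no other edge owns the two table entries that are cleared.\<close>

lemma rep_erase:
  assumes rep: "rep \<tau> M" and pr: "proper \<tau>" and g: "g < m" "\<tau> g = Some \<kappa>" and k: "\<kappa> < q"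
  shows "rep (\<tau>(g := None)) (M(row (p g) + \<kappa> := 0, row (r g) + \<kappa> := 0, 3 * m + (2 * g + 1) := 0))"
proof -
  define M' where "M' = M(row (p g) + \<kappa> := 0, row (r g) + \<kappa> := 0, 3 * m + (2 * g + 1) := 0)"
  have low: "M' a = M a" if "a < 3 * m \<or> a = 5 * m + 1" for a
    using that g by (auto simp: M'_def row_def)
  have 1: "M' (2 * j) = row (p j) \<and> M' (2 * j + 1) = row (r j)" if "j < m" for j
    using that repD(1,2)[OF rep that] by (simp add: low)
  have 2: "M' (3 * m + (2 * j + 1)) = flag (\<tau>(g := None)) j" if "j < m" for j
    using that g repD(3)[OF rep that] by (auto simp: M'_def row_def flag_def)
  have 3: "M' (5 * m + 1) = 0" using repD(4)[OF rep] by (simp add: low)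
  have 4: "M' (2 * m + j) = \<mu>" if "j < m" "(\<tau>(g := None)) j = Some \<mu>" for j \<mu>
    using that repD(5)[OF rep, of j \<mu>] by (auto simp: low split: if_splits)
  have cols: "\<mu> \<in> cols \<tau> x \<Longrightarrow> \<not> (x \<in> ends g \<and> \<mu> = \<kappa>) \<Longrightarrow> \<mu> \<in> cols (\<tau>(g := None)) x" for \<mu> x
  proof -
    assume mu: "\<mu> \<in> cols \<tau> x" "\<not> (x \<in> ends g \<and> \<mu> = \<kappa>)"
    then obtain i where i: "i < m" "\<tau> i = Some \<mu>" "x \<in> ends i" by (auto simp: cols_def)
    then have "i \<noteq> g" using mu(2) g by auto
    then show ?thesis using i by (auto simp: cols_def intro!: exI[of _ i])
  qed
  have tab: "M' (row x + \<mu>) = (if x \<in> ends g \<and> \<mu> = \<kappa> then 0 else M (row x + \<mu>))" if "x < n" "\<mu> < q" for x \<mu>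
  proof -
    have "row x + \<mu> \<noteq> 3 * m + (2 * g + 1)" using g by (simp add: row_def)
    then show ?thesis using row_inj[OF that(2) k] by (auto simp: M'_def ends_def)
  qed
  have 5: "M' (row x + \<mu>) = 0" if "x < n" "\<mu> < q" "\<mu> \<notin> cols (\<tau>(g := None)) x" for x \<mu>
    using that tab[OF that(1,2)] repD(6)[OF rep that(1,2)] cols[of \<mu> x] by auto
  have 6: "M' (row x + \<mu>) = 2 * j + 1" if "x < n" "\<mu> < q" "j < m" "(\<tau>(g := None)) j = Some \<mu>" "x \<in> ends j" for x \<mu> j
  proof -
    have s: "j \<noteq> g" "\<tau> j = Some \<mu>" using that(4) by (auto split: if_splits)
    have "\<not> (x \<in> ends g \<and> \<mu> = \<kappa>)"
      using properD[OF pr that(3) g(1) s(2)] g(2) that(5) s(1) by auto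
    then show ?thesis using tab[OF that(1,2)] repD(7)[OF rep that(1,2,3) s(2) that(5)] by auto
  qed
  have "rep (\<tau>(g := None)) M'" unfolding rep_def using 1 2 3 4 5 6 by blast
  then show ?thesis by (simp add: M'_def)
qed

lemma wp_erase:
  assumes v: "regs v" and g: "g < m" and k: "k < m" and a: "a < q"
    and M: "M (5 * m + 2 + k) = 2 * g + 1" "M (2 * g) = row (p g)" "M (2 * g + 1) = row (r g)"
    and vv: "v 23 = k" "v 20 = a"
  shows "wp B erase_code 11 (\<lambda>(v', M'). regs v' \<and> M' = M(row (p g) + a := 0, row (r g) + a := 0, 3 * m + (2 * g + 1) := 0)
     \<and> agree {11,14,16,20,21,23,24,26} v v') (v, M)"
proof -
  have rb: "2 * (row (p g) + a) + 6 * m + 30 \<le> B" "2 * (row (r g) + a) + 6 * m + 30 \<le> B"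
    using row_bound[of "p g" a] row_bound[of "r g" a] vert[OF g(1)] a by auto
  have ne: "2 * g + 1 \<noteq> row (p g) + a" using g by (simp add: row_def)
  show ?thesis unfolding erase_code_def
    using v vv M ne rb B_bound g k a by (simp add: wp_simps regs_def agree_def)
qed

lemma wp_uncolor:
  assumes lc: "long_cycle \<sigma> e c d fs" and pc: "\<sigma> \<in> pcolorings" and rep: "rep \<sigma> M" and cq: "c < q"
    and st: "stored (p e) fs (length fs) M" and j: "j < 5"
    and v: "regs v" "v 24 = j" "v 26 = d" "v 11 = c" "v 14 = length fs"
  shows "wp B uncolor_code (22 * length fs + 8) (\<lambda>(v', M'). regs v' \<and> rep (uncolor \<sigma> fs j) M') (v, M)"
proof -
  note F = long_cycleD[OF lc]
  let ?L = "length fs"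
  have lm: "?L \<le> m"
    using altpath_length(1)[of \<sigma> d c "p e" fs] lc by (auto simp: long_cycle_def free_def)
  have kept: "kept j \<le> 3" by (simp add: kept_def)
  have dq: "d < q"
  proof -
    have "0 < ?L" using F(9) by linarith
    then have "\<sigma> (fs ! 0) = Some d" using F(12) by simp
    then show ?thesis using pc by (auto simp: pcolorings_def ran_def)
  qed
  \<comment> \<open>The edges erased in the first \<open>k\<close> iterations;
    \<open>\<tau> k\<close> is the coloring that the memory represents at that moment.\<close>
  define G where "G k = {fs ! l |l. l < k \<and> (l < kept j \<or> kept j + 2 \<le> l)}" for k
  define \<tau> where "\<tau> k = \<sigma> |` (- G k)" for k
  have G_Suc: "G (Suc k) = (if k < kept j \<or> kept j + 2 \<le> k then insert (fs ! k) (G k) else G k)" for k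
    unfolding G_def by (auto simp: less_Suc_eq)
  have tau_Suc: "\<tau> (Suc k) = (if k < kept j \<or> kept j + 2 \<le> k then (\<tau> k)(fs ! k := None) else \<tau> k)" for k
    unfolding \<tau>_def G_Suc by (auto simp: restrict_map_def fun_eq_iff)
  have tau_nth: "\<tau> k (fs ! k) = Some (if even k then d else c)" if "k < ?L" for k
  proof -
    have "fs ! k \<notin> G k" using nth_eq_iff_index_eq[OF F(10)] that by (auto simp: G_def)
    then show ?thesis using F(12)[OF that] by (simp add: \<tau>_def)
  qed
  have tau_pr: "proper (\<tau> k)" for k
    by (rule proper_mono[OF F(1)]) (auto simp: \<tau>_def map_le_def)
  have G_L: "G ?L = gone fs j"
  proof (rule set_eqI)
    fix x
    have "x \<in> G ?L \<longleftrightarrow> (\<exists>l<?L. x = fs ! l \<and> fs ! l \<in> gone fs j)"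
      using gone_nth[OF F(10)] by (auto simp: G_def)
    also have "\<dots> \<longleftrightarrow> x \<in> gone fs j"
    proof -
      have "x \<in> set fs" if "x \<in> gone fs j" using that by (auto simp: gone_def dest: in_set_takeD in_set_dropD)
      then show ?thesis by (metis in_set_conv_nth)
    qed
    finally show "x \<in> G ?L \<longleftrightarrow> x \<in> gone fs j" .
  qed
  let ?ca = "\<lambda>k. if even k then d else c" and ?cb = "\<lambda>k. if even k then c else d"
  let ?I = "\<lambda>k (v', M'). regs v' \<and> rep (\<tau> k) M' \<and> stored (p e) fs ?L M' \<and> v' 23 = k \<and> v' 16 = ?L - k \<and>
     v' 20 = ?ca k \<and> v' 21 = ?cb k \<and> v' 24 = kept j"
  let ?pre = "[Sub 17 24 23, Sub 18 23 24, Sub 18 18 3, Add 17 17 18, If 17 erase_code []]"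
  let ?post = "[Add 18 20 0, Add 20 21 0, Add 21 18 0, Add 23 23 3, Sub 16 16 3]"
  have init: "wp B [Const 17 3, Sub 18 24 17, Sub 24 24 18, Add 20 26 0, Add 21 11 0, Const 23 0, Add 16 14 0] 7 (?I 0) (v, M)"
  proof -
    have "\<tau> 0 = \<sigma>" by (simp add: \<tau>_def G_def restrict_map_def)
    moreover have "j - (j - 3) = kept j" by (simp add: kept_def)
    ultimately show ?thesis using v rep st j cq dq lm B_bound by (simp add: wp_simps regs_def)
  qed
  have loop: "wp B [While 16 (?pre @ ?post)] (?L * (21 + 1) + 1) (?I ?L) st'" if "?I 0 st'" for st'
  proof (rule wp_While_const[where I = ?I, OF that])
    fix k v' M' assume k: "k < ?L" and I: "?I k (v', M')"
    let ?g = "fs ! k"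
    let ?J = "\<lambda>(v1, M1). regs v1 \<and> rep (\<tau> (Suc k)) M1 \<and> stored (p e) fs ?L M1 \<and> v1 23 = k \<and> v1 16 = ?L - k \<and>
     v1 20 = ?ca k \<and> v1 21 = ?cb k \<and> v1 24 = kept j"
    have g: "?g < m" using walk_nth(1)[OF F(6) k] .
    have rM: "rep (\<tau> k) M'" and sM: "stored (p e) fs ?L M'" using I by auto
    have pre: "wp B ?pre 16 ?J (v', M')"
    proof (cases "k < kept j \<or> kept j + 2 \<le> k")
      case False
      then have "kept j - k = 0" "k - kept j - 1 = 0" by linarith+
      then show ?thesis using I tau_Suc[of k] False B_bound lm k kept by (simp add: wp_simps regs_def)
    next
      case True
      let ?M = "M'(row (p ?g) + ?ca k := 0, row (r ?g) + ?ca k := 0, 3 * m + (2 * ?g + 1) := 0)"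
      have s: "kept j - k + (k - kept j - 1) \<noteq> 0" using True by linarith
      have r1: "rep (\<tau> (Suc k)) ?M"
        using rep_erase[OF rM tau_pr g tau_nth[OF k]] tau_Suc[of k] True cq dq by simp
      have s1: "stored (p e) fs ?L ?M"
        using sM g lm unfolding stored_def by (auto simp: row_def)
      have er: "wp B erase_code 11 ?J (v1, M')" if v1: "regs v1" "agree {11,14,16,20,21,23,24,26} v' v1" for v1
      proof (rule wp_mono[OF wp_erase[of v1 ?g k "?ca k" M']])
        show "k < m" using k lm by simp
        show "M' (5 * m + 2 + k) = 2 * ?g + 1" using sM k by (simp add: stored_def)
        show "M' (2 * ?g) = row (p ?g)" "M' (2 * ?g + 1) = row (r ?g)" using repD(1,2)[OF rM g] by auto
        fix st' assume P: "case st' of (v'', M'') \<Rightarrow> regs v'' \<and> M'' = ?M \<and> agree {11,14,16,20,21,23,24,26} v1 v''"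
        obtain v2 M2 where st': "st' = (v2, M2)" by fastforce
        have "regs v2" "M2 = ?M" "agree {11,14,16,20,21,23,24,26} v1 v2" using P by (simp_all add: st')
        then show "?J st'" using r1 s1 v1(2) I unfolding st' by (simp add: agree_def)
      qed (use v1 I cq dq g in \<open>auto simp: agree_def\<close>)
      have "regs (v'(17 := x, 18 := y))" "agree {11,14,16,20,21,23,24,26} v' (v'(17 := x, 18 := y))"
        "regs (v'(18 := y, 17 := x))" "agree {11,14,16,20,21,23,24,26} v' (v'(18 := y, 17 := x))" for x y
        using I by (auto simp: regs_def agree_def)
      note er' = er[OF this(1,2)] er[OF this(3,4)]
      have v3: "v' 3 = 1" "v' 23 = k" "v' 24 = kept j" using I by (auto simp: regs_def)
      show ?thesis
        using er' s v3 B_bound lm k kept by (simp add: wp_simps)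
    qed
    have "wp B (?pre @ ?post) 21 (?I (Suc k)) (v', M')"
    proof (rule wp_append_le[OF pre])
      fix v1 M1 assume "?J (v1, M1)"
      then show "wp B ?post 5 (?I (Suc k)) (v1, M1)"
        using k lm cq dq B_bound by (simp add: wp_simps regs_def)
    qed simp
    then show "v' 16 \<noteq> 0 \<and> wp B (?pre @ ?post) 21 (?I (Suc k)) (v', M')" using I k by simp
  qed auto
  have "wp B uncolor_code (7 + (?L * (21 + 1) + 1)) (?I ?L) (v, M)"
    unfolding uncolor_code_def by (rule wp_seq[OF init], rule loop)
  moreover have "\<tau> ?L = uncolor \<sigma> fs j" by (simp add: \<tau>_def uncolor_gone G_L)
  ultimately show ?thesis by (auto elim!: wp_mono)
qed

end

section \<open>One round of the program\<close>

definition recolor_code :: "instr list" where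
  "recolor_code = [Const 17 5, Rand 24 17, Rand 25 2] @ check_code @
     [If 28 [Const 17 5, Rand 24 17] []] @ uncolor_code"

definition update_code :: "instr list" where
  "update_code = detect_code @ [If 14 [Const 17 3, Sub 17 14 17, If 17 recolor_code []] color_code]"

definition round_code :: "instr list" where
  "round_code = [Sub 17 9 3, Load 12 17, Load 13 9] @ [Rand 11 2] @
     [Add 17 12 11, Load 17 17, Add 18 13 11, Load 18 18, Add 17 17 18] @ [If 17 [] update_code] @ scan_code"

context coloring_instance begin

text \<open>The averages are affine in \<open>F\<close>, so the success probabilities
  \<open>1 - fail N \<sigma>\<close>, which \<open>val\<close> bounds from below, obey the same
  recursion as \<open>fail\<close>.\<close>

lemma cycle_avg_compl:
  assumes "0 < q"
  shows "cycle_avg (\<lambda>\<sigma>. 1 - F \<sigma>) \<sigma> e fs = 1 - cycle_avg F \<sigma> e fs"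
proof -
  let ?A = "(\<Sum>j<5. F (uncolor \<sigma> fs j)) / 5"
  have 1: "(\<Sum>j<5. 1 - F (uncolor \<sigma> fs j)) / 5 = 1 - ?A" by (simp add: sum_subtractf diff_divide_distrib)
  have 2: "(\<Sum>\<kappa><q. if \<kappa> \<in> X then 1 - ?A else 1 - b) / real q = 1 - (\<Sum>\<kappa><q. if \<kappa> \<in> X then ?A else b) / q" for X b
  proof -
    have "(\<Sum>\<kappa><q. if \<kappa> \<in> X then 1 - ?A else 1 - b) = (\<Sum>\<kappa><q. 1 - (if \<kappa> \<in> X then ?A else b))"
      by (intro sum.cong) auto
    then show ?thesis using assms by (simp add: sum_subtractf diff_divide_distrib)
  qed
  show ?thesis unfolding cycle_avg_def 1 2 by (simp add: sum_subtractf diff_divide_distrib)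
qed

lemma color_avg_compl: "0 < q \<Longrightarrow> color_avg (\<lambda>\<sigma>. 1 - F \<sigma>) \<sigma> e c = 1 - color_avg F \<sigma> e c"
  by (auto simp: color_avg_def cycle_avg_compl split: option.split)

end

context coloring_machine begin

definition detect_time :: nat where
  "detect_time = 4 + 14 * m + (D + 1) * (16 * min n m + 13)"

context
  fixes G :: "config set" and t :: nat and w :: "(nat \<Rightarrow> nat option) \<Rightarrow> real" and K :: "instr list"
  assumes G: "\<And>cfg. cfg \<in> G \<Longrightarrow> fst cfg = []"
    and w: "\<And>\<tau> v M. good \<tau> \<Longrightarrow> rep \<tau> M \<Longrightarrow> regs v \<Longrightarrow> w \<tau> \<le> val B G t (K, v, M)"
begin

lemma val_le: "x \<le> val B G s cfg \<Longrightarrow> s \<le> s' \<Longrightarrow> x \<le> val B G s' cfg"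
  by (rule order_trans[OF _ val_mono[OF G]])

lemma val_wp_le:
  assumes "wp B P s R st" "\<And>v M. R (v, M) \<Longrightarrow> x \<le> val B G t' (rest, v, M)" "s + t' \<le> s'"
  shows "x \<le> val B G s' (P @ rest, st)"
  by (rule val_le[OF val_wp[OF G assms(1)] assms(3)]) (use assms(2) in auto)

lemma good_pcolorings: "good \<sigma> \<Longrightarrow> \<sigma> \<in> pcolorings \<and> proper \<sigma>"
  by (simp add: good_def pcolorings_def)

text \<open>\<open>w \<tau>\<close> is a lower bound for what the continuation \<open>K\<close>
  achieves from any memory that represents \<open>\<tau>\<close>. Each execution of
  \<open>Rand\<close> becomes one of the nested means in \<open>cycle_avg\<close>.\<close>

lemma val_recolor:
  assumes good: "good \<sigma>" and lc: "long_cycle \<sigma> e c d fs" and rep: "rep \<sigma> M" and cq: "c < q"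
    and st: "stored (p e) fs (length fs) M"
    and v: "regs v" "v 26 = d" "v 11 = c" "v 14 = length fs"
  shows "cycle_avg w \<sigma> e fs \<le> val B G (22 * m + 80 + t) (recolor_code @ K, v, M)"
proof -
  note F = long_cycleD[OF lc]
  have lm: "length fs \<le> m"
    using altpath_length(1)[of \<sigma> d c "p e" fs] lc by (auto simp: long_cycle_def free_def)
  have pc: "\<sigma> \<in> pcolorings" using good by (simp add: good_def)
  have uncolor: "w (uncolor \<sigma> fs j) \<le> val B G (22 * m + 8 + t) (uncolor_code @ K, v', M)"
    if "j < 5" "regs v'" "v' 24 = j" "agree {11, 14, 26} v v'" for j v'
  proof (rule val_wp_le[where t' = t, OF wp_uncolor[OF lc pc rep cq st that(1,2,3)]])
    show "v' 26 = d" "v' 11 = c" "v' 14 = length fs" using that(4) v by (auto simp: agree_def)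
  qed (use w good_uncolor[OF good] lm in auto)
  let ?A = "(\<Sum>j<5. w (uncolor \<sigma> fs j)) / 5"
  have pick: "(if \<kappa> \<in> priv \<sigma> (vtx (p e) fs) j then ?A else w (uncolor \<sigma> fs j)) \<le>
    val B G (22 * m + 75 + t) (check_code @ [If 28 [Const 17 5, Rand 24 17] []] @ uncolor_code @ K, v', M)"
    if j: "j < 5" and k: "\<kappa> < q" and v': "regs v'" "v' 24 = j" "v' 25 = \<kappa>" "agree {11, 14, 26} v v'" for j \<kappa> v'
  proof (rule val_wp_le[OF wp_test[OF rep F(2) st F(9) lm F(6) k v'(1,3,2) j]])
    fix v1 M1
    assume "case (v1, M1) of (v'', M') \<Rightarrow> M' = M \<and> regs v'' \<and> agree {9, 11, 12, 13, 14, 24, 25, 26, 27} v' v'' \<and>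
       (v'' 28 \<noteq> 0) = (\<kappa> \<in> priv \<sigma> (vtx (p e) fs) j)"
    then have v1: "M1 = M" "regs v1" "agree {9, 11, 12, 13, 14, 24, 25, 26, 27} v' v1"
      "(v1 28 \<noteq> 0) = (\<kappa> \<in> priv \<sigma> (vtx (p e) fs) j)" by auto
    have s1: "agree {11, 14, 26} v v1" using v1(3) v'(4) by (auto simp: agree_def)
    have "(if \<kappa> \<in> priv \<sigma> (vtx (p e) fs) j then ?A else w (uncolor \<sigma> fs j)) \<le>
      val B G (Suc (22 * m + 11 + t)) (If 28 [Const 17 5, Rand 24 17] [] # (uncolor_code @ K), v1, M)"
    proof (rule val_If)
      assume "v1 28 \<noteq> 0"
      then have q: "\<kappa> \<in> priv \<sigma> (vtx (p e) fs) j" using v1(4) by simp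
      let ?v = "v1(17 := 5)"
      have "?A \<le> val B G (Suc (22 * m + 8 + t)) (Rand 24 17 # (uncolor_code @ K), ?v, M)"
      proof -
        have "(\<Sum>a<5. w (uncolor \<sigma> fs a)) / real 5 \<le> val B G (Suc (22 * m + 8 + t)) (Rand 24 17 # (uncolor_code @ K), ?v, M)"
          by (rule val_Rand) (use uncolor v1(2) s1 B_bound in \<open>auto simp: regs_def agree_def\<close>)
        then show ?thesis by simp
      qed
      then have "?A \<le> val B G (22 * m + 11 + t) ([Const 17 5] @ (Rand 24 17 # (uncolor_code @ K)), v1, M)"
        by (intro val_wp_le[where t' = "Suc (22 * m + 8 + t)" and P = "[Const 17 5]" and s = 1 and R = "\<lambda>st. st = (?v, M)"]) (use B_bound in \<open>auto simp: wp_simps\<close>)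
      then show "(if \<kappa> \<in> priv \<sigma> (vtx (p e) fs) j then ?A else w (uncolor \<sigma> fs j)) \<le>
        val B G (22 * m + 11 + t) ([Const 17 5, Rand 24 17] @ (uncolor_code @ K), v1, M)" using q by simp
    next
      assume "v1 28 = 0"
      then have q: "\<kappa> \<notin> priv \<sigma> (vtx (p e) fs) j" using v1(4) by simp
      have "v1 24 = j" using v1(3) v'(2) by (simp add: agree_def)
      then have "w (uncolor \<sigma> fs j) \<le> val B G (22 * m + 8 + t) (uncolor_code @ K, v1, M)"
        using uncolor[OF j v1(2) _ s1] by simp
      then show "(if \<kappa> \<in> priv \<sigma> (vtx (p e) fs) j then ?A else w (uncolor \<sigma> fs j)) \<le>
        val B G (22 * m + 11 + t) ([] @ (uncolor_code @ K), v1, M)" using q by (auto intro: val_le)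
    qed
    then show "(if \<kappa> \<in> priv \<sigma> (vtx (p e) fs) j then ?A else w (uncolor \<sigma> fs j)) \<le>
      val B G (22 * m + 15 + t) ([If 28 [Const 17 5, Rand 24 17] []] @ uncolor_code @ K, v1, M1)"
      unfolding v1(1) append_Cons append_Nil by (rule val_le) simp
  qed simp
  have q: "0 < q" using cq by simp
  let ?rest = "check_code @ [If 28 [Const 17 5, Rand 24 17] []] @ uncolor_code @ K"
  have r2: "(\<Sum>\<kappa><q. if \<kappa> \<in> priv \<sigma> (vtx (p e) fs) j then ?A else w (uncolor \<sigma> fs j)) / real q
     \<le> val B G (Suc (22 * m + 75 + t)) (Rand 25 2 # ?rest, v', M)"
    if "j < 5" "regs v'" "v' 24 = j" "agree {11, 14, 26} v v'" for j v'
    by (rule val_Rand) (use pick that q B_bound in \<open>auto simp: regs_def agree_def\<close>)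
  let ?v = "v(17 := 5)"
  have "(\<Sum>j<5. (\<Sum>\<kappa><q. if \<kappa> \<in> priv \<sigma> (vtx (p e) fs) j then ?A else w (uncolor \<sigma> fs j)) / real q) / real 5
     \<le> val B G (Suc (Suc (22 * m + 75 + t))) (Rand 24 17 # (Rand 25 2 # ?rest), ?v, M)"
    by (rule val_Rand) (use r2 v B_bound in \<open>auto simp: regs_def agree_def\<close>)
  then have "cycle_avg w \<sigma> e fs \<le> val B G (Suc (Suc (22 * m + 75 + t))) (Rand 24 17 # (Rand 25 2 # ?rest), ?v, M)"
    by (simp add: cycle_avg_def)
  then have "cycle_avg w \<sigma> e fs \<le> val B G (22 * m + 80 + t) ([Const 17 5] @ (Rand 24 17 # (Rand 25 2 # ?rest)), v, M)"
    by (intro val_wp_le[where t' = "Suc (Suc (22 * m + 75 + t))" and P = "[Const 17 5]" and s = 1 and R = "\<lambda>st. st = (?v, M)"]) (use B_bound in \<open>auto simp: wp_simps\<close>)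
  then show ?thesis by (simp add: recolor_code_def)
qed

lemma val_update:
  assumes good: "good \<sigma>" and rep: "rep \<sigma> M" and e: "e < m" "\<sigma> e = None" and cq: "c < q" and free: "free \<sigma> e c"
    and v: "regs v" "v 9 = 2 * e + 1" "v 27 = 2 * m + e" "v 11 = c" "v 12 = row (p e)" "v 13 = row (r e)"
  shows "color_avg w \<sigma> e c \<le> val B G (detect_time + (22 * m + 85) + t) (update_code @ K, v, M)"
proof -
  have pc: "\<sigma> \<in> pcolorings" "proper \<sigma>" using good_pcolorings[OF good] by auto
  have "color_avg w \<sigma> e c \<le> val B G (detect_time + (22 * m + 85 + t)) (detect_code @
      (If 14 [Const 17 3, Sub 17 14 17, If 17 recolor_code []] color_code # K), v, M)"
  proof (rule val_wp_le[OF wp_detect[OF rep pc(1) v(1) e(1) free cq v(4,5,6)]])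
    fix v1 M1
    assume "case (v1, M1) of (v', M') \<Rightarrow> regs v' \<and> rep \<sigma> M' \<and> agree {9, 10, 11, 12, 13, 27} v v' \<and>
         (case closing \<sigma> c e of None \<Rightarrow> v' 14 = 0
          | Some fs \<Rightarrow> fs \<noteq> [] \<and> v' 14 = length fs \<and> stored (p e) fs (length fs) M' \<and> \<sigma> (hd fs) = Some (v' 26))"
    then have v1: "regs v1" "rep \<sigma> M1" "agree {9, 10, 11, 12, 13, 27} v v1"
      and det: "case closing \<sigma> c e of None \<Rightarrow> v1 14 = 0
          | Some fs \<Rightarrow> fs \<noteq> [] \<and> v1 14 = length fs \<and> stored (p e) fs (length fs) M1 \<and> \<sigma> (hd fs) = Some (v1 26)"
      by auto
    have vv: "v1 9 = 2 * e + 1" "v1 27 = 2 * m + e" "v1 11 = c" "v1 12 = row (p e)" "v1 13 = row (r e)"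
      using v1(3) v by (auto simp: agree_def)
    show "color_avg w \<sigma> e c \<le> val B G (22 * m + 85 + t) (If 14 [Const 17 3, Sub 17 14 17, If 17 recolor_code []] color_code # K, v1, M1)"
    proof (cases "closing \<sigma> c e")
      case None
      have g: "good (\<sigma>(e \<mapsto> c))" by (rule good_insert[OF good e free None cq])
      have "w (\<sigma>(e \<mapsto> c)) \<le> val B G (22 * m + 84 + t) (color_code @ K, v1, M1)"
        by (rule val_wp_le[where t' = t, OF wp_color[OF v1(2) pc(1) v1(1) e cq free vv]]) (use w g in auto)
      then have "w (\<sigma>(e \<mapsto> c)) \<le> val B G (Suc (22 * m + 84 + t)) (If 14 [Const 17 3, Sub 17 14 17, If 17 recolor_code []] color_code # K, v1, M1)"
        by (intro val_If) (use det None in auto)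
      then show ?thesis using free None by (auto simp: color_avg_def intro: val_le)
    next
      case (Some fs)
      have d: "fs \<noteq> []" "v1 14 = length fs" "stored (p e) fs (length fs) M1" "\<sigma> (hd fs) = Some (v1 26)"
        using det Some by auto
      have cl: "closes \<sigma> c e fs" by (rule closing_Some[OF pc(2) free Some])
      have lm: "length fs \<le> m"
      proof -
        obtain a where "a \<noteq> c" "altpath \<sigma> a c (p e) fs" using cl unfolding closes_def by blast
        then show ?thesis using altpath_length(1)[OF pc(2)] free by (auto simp: free_def)
      qed
      let ?v = "v1(17 := length fs - 3)"
      have rv: "regs ?v" using v1(1) by (auto simp: regs_def)
      have pre: "wp B [Const 17 3, Sub 17 14 17] 2 (\<lambda>st. st = (?v, M1)) (v1, M1)"
        using d lm B_bound by (simp add: wp_simps)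
      have "color_avg w \<sigma> e c \<le> val B G (Suc (22 * m + 80 + t)) (If 17 recolor_code [] # K, ?v, M1)"
      proof (rule val_If)
        assume "?v 17 \<noteq> 0"
        then have l3: "3 < length fs" by simp
        obtain d' where lc: "long_cycle \<sigma> e c d' fs" using long_cycleI[OF pc(2) e free Some l3] by blast
        \<comment> \<open>\<open>long_cycleI\<close> yields some second color \<open>d'\<close>; the
          color stored in register \<open>26\<close> is the same, both being the color of the first
          path edge.\<close>
        have "\<sigma> (hd fs) = Some d'" using long_cycleD(12)[OF lc, of 0] d(1) by (simp add: hd_conv_nth)
        then have d': "?v 26 = d'" using d(4) by simp
        have "cycle_avg w \<sigma> e fs \<le> val B G (22 * m + 80 + t) (recolor_code @ K, ?v, M1)"
          by (rule val_recolor[OF good lc v1(2) cq d(3) rv d']) (use vv d in auto)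
        then show "color_avg w \<sigma> e c \<le> val B G (22 * m + 80 + t) (recolor_code @ K, ?v, M1)"
          using free Some l3 by (simp add: color_avg_def)
      next
        assume "?v 17 = 0"
        then have l3: "length fs \<le> 3" by simp
        have "w \<sigma> \<le> val B G (22 * m + 80 + t) ([] @ K, ?v, M1)"
          using val_le[OF w[OF good v1(2) rv]] by simp
        then show "color_avg w \<sigma> e c \<le> val B G (22 * m + 80 + t) ([] @ K, ?v, M1)"
          using free Some l3 by (simp add: color_avg_def)
      qed
      then have "color_avg w \<sigma> e c \<le> val B G (22 * m + 84 + t) ([Const 17 3, Sub 17 14 17] @ (If 17 recolor_code [] # K), v1, M1)"
        by (intro val_wp_le[where t' = "Suc (22 * m + 80 + t)", OF pre]) auto
      then have "color_avg w \<sigma> e c \<le> val B G (Suc (22 * m + 84 + t)) (If 14 [Const 17 3, Sub 17 14 17, If 17 recolor_code []] color_code # K, v1, M1)"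
        by (intro val_If) (use d in auto)
      then show ?thesis by (rule val_le) simp
    qed
  qed (simp add: detect_time_def)
  then show ?thesis by (simp add: update_code_def add.assoc)
qed

end

definition round_time :: nat where
  "round_time = detect_time + 27 * m + 110"

lemma val_round:
  assumes G: "\<And>cfg. cfg \<in> G \<Longrightarrow> fst cfg = []"
    and w: "\<And>\<tau> v M. good \<tau> \<Longrightarrow> rep \<tau> M \<Longrightarrow> scanned \<tau> v \<Longrightarrow> w \<tau> \<le> val B G t ([While 10 round_code], v, M)"
    and good: "good \<sigma>" and rep: "rep \<sigma> M" and v: "scanned \<sigma> v" and e: "first \<sigma> < m"
  shows "(\<Sum>c<q. color_avg w \<sigma> (first \<sigma>) c) / q \<le> val B G (round_time + t) ([While 10 round_code], v, M)"
proof -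
  let ?W = "[While 10 round_code]" and ?e = "first \<sigma>"
  let ?K = "scan_code @ ?W"
  have pc: "\<sigma> \<in> pcolorings" using good by (simp add: good_def)
  have eN: "\<sigma> ?e = None" by (rule first_props(3)[OF e])
  have q: "0 < q" using colors e by fastforce
  have K: "w \<tau> \<le> val B G (5 * m + 10 + t) (?K, v', M')" if "good \<tau>" "rep \<tau> M'" "regs v'" for \<tau> v' M'
  proof (rule val_wp[OF G wp_scan[OF that(2) _ that(3)]])
    show "\<tau> \<in> pcolorings" using that(1) by (simp add: good_def)
  qed (use w that in auto)
  let ?pre = "[Sub 17 9 3, Load 12 17, Load 13 9]"
  let ?chk = "[Add 17 12 11, Load 17 17, Add 18 13 11, Load 18 18, Add 17 17 18]"
  let ?v1 = "v(17 := 2 * ?e, 12 := row (p ?e), 13 := row (r ?e))"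
  have vn: "p ?e < n" "r ?e < n" using vert[OF e] by auto
  have pre: "wp B ?pre 3 (\<lambda>st. st = (?v1, M)) (v, M)"
    using v repD(1,2)[OF rep e] e B_bound row_bound[OF vn(1), of 0] row_bound[OF vn(2), of 0]
    by (simp add: wp_simps scanned_def regs_def)
  define t2 where "t2 = detect_time + (22 * m + 85) + (5 * m + 10 + t)"
  have col: "color_avg w \<sigma> ?e c \<le> val B G (6 + t2) (?chk @ (If 17 [] update_code # ?K), ?v1(11 := c), M)"
    if c: "c < q" for c
  proof -
    let ?a = "M (row (p ?e) + c)" and ?b = "M (row (r ?e) + c)"
    let ?v2 = "?v1(11 := c, 17 := ?a + ?b, 18 := ?b)"
    have ab: "?a \<le> 2 * m" "?b \<le> 2 * m" "?a = 0 \<longleftrightarrow> c \<notin> cols \<sigma> (p ?e)" "?b = 0 \<longleftrightarrow> c \<notin> cols \<sigma> (r ?e)"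
      using tab_bound[OF rep vn(1) c] tab_bound[OF rep vn(2) c] tab_zero[OF rep vn(1) c] tab_zero[OF rep vn(2) c] by auto
    have chk: "wp B ?chk 5 (\<lambda>st. st = (?v2, M)) (?v1(11 := c), M)"
      using c ab(1,2) B_bound row_bound[OF vn(1), of c] row_bound[OF vn(2), of c]
      by (simp add: wp_simps fun_upd_twist)
    have r2: "regs ?v2" using v by (auto simp: scanned_def regs_def)
    have "color_avg w \<sigma> ?e c \<le> val B G (Suc t2) (If 17 [] update_code # ?K, ?v2, M)"
    proof (rule val_If)
      assume "?v2 17 \<noteq> 0"
      then have nf: "\<not> free \<sigma> ?e c" using ab(3,4) by (auto simp: free_def)
      have "w \<sigma> \<le> val B G t2 (?K, ?v2, M)"
        by (rule order_trans[OF K[OF good rep r2] val_mono[OF G]]) (simp_all add: t2_def)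
      then show "color_avg w \<sigma> ?e c \<le> val B G t2 ([] @ ?K, ?v2, M)" using nf by (simp add: color_avg_def)
    next
      assume "?v2 17 = 0"
      then have f: "free \<sigma> ?e c" using ab(3,4) by (auto simp: free_def)
      show "color_avg w \<sigma> ?e c \<le> val B G t2 (update_code @ ?K, ?v2, M)"
        unfolding t2_def
        by (rule val_update[OF G K good rep e eN c f r2]) (use v in \<open>auto simp: scanned_def\<close>)
    qed
    then show ?thesis by (intro order_trans[OF val_wp[OF G chk] val_mono[OF G]]) auto
  qed
  have "(\<Sum>c<q. color_avg w \<sigma> ?e c) / q \<le> val B G (Suc (6 + t2)) (Rand 11 2 # (?chk @ (If 17 [] update_code # ?K)), ?v1, M)"
    by (rule val_Rand) (use col q v B_bound in \<open>auto simp: scanned_def regs_def\<close>)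
  then have "(\<Sum>c<q. color_avg w \<sigma> ?e c) / q \<le> val B G (3 + Suc (6 + t2)) (?pre @ (Rand 11 2 # (?chk @ (If 17 [] update_code # ?K))), v, M)"
    by (intro val_wp[OF G pre]) auto
  then have "(\<Sum>c<q. color_avg w \<sigma> ?e c) / q \<le> val B G (3 + Suc (6 + t2)) (round_code @ ?W, v, M)"
    by (simp add: round_code_def)
  then have "(\<Sum>c<q. color_avg w \<sigma> ?e c) / q \<le> val B G (Suc (3 + Suc (6 + t2))) (?W, v, M)"
    by (intro val_While) (use v e in \<open>auto simp: scanned_def\<close>)
  also have "\<dots> \<le> val B G (round_time + t) (?W, v, M)"
    by (rule val_mono[OF G]) (simp_all add: round_time_def t2_def)
  finally show ?thesis .
qed

definition final :: "(nat \<times> nat) list \<Rightarrow> config set" where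
  "final es = {cfg. \<exists>\<phi>. acyclic_edge_coloring {..<n} (ends ` {..<m}) q \<phi> \<and> outputs_coloring es \<phi> cfg}"

text \<open>Besides the \<open>N\<close> rounds one step is reserved for the last evaluation of the
  loop guard.\<close>

lemma val_loop:
  assumes es: "length es = m" "\<And>i. i < m \<Longrightarrow> edge (es ! i) = ends i"
  shows "good \<sigma> \<Longrightarrow> rep \<sigma> M \<Longrightarrow> scanned \<sigma> v \<Longrightarrow>
    1 - fail N \<sigma> \<le> val B (final es) (N * round_time + 1) ([While 10 round_code], v, M)"
proof (induction N arbitrary: \<sigma> v M)
  have G: "\<And>cfg. cfg \<in> final es \<Longrightarrow> fst cfg = []" by (auto simp: final_def outputs_coloring_def)
  have complete: "1 \<le> val B (final es) (k + 1) ([While 10 round_code], v, M)"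
    if s: "good \<sigma>" "rep \<sigma> M" "scanned \<sigma> v" "\<not> first \<sigma> < m" for \<sigma> v M k
  proof -
    have dom: "{..<m} \<subseteq> dom \<sigma>" using first_props(4) s(4) by blast
    obtain \<phi> where \<phi>: "acyclic_edge_coloring {..<n} (ends ` {..<m}) q \<phi>" "\<And>i. i < m \<Longrightarrow> \<sigma> i = Some (\<phi> (ends i))"
      using complete_ex_coloring[OF s(1) dom] by blast
    have "([], v, M) \<in> final es"
      unfolding final_def outputs_coloring_def using \<phi> es repD(5)[OF s(2)] by auto
    moreover have "run B (0 + 1) ([While 10 round_code], v, M) = return_pmf ([], v, M)"
      using s(3,4) by (simp add: scanned_def bind_return_pmf)
    ultimately have "val B (final es) (0 + 1) ([While 10 round_code], v, M) = 1"
      unfolding val_def by (simp only: measure_return_pmf) (simp add: indicator_def)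
    then have "1 \<le> val B (final es) (0 + 1) ([While 10 round_code], v, M)" by simp
    also have "\<dots> \<le> val B (final es) (k + 1) ([While 10 round_code], v, M)" by (rule val_mono[OF G]) auto
    finally show ?thesis .
  qed
  {
    case 0
    then show ?case using complete[of \<sigma> M v 0] by (auto simp: val_def)
  next
    case (Suc N)
    show ?case
    proof (cases "first \<sigma> < m")
      case False
      then show ?thesis using complete[OF Suc.prems False] by simp
    next
      case True
      then have q: "0 < q" using colors by fastforce
      have "(\<Sum>c<q. color_avg (\<lambda>\<sigma>. 1 - fail N \<sigma>) \<sigma> (first \<sigma>) c) / q
        \<le> val B (final es) (round_time + (N * round_time + 1)) ([While 10 round_code], v, M)"
        by (rule val_round[OF G Suc.IH Suc.prems True])
      then show ?thesis
        using True q by (simp add: color_avg_compl sum_subtractf diff_divide_distrib add.assoc)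
    qed
  }
qed

end

section \<open>Preparing the registers and the memory\<close>

definition prepare_code :: "instr list" where
  "prepare_code = [Const 0 0, Const 3 1, Const 4 2, Add 17 1 1, Add 5 17 1, Add 8 17 3, Add 6 5 8, Add 6 6 3,
     Add 7 6 1, Add 29 7 1, Add 29 29 3, Add 16 17 0] @
     [While 16 ([Sub 16 16 3, Load 19 16, Add 20 29 0] @
        ([While 19 [Add 20 20 2, Sub 19 19 3]] @ [Store 16 20]))]"

definition coloring_program :: "instr list" where
  "coloring_program = prepare_code @ scan_code @ [While 10 round_code]"

context coloring_machine begin

text \<open>The product \<open>x * q\<close> in \<open>row x\<close> is built by \<open>x\<close>
  additions, fewer than \<open>n\<close> for each of the \<open>2 * m\<close> ends, which takes time
  of order \<open>m * n\<close>. The cells are converted from the last one down, so after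
  \<open>k\<close> iterations those from \<open>2 * m - k\<close> on are done.\<close>

lemma wp_prepare:
  assumes v: "v 1 = m" "v 2 = q"
    and M: "\<And>j. j < m \<Longrightarrow> M (2 * j) = p j \<and> M (2 * j + 1) = r j" "\<And>a. 2 * m \<le> a \<Longrightarrow> M a = 0"
  shows "wp B prepare_code (12 + (2 * m * (3 * n + 6) + 1)) (\<lambda>(v', M'). regs v' \<and> rep Map.empty M') (v, M)"
proof -
  have Mn: "M a < n" if "a < 2 * m" for a
  proof -
    have "a = 2 * (a div 2) \<or> a = 2 * (a div 2) + 1" by presburger
    moreover have "a div 2 < m" using that by simp
    ultimately show ?thesis using M(1)[of "a div 2"] vert[of "a div 2"] by metis
  qed
  let ?M = "\<lambda>k a. if a < 2 * m \<and> 2 * m - k \<le> a then row (M a) else M a"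
  let ?I = "\<lambda>k (v', M'). regs v' \<and> v' 29 = 7 * m + 3 \<and> v' 16 = 2 * m - k \<and> M' = ?M k"
  have init: "wp B [Const 0 0, Const 3 1, Const 4 2, Add 17 1 1, Add 5 17 1, Add 8 17 3, Add 6 5 8, Add 6 6 3,
     Add 7 6 1, Add 29 7 1, Add 29 29 3, Add 16 17 0] 12 (?I 0) (v, M)"
  proof -
    have "?M 0 = M" by auto
    then show ?thesis using v B_bound by (simp add: wp_simps regs_def)
  qed
  let ?inner = "[Add 20 20 2, Sub 19 19 3]"
  let ?body = "[Sub 16 16 3, Load 19 16, Add 20 29 0] @ ([While 19 ?inner] @ [Store 16 20])"
  have loop: "wp B [While 16 ?body] (2 * m * ((3 * n + 5) + 1) + 1) (?I (2 * m)) st'" if "?I 0 st'" for st'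
  proof (rule wp_While_const[where I = ?I, OF that])
    fix k v' M' assume k: "k < 2 * m" and I: "?I k (v', M')"
    let ?a = "2 * m - Suc k"
    have a: "?a < 2 * m" "M' ?a = M ?a" "M ?a < n" using k I Mn[of ?a] by auto
    have rb: "2 * row (M ?a) + 6 * m + 30 \<le> B" using row_bound[OF a(3), of 0] by simp
    have nB: "n \<le> B"
    proof (cases "q = 0")
      case True
      then show ?thesis using colors k by simp
    next
      case False
      then have "n \<le> (n + 1) * q" by (cases q) auto
      then show ?thesis using B by linarith
    qed
    let ?J = "\<lambda>l (v1, M1). regs v1 \<and> v1 29 = 7 * m + 3 \<and> v1 16 = ?a \<and> M1 = M' \<and> v1 20 = row l \<and> v1 19 = M ?a - l"
    have pre: "wp B [Sub 16 16 3, Load 19 16, Add 20 29 0] 3 (?J 0) (v', M')"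
    proof -
      have "regs v'" "v' 29 = 7 * m + 3" "v' 16 = 2 * m - k" using I by auto
      moreover have "2 * m - k - 1 = ?a" by simp
      ultimately show ?thesis using k a(2,3) nB B_bound by (simp add: wp_simps regs_def row_def)
    qed
    have inner: "wp B [While 19 ?inner] (M ?a * (2 + 1) + 1) (?J (M ?a)) st1" if "?J 0 st1" for st1
    proof (rule wp_While_const[where I = ?J, OF that])
      fix l v1 M1 assume l: "l < M ?a" and J: "?J l (v1, M1)"
      have "row (Suc l) \<le> row (M ?a)" using l by (simp add: row_def del: mult_Suc)
      moreover have "row l + q = row (Suc l)" by (simp add: row_def)
      ultimately have "wp B ?inner 2 (?J (Suc l)) (v1, M1)"
        using J l a nB rb by (simp add: wp_simps regs_def)
      then show "v1 19 \<noteq> 0 \<and> wp B ?inner 2 (?J (Suc l)) (v1, M1)" using J l by simp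
    qed auto
    have fin: "wp B [Store 16 20] 1 (?I (Suc k)) st1" if J: "?J (M ?a) st1" for st1
    proof -
      obtain v1 M1 where st1: "st1 = (v1, M1)" by fastforce
      have J': "regs v1" "v1 29 = 7 * m + 3" "v1 16 = ?a" "M1 = M'" "v1 20 = row (M ?a)" using J by (auto simp: st1)
      have "M'(?a := row (M ?a)) = ?M (Suc k)"
      proof
        fix b
        have "2 * m - Suc k \<le> b \<longleftrightarrow> b = ?a \<or> 2 * m - k \<le> b" using k by linarith
        then show "(M'(?a := row (M ?a))) b = ?M (Suc k) b" using I k by auto
      qed
      then show ?thesis unfolding st1 using J' by (simp add: wp_simps)
    qed
    have "wp B ?body (3 + ((M ?a * (2 + 1) + 1) + 1)) (?I (Suc k)) (v', M')"
      by (rule wp_seq[OF pre], rule wp_seq[OF inner], assumption, rule fin)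
    then have "wp B ?body (3 * n + 5) (?I (Suc k)) (v', M')"
      by (rule wp_mono) (use a(3) in auto)
    then show "v' 16 \<noteq> 0 \<and> wp B ?body (3 * n + 5) (?I (Suc k)) (v', M')" using I k by simp
  qed auto
  have "wp B prepare_code (12 + (2 * m * ((3 * n + 5) + 1) + 1)) (?I (2 * m)) (v, M)"
    unfolding prepare_code_def by (rule wp_seq[OF init], rule loop)
  moreover have "rep Map.empty (?M (2 * m))"
    unfolding rep_def using M by (auto simp: flag_def row_def)
  ultimately show ?thesis by (auto elim!: wp_mono)
qed

section \<open>Running time and success probability\<close>

text \<open>Every edge is counted at its end \<open>p i\<close>. The bound is what fits
  \<open>m * m\<close> into the time limit.\<close>

lemma card_edges_le: "m \<le> n * (D + 1)"
proof -
  have "{..<m} = (\<Union>w<n. {i. i < m \<and> p i = w})" using vert by auto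
  then have "m = card (\<Union>w<n. {i. i < m \<and> p i = w})" by (metis card_lessThan)
  also have "\<dots> \<le> (\<Sum>w<n. card {i. i < m \<and> p i = w})" by (rule card_UN_le) simp
  also have "\<dots> \<le> (\<Sum>w<n. D + 1)"
  proof (rule sum_mono)
    fix w
    have "card {i. i < m \<and> p i = w} \<le> card {i. i < m \<and> w \<in> ends i}" by (rule card_mono) auto
    then show "card {i. i < m \<and> p i = w} \<le> D + 1" using card_incident[of w] by simp
  qed
  finally show ?thesis by simp
qed

lemma val_program:
  assumes es: "length es = m" "\<And>i. i < m \<Longrightarrow> es ! i = (p i, r i)"
    and T: "12 + (2 * m * (3 * n + 6) + 1) + ((5 * m + 10) + (N * round_time + 1)) \<le> T"
  shows "1 - fail N Map.empty \<le> measure_pmf.prob (run B T (initial coloring_program n es q)) (final es)"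
proof -
  have G: "\<And>cfg. cfg \<in> final es \<Longrightarrow> fst cfg = []" by (auto simp: final_def outputs_coloring_def)
  let ?v = "\<lambda>i. if i = 0 then n else if i = 1 then length es else if i = 2 then q else (0::nat)"
  let ?M = "\<lambda>a. if a < 2 * length es then (if even a then fst else snd) (es ! (a div 2)) else 0"
  have edge: "edge (es ! i) = ends i" if "i < m" for i using es(2)[OF that] by (simp add: edge_def ends_def)
  have "1 - fail N Map.empty \<le> val B (final es) (12 + (2 * m * (3 * n + 6) + 1) + ((5 * m + 10) + (N * round_time + 1)))
     (prepare_code @ (scan_code @ [While 10 round_code]), ?v, ?M)"
  proof (rule val_wp[OF G wp_prepare])
    fix st assume "case st of (v', M') \<Rightarrow> regs v' \<and> rep Map.empty M'"
    then obtain v' M' where st: "st = (v', M')" "regs v'" "rep Map.empty M'" by (cases st) auto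
    have sc: "wp B scan_code (5 * m + 10) (\<lambda>(v'', M''). M'' = M' \<and> scanned Map.empty v'') (v', M')"
      by (rule wp_scan[OF st(3) _ st(2)]) (use good_empty in \<open>simp add: good_def\<close>)
    show "1 - fail N Map.empty \<le> val B (final es) ((5 * m + 10) + (N * round_time + 1)) (scan_code @ [While 10 round_code], st)"
      unfolding st(1)
    proof (rule val_wp[OF G sc])
      fix st'' assume P: "case st'' of (v'', M'') \<Rightarrow> M'' = M' \<and> scanned Map.empty v''"
      obtain v'' M'' where st'': "st'' = (v'', M'')" by fastforce
      show "1 - fail N Map.empty \<le> val B (final es) (N * round_time + 1) ([While 10 round_code], st'')"
        unfolding st'' by (rule val_loop[OF es(1) edge good_empty]) (use P st(3) st'' in auto)
    qed
  qed (use es in auto)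
  also have "\<dots> \<le> val B (final es) T (prepare_code @ (scan_code @ [While 10 round_code]), ?v, ?M)"
    by (rule val_mono[OF G T])
  finally show ?thesis by (simp add: val_def initial_def coloring_program_def)
qed

end

text \<open>The constants are absorbed by \<open>64 = 2 ^ 6\<close>, hence by six of the eight
  factors.\<close>

lemma word_bound: "2 * ((n + 1) * q) + 20 * m + 40 \<le> (n + m + q + 2) ^ 8" for n m q :: nat
proof -
  let ?S = "n + m + q + 2"
  have "(n + 1) * q \<le> ?S * ?S" by (intro mult_le_mono) auto
  moreover have "m \<le> ?S" by simp
  moreover have "2 * ?S \<le> ?S * ?S" "4 \<le> ?S * ?S" using mult_le_mono[of 2 ?S 2 ?S] by auto
  moreover have "2 * x + 20 * m + 40 \<le> 64 * y" if "x \<le> y" "m \<le> z" "2 * z \<le> y" "4 \<le> y" for x y z :: nat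
    using that by linarith
  ultimately have "2 * ((n + 1) * q) + 20 * m + 40 \<le> 64 * (?S * ?S)" by blast
  also have "\<dots> \<le> ?S ^ 6 * (?S * ?S)"
    using power_mono[of 2 ?S 6] by (intro mult_right_mono) auto
  also have "\<dots> = ?S ^ 8" unfolding power2_eq_square[symmetric] power_add[symmetric] by simp
  finally show ?thesis .
qed

text \<open>The \<open>A * m\<close> rounds are estimated with \<open>n\<close> in place of
  \<open>min n m\<close> and the \<open>A * c * n\<close> rounds with \<open>m\<close> in its place;
  either way the walks cost a multiple of \<open>m * n * (D + 1)\<close>. The constant 184 is
  \<open>41 + 114 + 29\<close>.\<close>

lemma program_time_bound:
  fixes A c m n D :: nat
  assumes "1 \<le> m" "1 \<le> n" "m \<le> n * (D + 1)"
  shows "12 + (2 * m * (3 * n + 6) + 1) + ((5 * m + 10) +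
      (A * (m + c * n) * (4 + 14 * m + (D + 1) * (16 * min n m + 13) + 27 * m + 110) + 1))
    \<le> (184 * A * (1 + c) + 50) * (m * n * (D + 1) + 1)"
proof -
  let ?Z = "m * n * (D + 1)"
  let ?R = "4 + 14 * m + (D + 1) * (16 * min n m + 13) + 27 * m + 110"
  have z1: "m * m \<le> ?Z" using mult_le_mono2[OF assms(3), of m] by (simp only: mult.assoc)
  have mn: "m * n \<le> ?Z" by simp
  have m: "m \<le> m * n" "n \<le> m * n" using assms by auto
  have mD: "m * (D + 1) \<le> ?Z" "n * (D + 1) \<le> ?Z"
    using mult_le_mono1[OF m(1), of "D + 1"] mult_le_mono1[OF m(2), of "D + 1"] by (simp_all only:)
  have "m * ((D + 1) * (16 * min n m + 13)) \<le> m * ((D + 1) * (16 * n + 13))"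
    by (intro mult_le_mono2 add_le_mono1) auto
  also have "\<dots> = 16 * ?Z + 13 * (m * (D + 1))" by (simp add: algebra_simps)
  finally have w1: "m * ((D + 1) * (16 * min n m + 13)) \<le> 29 * ?Z" using mD by linarith
  have "n * ((D + 1) * (16 * min n m + 13)) \<le> n * ((D + 1) * (16 * m + 13))"
    by (intro mult_le_mono2 add_le_mono1) auto
  also have "\<dots> = 16 * ?Z + 13 * (n * (D + 1))" by (simp add: algebra_simps)
  finally have w2: "n * ((D + 1) * (16 * min n m + 13)) \<le> 29 * ?Z" using mD by linarith
  have "m * ?R = 41 * (m * m) + 114 * m + m * ((D + 1) * (16 * min n m + 13))" by (simp add: algebra_simps)
  then have r1: "m * ?R \<le> 184 * ?Z" using z1 m mn w1 by linarith
  have "n * ?R = 41 * (m * n) + 114 * n + n * ((D + 1) * (16 * min n m + 13))" by (simp add: algebra_simps)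
  then have r2: "n * ?R \<le> 184 * ?Z" using m mn w2 by linarith
  have "A * (m + c * n) * ?R = A * (m * ?R) + A * c * (n * ?R)" by (simp only: algebra_simps)
  also have "\<dots> \<le> A * (184 * ?Z) + A * c * (184 * ?Z)" by (intro add_mono mult_le_mono2 r1 r2)
  also have "\<dots> = 184 * A * (1 + c) * ?Z" by (simp add: algebra_simps)
  finally have main: "A * (m + c * n) * ?R \<le> 184 * A * (1 + c) * ?Z" .
  have "2 * m * (3 * n + 6) = 6 * (m * n) + 12 * m" by (simp add: algebra_simps)
  then have "2 * m * (3 * n + 6) + 5 * m \<le> 23 * ?Z" using m mn by linarith
  moreover have "(184 * A * (1 + c) + 50) * (?Z + 1) = 184 * A * (1 + c) * ?Z + 50 * ?Z + 184 * A * (1 + c) + 50"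
    by (simp add: algebra_simps)
  ultimately show ?thesis using main by linarith
qed

lemma coloring_program_correct: "finds_acyclic_edge_colorings_whp coloring_program"
proof -
  \<comment> \<open>Per edge, \<open>A\<close> rounds outweigh the factor \<open>5/2\<close> of
    \<open>fail_empty_le\<close>, since \<open>5/2 * (1/4)\<close> is below \<open>1\<close>. The
    remaining \<open>c * n\<close> blocks of \<open>A\<close> rounds yield
    \<open>(1/4) ^ (c * n)\<close>, which is at most \<open>1 / real n ^ c\<close>.\<close>
  obtain A where A: "(996/1000 :: real) ^ A < 1/4" using real_arch_pow_inv[of "1/4" "996/1000 :: real"] by auto
  show ?thesis unfolding finds_acyclic_edge_colorings_whp_def
  proof (rule exI[of _ 8], rule allI)
    fix c
    show "\<exists>C. \<forall>n E es q. sgraph {..<n} E \<longrightarrow> edge_list E es \<longrightarrow> 4 * (int (max_degree {..<n} E) - 1) < int q \<longrightarrow>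
      1 - 1 / real n ^ c \<le> measure_pmf.prob (run ((n + card E + q + 2) ^ 8) (C * (card E * n * max_degree {..<n} E + 1))
         (initial coloring_program n es q))
        {cfg. \<exists>\<phi>. acyclic_edge_coloring {..<n} E q \<phi> \<and> outputs_coloring es \<phi> cfg}"
    proof (rule exI[of _ "184 * A * (1 + c) + 50"], intro allI impI)
      fix n E es q
      assume g: "sgraph {..<n} E" and el: "edge_list E es" and q: "4 * (int (max_degree {..<n} E) - 1) < int q"
      let ?m = "card E" and ?p = "\<lambda>i. fst (es ! i)" and ?r = "\<lambda>i. snd (es ! i)" and ?\<Delta> = "max_degree {..<n} E"
      have len: "length es = ?m" using el by (metis distinct_card edge_list_def length_map)
      have ed: "edge (es ! i) = {?p i, ?r i}" for i by (simp add: edge_def case_prod_unfold)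
      have bij: "bij_betw (\<lambda>i. {?p i, ?r i}) {..<?m} E"
        unfolding bij_betw_def
      proof
        have d: "distinct (map edge es)" and s: "set (map edge es) = E" using el by (auto simp: edge_list_def)
        show "inj_on (\<lambda>i. {?p i, ?r i}) {..<?m}"
        proof (rule inj_onI)
          fix i j assume ij: "i \<in> {..<?m}" "j \<in> {..<?m}" "{?p i, ?r i} = {?p j, ?r j}"
          then have "map edge es ! i = map edge es ! j" using len by (simp add: ed)
          then show "i = j" using d ij len by (subst (asm) nth_eq_iff_index_eq) auto
        qed
        have "(!) es ` {..<length es} = set es" using nth_image[of "length es" es] by (simp add: atLeast0LessThan)
        then have "set (map edge es) = edge ` ((!) es ` {..<length es})" by (simp only: set_map)
        also have "\<dots> = (\<lambda>i. edge (es ! i)) ` {..<length es}" by (rule image_image)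
        finally have "set (map edge es) = (\<lambda>i. edge (es ! i)) ` {..<length es}" .
        then have "(\<lambda>i. edge (es ! i)) ` {..<?m} = E" using s len by simp
        then show "(\<lambda>i. {?p i, ?r i}) ` {..<?m} = E" by (simp add: ed)
      qed
      interpret coloring_instance ?m ?p ?r q "?\<Delta> - 1" by (rule coloring_instance_of_sgraph[OF g q bij])
      have endE: "ends ` {..<?m} = E" using bij by (simp add: bij_betw_def ends_def)
      have vE: "ends i \<subseteq> {..<n}" if "i < ?m" for i
        using endE that g by (auto simp: sgraph_def)
      interpret coloring_machine ?m ?p ?r q "?\<Delta> - 1" n "(n + ?m + q + 2) ^ 8"
        by unfold_locales (use vE word_bound[of n q ?m] in \<open>auto simp: ends_def\<close>)
      \<comment> \<open>Without edges the time limit does not grow with \<open>n\<close>, so there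
        must be no rounds; the empty coloring is already complete.\<close>
      define N where "N = (if ?m = 0 then 0 else A * (?m + c * n))"
      have time: "12 + (2 * ?m * (3 * n + 6) + 1) + ((5 * ?m + 10) + (N * round_time + 1))
        \<le> (184 * A * (1 + c) + 50) * (?m * n * ?\<Delta> + 1)"
      proof (cases "?m = 0")
        case True
        then show ?thesis by (simp add: N_def)
      next
        case False
        have "0 < ?\<Delta>"
        proof (rule ccontr)
          assume "\<not> 0 < ?\<Delta>"
          moreover have "card {e \<in> E. ?p 0 \<in> e} \<le> ?\<Delta>" by (rule max_degree_ge[OF g])
          moreover have "ends 0 \<in> {e \<in> E. ?p 0 \<in> e}" using endE False by (auto simp: ends_def)
          ultimately show False using sgraph_finite[OF g] by (auto simp: card_eq_0_iff)
        qed
        moreover have "1 \<le> n" using vE[of 0] False by (auto simp: ends_def)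
        ultimately show ?thesis
          unfolding round_time_def detect_time_def
          using program_time_bound[OF _ _ card_edges_le, of A c] False by (simp add: N_def)
      qed
      have "fail N Map.empty \<le> 1 / real n ^ c"
      proof (cases "?m = 0")
        case True
        then have N0: "N = 0" by (simp add: N_def)
        have "\<not> first Map.empty < ?m" using True by linarith
        then have "fail N Map.empty = 0" unfolding N0 by (simp only: fail.simps if_False)
        then show ?thesis by (rule ord_eq_le_trans) simp
      next
        case False
        then have n: "1 \<le> n" using vE[of 0] by (auto simp: ends_def)
        have "fail N Map.empty \<le> (5/2) ^ ?m * (996/1000) ^ N" by (rule fail_empty_le)
        also have "(996/1000 :: real) ^ N = ((996/1000) ^ A) ^ (?m + c * n)" using False by (simp add: N_def power_mult)
        also have "(5/2) ^ ?m * \<dots> \<le> (5/2) ^ ?m * (1/4) ^ (?m + c * n)"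
          using A by (intro mult_left_mono power_mono) auto
        also have "\<dots> = (5/2 * (1/4)) ^ ?m * (1/4) ^ (c * n)" by (simp only: power_add power_mult_distrib mult.assoc)
        also have "\<dots> \<le> 1 * (1/2) ^ (n * c)"
          by (intro mult_mono) (auto intro: power_le_one power_mono simp: mult.commute)
        also have "\<dots> = (1 / 2 ^ n) ^ c" by (simp add: power_mult power_one_over)
        also have "\<dots> \<le> (1 / real n) ^ c"
          using n less_exp[of n] by (intro power_mono divide_left_mono) (auto simp flip: of_nat_power)
        also have "\<dots> = 1 / real n ^ c" by (simp add: power_one_over)
        finally show ?thesis .
      qed
      moreover have "1 - fail N Map.empty \<le> measure_pmf.prob (run ((n + ?m + q + 2) ^ 8)
          ((184 * A * (1 + c) + 50) * (?m * n * ?\<Delta> + 1)) (initial coloring_program n es q)) (final es)"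
        by (rule val_program[OF len _ time]) simp
      ultimately show "1 - 1 / real n ^ c \<le> measure_pmf.prob (run ((n + ?m + q + 2) ^ 8)
          ((184 * A * (1 + c) + 50) * (?m * n * ?\<Delta> + 1)) (initial coloring_program n es q))
        {cfg. \<exists>\<phi>. acyclic_edge_coloring {..<n} E q \<phi> \<and> outputs_coloring es \<phi> cfg}"
        unfolding final_def endE by linarith
    qed
  qed
qed

theorem theorem5p5:
  shows "(\<forall>(V :: 'a set) E \<Delta> q.
            sgraph V E \<longrightarrow> max_degree V E = \<Delta> \<longrightarrow> int q > 4 * (int \<Delta> - 1) \<longrightarrow>
            (\<exists>\<phi>. acyclic_edge_coloring V E q \<phi>))
       \<and> (\<exists>P. finds_acyclic_edge_colorings_whp P)"
  using acyclic_edge_coloring_exists coloring_program_correct by blast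

end
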